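(* Assume that conditions (C1), (C2), (C3) and (C5) listed in the context hold. Then $$\sup_{t\in[a,b]}|\widehat\mu(t)-\mu(t)|=O\bigl(h_\mu^{2}+\delta_{n1}(h_\mu)\bigr)\quad\text{almost surely, as } n\to\infty.$$
   Context: Model. $X=\{X(t):t\in[a,b]\}$ is a stochastic process on a fixed interval $[a,b]$ with mean function $\mu(t)=\mathbb{E}\{X(t)\}$ and covariance function $R(s,t)=\operatorname{cov}\{X(s),X(t)\}$, assumed to exist. One observes $Y_{ij}=X_i(T_{ij})+U_{ij}$, $i=1,\dots,n$, $j=1,\dots,m_i$, where the $X_i$ are independent realizations of $X$, the $T_{ij}$ are random points in $[a,b]$ with density $f_T$, and the $U_{ij}$ are identically distributed errors with mean zero and finite variance $\sigma^2$; the $X_i$, $T_{ij}$, $U_{ij}$ are all independent. The numbers $m_i\ge 2$ may depend on $n$ ($m_i=m_{in}$). Notation. $K$ is a kernel and $K_h(t)=(1/h)K(t/h)$. $\gamma_{nk}=\bigl(n^{-1}\sum_{i=1}^n m_i^{-k}\bigr)^{-1}$ for $k=1,2,\dots$, and for a bandwidth $h$, $\delta_{n1}(h)=[\{1+(h\gamma_{n1})^{-1}\}\log n/n]^{1/2}$. $h_\mu=h_{\mu,n}>0$ is a bandwidth depending on $n$. Estimator. $\widehat\mu(t)=\widehat a_0$, where $(\widehat a_0,\widehat a_1)$ minimizes over $(a_0,a_1)$ $$\frac1n\sum_{i=1}^n\frac1{m_i}\sum_{j=1}^{m_i}\{Y_{ij}-a_0-a_1(T_{ij}-t)\}^2K_{h_\mu}(T_{ij}-t).$$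 Equivalently $\widehat\mu(t)=(R_0S_2-R_1S_1)/(S_0S_2-S_1^2)$ with $S_r=\frac1n\sum_i\frac1{m_i}\sum_j K_{h_\mu}(T_{ij}-t)\{(T_{ij}-t)/h_\mu\}^r$ and $R_r=\frac1n\sum_i\frac1{m_i}\sum_j K_{h_\mu}(T_{ij}-t)\{(T_{ij}-t)/h_\mu\}^rY_{ij}$. Conditions. (C1) For some constants $m_T>0$ and $M_T<\infty$, $m_T\le f_T(t)\le M_T$ for all $t\in[a,b]$; $f_T$ is differentiable with a bounded derivative. (C2) $K$ is a symmetric probability density function on $[-1,1]$ and is of bounded variation on $[-1,1]$. (C3) $\mu$ is twice differentiable and its second derivative is bounded on $[a,b]$. (C5) $\mathbb{E}(|U_{ij}|^{\lambda_\mu})<\infty$ and $\mathbb{E}(\sup_{t\in[a,b]}|X(t)|^{\lambda_\mu})<\infty$ for some $\lambda_\mu\in(2,\infty)$; $h_\mu\to0$ and $(h_\mu^2+h_\mu/\gamma_{n1})^{-1}(\log n/n)^{1-2/\lambda_\mu}\to0$ as $n\to\infty$. *)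

theory Defs
  imports "HOL-Probability.Probability" "HOL-Library.Landau_Symbols"
begin

(* Processes are random elements of a measurable space S of paths, so that "independent
   realizations" refers to whole paths and not only to finite-dimensional distributions.
   The two requirements make X_i(T_ij) and the supremum over [a,b] of |X(t)| measurable.
   Path values outside [a,b] play no role. *)
definition path_space :: "real \<Rightarrow> real \<Rightarrow> (real \<Rightarrow> real) measure \<Rightarrow> bool" where
  "path_space a b S \<longleftrightarrow>
     (\<lambda>(x, t). x t) \<in> borel_measurable (S \<Otimes>\<^sub>M restrict_space borel {a..b}) \<and>
     (\<lambda>x. SUP t\<in>{a..b}. ennreal \<bar>x t\<bar>) \<in> borel_measurable S"

definition mean_function :: "'w measure \<Rightarrow> ('w \<Rightarrow> real \<Rightarrow> real) \<Rightarrow> real \<Rightarrow> real" where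
  "mean_function M X t = (LINT \<omega>|M. X \<omega> t)"

datatype source = Curve nat | Time nat nat | Error nat nat

definition generated_events ::
    "'w measure \<Rightarrow> 'b measure \<Rightarrow> ('w \<Rightarrow> 'b) \<Rightarrow> 'w set set" where
  "generated_events M N f = {f -` A \<inter> space M | A. A \<in> sets N}"

(* Indices i and j start at 0.  The curves, observation times and errors form one array that
   does not depend on n; for sample size n the data are those with i < n and j < m n i. *)
locale functional_data = prob_space M
  for M :: "'w measure"
    and a b :: real
    and S :: "(real \<Rightarrow> real) measure"
    and X :: "'w \<Rightarrow> real \<Rightarrow> real"
    and Xs :: "nat \<Rightarrow> 'w \<Rightarrow> real \<Rightarrow> real"
    and T U :: "nat \<Rightarrow> nat \<Rightarrow> 'w \<Rightarrow> real"
    and f\<^sub>T :: "real \<Rightarrow> real"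
    and \<sigma> :: real
    and m :: "nat \<Rightarrow> nat \<Rightarrow> nat" +
  assumes interval: "a < b"
    and path_space: "path_space a b S"
    and X_measurable: "X \<in> measurable M S"
    and X_mean_exists: "\<And>t. t \<in> {a..b} \<Longrightarrow> integrable M (\<lambda>\<omega>. X \<omega> t)"
    and X_cov_exists: "\<And>s t. s \<in> {a..b} \<Longrightarrow> t \<in> {a..b} \<Longrightarrow>
      integrable M (\<lambda>\<omega>. (X \<omega> s - mean_function M X s) * (X \<omega> t - mean_function M X t))"
    and Xs_measurable: "\<And>i. Xs i \<in> measurable M S"
    and Xs_distr: "\<And>i. distr M S (Xs i) = distr M S X"
    and T_range: "\<And>i j \<omega>. \<omega> \<in> space M \<Longrightarrow> T i j \<omega> \<in> {a..b}"
    and T_density: "\<And>i j. distributed M lborel (T i j) (\<lambda>t. ennreal (f\<^sub>T t) * indicator {a..b} t)"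
    and U_measurable: "\<And>i j. U i j \<in> borel_measurable M"
    and U_distr: "\<And>i j i' j'. distr M borel (U i j) = distr M borel (U i' j')"
    and U_integrable: "\<And>i j. integrable M (U i j)"
    and U_mean: "\<And>i j. expectation (U i j) = 0"
    and U_square_integrable: "\<And>i j. integrable M (\<lambda>\<omega>. (U i j \<omega>)\<^sup>2)"
    and U_variance: "\<And>i j. variance (U i j) = \<sigma>\<^sup>2"
    and independent: "indep_sets (\<lambda>k. case k of
          Curve i \<Rightarrow> generated_events M S (Xs i)
        | Time i j \<Rightarrow> generated_events M borel (T i j)
        | Error i j \<Rightarrow> generated_events M borel (U i j)) UNIV"
    and m_ge_2: "\<And>n i. i < n \<Longrightarrow> 2 \<le> m n i"

definition observation ::
    "(nat \<Rightarrow> 'w \<Rightarrow> real \<Rightarrow> real) \<Rightarrow> (nat \<Rightarrow> nat \<Rightarrow> 'w \<Rightarrow> real) \<Rightarrow> (nat \<Rightarrow> nat \<Rightarrow> 'w \<Rightarrow> real) \<Rightarrow>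
     nat \<Rightarrow> nat \<Rightarrow> 'w \<Rightarrow> real" where
  "observation Xs T U i j \<omega> = Xs i \<omega> (T i j \<omega>) + U i j \<omega>"

definition scaled_kernel :: "(real \<Rightarrow> real) \<Rightarrow> real \<Rightarrow> real \<Rightarrow> real" where
  "scaled_kernel K h t = (1 / h) * K (t / h)"

definition gamma_n :: "(nat \<Rightarrow> nat \<Rightarrow> nat) \<Rightarrow> nat \<Rightarrow> nat \<Rightarrow> real" where
  "gamma_n m n k = inverse ((1 / real n) * (\<Sum>i<n. 1 / real (m n i) ^ k))"

definition delta_n1 :: "(nat \<Rightarrow> nat \<Rightarrow> nat) \<Rightarrow> nat \<Rightarrow> real \<Rightarrow> real" where
  "delta_n1 m n h = sqrt ((1 + inverse (h * gamma_n m n 1)) * ln (real n) / real n)"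

definition local_linear_loss ::
    "(real \<Rightarrow> real) \<Rightarrow> real \<Rightarrow> nat \<Rightarrow> (nat \<Rightarrow> nat) \<Rightarrow> (nat \<Rightarrow> nat \<Rightarrow> real) \<Rightarrow> (nat \<Rightarrow> nat \<Rightarrow> real) \<Rightarrow>
     real \<Rightarrow> real \<times> real \<Rightarrow> real" where
  "local_linear_loss K h n k \<tau> y t = (\<lambda>(a0, a1).
     (1 / real n) * (\<Sum>i<n. (1 / real (k i)) *
       (\<Sum>j<k i. (y i j - a0 - a1 * (\<tau> i j - t))\<^sup>2 * scaled_kernel K h (\<tau> i j - t))))"

(* A minimizer always exists, but it need not be unique when few of the observation times fall
   in the window around t; every choice of minimizers is then admitted. *)
definition is_local_linear_estimator ::
    "'w measure \<Rightarrow> real \<Rightarrow> real \<Rightarrow> (nat \<Rightarrow> 'w \<Rightarrow> real \<Rightarrow> real) \<Rightarrow> (nat \<Rightarrow> nat \<Rightarrow> 'w \<Rightarrow> real) \<Rightarrow>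
     (nat \<Rightarrow> nat \<Rightarrow> 'w \<Rightarrow> real) \<Rightarrow> (nat \<Rightarrow> nat \<Rightarrow> nat) \<Rightarrow> (real \<Rightarrow> real) \<Rightarrow> (nat \<Rightarrow> real) \<Rightarrow>
     (nat \<Rightarrow> 'w \<Rightarrow> real \<Rightarrow> real) \<Rightarrow> bool" where
  "is_local_linear_estimator M a b Xs T U m K h \<mu>hat \<longleftrightarrow>
     (\<forall>n\<ge>1. \<forall>\<omega>\<in>space M. \<forall>t\<in>{a..b}. \<exists>a1.
        is_arg_min
          (local_linear_loss K (h n) n (m n) (\<lambda>i j. T i j \<omega>) (\<lambda>i j. observation Xs T U i j \<omega>) t)
          (\<lambda>_. True) (\<mu>hat n \<omega> t, a1))"

definition bounded_variation_on :: "(real \<Rightarrow> real) \<Rightarrow> real \<Rightarrow> real \<Rightarrow> bool" where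
  "bounded_variation_on f c d \<longleftrightarrow>
     (\<exists>V. \<forall>(N::nat) x. mono_on {..N} x \<and> x ` {..N} \<subseteq> {c..d} \<longrightarrow>
        (\<Sum>l<N. \<bar>f (x (Suc l)) - f (x l)\<bar>) \<le> V)"

definition condition_C1 :: "real \<Rightarrow> real \<Rightarrow> (real \<Rightarrow> real) \<Rightarrow> bool" where
  "condition_C1 a b f \<longleftrightarrow>
     (\<exists>m\<^sub>T M\<^sub>T. m\<^sub>T > 0 \<and> (\<forall>t\<in>{a..b}. m\<^sub>T \<le> f t \<and> f t \<le> M\<^sub>T)) \<and>
     (\<exists>f'. (\<forall>t\<in>{a..b}. (f has_real_derivative f' t) (at t within {a..b})) \<and>
           bounded (f' ` {a..b}))"

definition condition_C2 :: "(real \<Rightarrow> real) \<Rightarrow> bool" where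
  "condition_C2 K \<longleftrightarrow>
     (\<forall>u. 0 \<le> K u) \<and> (\<forall>u. K (- u) = K u) \<and> (\<forall>u. u \<notin> {-1..1} \<longrightarrow> K u = 0) \<and>
     has_bochner_integral lborel K 1 \<and> bounded_variation_on K (-1) 1"

definition condition_C3 :: "real \<Rightarrow> real \<Rightarrow> (real \<Rightarrow> real) \<Rightarrow> bool" where
  "condition_C3 a b \<mu> \<longleftrightarrow>
     (\<exists>\<mu>' \<mu>''.
        (\<forall>t\<in>{a..b}. (\<mu> has_real_derivative \<mu>' t) (at t within {a..b})) \<and>
        (\<forall>t\<in>{a..b}. (\<mu>' has_real_derivative \<mu>'' t) (at t within {a..b})) \<and>
        bounded (\<mu>'' ` {a..b}))"

(* \<rho> is the moment exponent, common to the errors, the process and the bandwidth condition. *)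
definition condition_C5 ::
    "'w measure \<Rightarrow> real \<Rightarrow> real \<Rightarrow> ('w \<Rightarrow> real \<Rightarrow> real) \<Rightarrow> (nat \<Rightarrow> nat \<Rightarrow> 'w \<Rightarrow> real) \<Rightarrow>
     (nat \<Rightarrow> nat \<Rightarrow> nat) \<Rightarrow> (nat \<Rightarrow> real) \<Rightarrow> bool" where
  "condition_C5 M a b X U m h \<longleftrightarrow>
     (\<exists>\<rho>>2.
        (\<forall>i j. integrable M (\<lambda>\<omega>. \<bar>U i j \<omega>\<bar> powr \<rho>)) \<and>
        (\<integral>\<^sup>+\<omega>. (SUP t\<in>{a..b}. ennreal (\<bar>X \<omega> t\<bar> powr \<rho>)) \<partial>M) < \<infinity> \<and>
        h \<longlonglongrightarrow> 0 \<and>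
        (\<lambda>n. inverse ((h n)\<^sup>2 + h n / gamma_n m n 1) *
              (ln (real n) / real n) powr (1 - 2 / \<rho>)) \<longlonglongrightarrow> 0)"

end

theory Submission
  imports Defs
begin

text \<open>Write \<beta> = h^2 + h/\<gamma> for the order of the second moment of a within-curve average over a window of
width h, averaged over the curves, and r = (\<beta> log n / n)^(1/2) for the resulting fluctuation of an average
over n curves. Then r / h is the stochastic rate \<delta>, so the theorem says that the error is a Taylor
bias h^2 plus r / h.

The proof reduces kernel averages to plain sums over intervals. Since K and u K(u) have bounded
variation, summation by parts (weighted_sum_le_variation) bounds a kernel average of the noise
by the largest sum of the noise over an interval of length at most 2h. Since K also integrates to one,
it exceeds a positive constant on some interval (bounded_variation_positive_interval), so the
quadratic form of the least squares problem is bounded below by the numbers of design points in two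
short intervals. Comparing the loss at the minimizer with the loss at (\<mu>(t), \<mu>'(t)) then
gives the error bound (local_linear_error_bound) for every choice of minimizers.

It remains to control interval sums of the design counts and of the noise, uniformly over
intervals of length at most 2h, with error O(r) almost surely (uniform_interval_deviation). For
nonnegative summands these sums are monotone in the interval, so a grid of mesh of order 1/n is enough.
On the grid the row averages are truncated at the level \<beta>/r, for which a Chernoff bound yields
probabilities of order n^-4, and the Borel--Cantelli lemma applies. The signed noise is the
difference of its positive and negative parts, whose interval sums have equal means because the
noise has mean zero given the observation times (noise_window_mean_zero).

The delicate point is the truncation error. It is governed by (1/n) times the sum over the curves of
the \<rho>-th powers of the averages of |U_ij| over j < m_i. Because the m_i may change
with n, this is not a partial sum of one sequence, and a law of large numbers for the variables
|U_ij|^\<rho> with changing weights may fail under a bare first moment. A maximal inequality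
repairs this: E |U|^\<rho> is a second moment of |U|^(\<rho>/2), so dyadic block sums of
|U|^(\<rho>/2) have square summable normalized deviations, and one integrable variable per curve
dominates the \<rho>-th power of all its averages at once (AE_error_mean_le_error_max). These
variables are independent and identically distributed over the curves, and their partial sums grow
at most linearly (iid_partial_sums_linear).\<close>

section \<open>Functions of bounded variation\<close>

lemma abel_summation:
  fixes c g :: "nat \<Rightarrow> real"
  shows "(\<Sum>l\<le>N. c l * g l) =
    (\<Sum>i\<le>N. c i) * g N - (\<Sum>l<N. (\<Sum>i\<le>l. c i) * (g (Suc l) - g l))"
  by (induction N) (simp_all add: algebra_simps)

text \<open>Summation by parts along the sorted values of u: the increments of g are summed against the partial
sums of the weights, which are the quantities bounded by B. In the application B bounds sums over
intervals, so a kernel average costs no more than an interval sum.\<close>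

lemma weighted_sum_le_variation:
  fixes A :: "'k set" and u w :: "'k \<Rightarrow> real" and g :: "real \<Rightarrow> real"
  assumes fin: "finite A" and cd: "c \<le> d" and u: "\<And>k. k \<in> A \<Longrightarrow> u k \<in> {c..d}"
    and var: "\<And>(N::nat) x. mono_on {..N} x \<Longrightarrow> x ` {..N} \<subseteq> {c..d} \<Longrightarrow>
      (\<Sum>l<N. \<bar>g (x (Suc l)) - g (x l)\<bar>) \<le> V"
    and gb: "\<And>x. x \<in> {c..d} \<Longrightarrow> \<bar>g x\<bar> \<le> G"
    and B: "\<And>s. s \<in> {c..d} \<Longrightarrow> \<bar>\<Sum>k\<in>{k\<in>A. u k \<le> s}. w k\<bar> \<le> B"
  shows "\<bar>\<Sum>k\<in>A. w k * g (u k)\<bar> \<le> (G + V) * B"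
proof -
  have "0 \<le> V" using var[of 0 "\<lambda>_. c"] cd by (auto simp: mono_on_def)
  moreover have "0 \<le> B" using B[of c] cd by auto
  moreover have "0 \<le> G" using gb[of c] cd by auto
  ultimately have nn: "0 \<le> (G + V) * B" "0 \<le> B" "0 \<le> V" by auto
  show ?thesis
  proof (cases "A = {}")
    case True
    then show ?thesis using nn by simp
  next
    case False
    \<comment> \<open>Ties between values of u are grouped, so that the sequence x is strictly increasing.\<close>
    define xs where "xs = sorted_list_of_set (u ` A)"
    define N where "N = length xs - 1"
    define x where "x l = xs ! l" for l
    have set_xs: "set xs = u ` A" and dist: "distinct xs" and sorted: "sorted xs"
      using fin by (auto simp: xs_def)
    have "xs \<noteq> []" using set_xs False by auto
    then have len: "length xs = Suc N" by (simp add: N_def)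
    have img: "x ` {..N} = u ` A"
      unfolding set_xs[symmetric] x_def set_conv_nth len by (auto simp: less_Suc_eq_le)
    have mono: "mono_on {..N} x"
      using sorted len by (auto simp: mono_on_def x_def sorted_iff_nth_mono less_Suc_eq_le)
    have inj: "x i = x j \<longleftrightarrow> i = j" if "i \<le> N" "j \<le> N" for i j
      using dist that len by (simp add: x_def nth_eq_iff_index_eq)
    have range: "x ` {..N} \<subseteq> {c..d}" using img u by auto
    define cf where "cf l = (\<Sum>k\<in>{k\<in>A. u k = x l}. w k)" for l
    have part: "(\<Sum>i\<le>l. \<Sum>k\<in>{k\<in>A. u k = x i}. f k) = (\<Sum>k\<in>{k\<in>A. u k \<le> x l}. f k)"
      if "l \<le> N" for l and f :: "'k \<Rightarrow> real"
    proof -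
      have eq: "{k\<in>A. u k \<le> x l} = (\<Union>i\<in>{..l}. {k\<in>A. u k = x i})"
      proof (intro equalityI subsetI)
        fix k assume k: "k \<in> {k\<in>A. u k \<le> x l}"
        then have "u k \<in> x ` {..N}" unfolding img by auto
        then obtain i where i: "i \<le> N" "u k = x i" by auto
        have "i \<le> l"
        proof (rule ccontr)
          assume "\<not> i \<le> l"
          then have "x l \<le> x i" using mono i that by (auto simp: mono_on_def)
          with k i have "x l = x i" by auto
          then show False using inj[of l i] i that \<open>\<not> i \<le> l\<close> by auto
        qed
        then show "k \<in> (\<Union>i\<in>{..l}. {k\<in>A. u k = x i})" using k i by auto
      next
        fix k assume "k \<in> (\<Union>i\<in>{..l}. {k\<in>A. u k = x i})"
        then show "k \<in> {k\<in>A. u k \<le> x l}"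
          using mono that by (auto simp: mono_on_def)
      qed
      show ?thesis
        unfolding eq
      proof (rule sum.UNION_disjoint[symmetric])
        show "\<forall>i\<in>{..l}. \<forall>j\<in>{..l}. i \<noteq> j \<longrightarrow> {k \<in> A. u k = x i} \<inter> {k \<in> A. u k = x j} = {}"
          using inj that by auto
      qed (use fin in auto)
    qed
    have top: "{k\<in>A. u k \<le> x N} = A"
    proof -
      have "u k \<le> x N" if "k \<in> A" for k
      proof -
        have "u k \<in> x ` {..N}" using that img by auto
        then show ?thesis using mono by (auto simp: mono_on_def)
      qed
      then show ?thesis by auto
    qed
    have "(\<Sum>k\<in>A. w k * g (u k)) = (\<Sum>i\<le>N. \<Sum>k\<in>{k\<in>A. u k = x i}. w k * g (u k))"
      using part[of N "\<lambda>k. w k * g (u k)"] top by simp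
    also have "\<dots> = (\<Sum>i\<le>N. cf i * g (x i))"
      by (intro sum.cong refl) (auto simp: cf_def sum_distrib_right)
    also have "\<dots> = (\<Sum>i\<le>N. cf i) * g (x N)
        - (\<Sum>l<N. (\<Sum>i\<le>l. cf i) * (g (x (Suc l)) - g (x l)))"
      by (rule abel_summation)
    finally have eq: "(\<Sum>k\<in>A. w k * g (u k)) = \<dots>" .
    have cfB: "\<bar>\<Sum>i\<le>l. cf i\<bar> \<le> B" if "l \<le> N" for l
      unfolding cf_def part[OF that] using range that by (intro B) auto
    have 1: "\<bar>(\<Sum>i\<le>N. cf i) * g (x N)\<bar> \<le> B * G"
      unfolding abs_mult using cfB[of N] gb[of "x N"] range nn by (intro mult_mono) auto
    have "\<bar>\<Sum>l<N. (\<Sum>i\<le>l. cf i) * (g (x (Suc l)) - g (x l))\<bar>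
        \<le> (\<Sum>l<N. B * \<bar>g (x (Suc l)) - g (x l)\<bar>)"
      by (rule order.trans[OF sum_abs], intro sum_mono)
        (auto simp: abs_mult intro!: mult_right_mono cfB)
    also have "\<dots> \<le> B * V"
      unfolding sum_distrib_left[symmetric] using var[OF mono range] nn by (intro mult_left_mono)
    finally show ?thesis using 1 unfolding eq by (simp add: algebra_simps)
  qed
qed

lemma mono_on_atMost_SucI:
  fixes x :: "nat \<Rightarrow> real"
  assumes "\<And>l. l < N \<Longrightarrow> x l \<le> x (Suc l)"
  shows "mono_on {..N} x"
proof (rule mono_onI)
  fix r s assume "r \<in> {..N}" "s \<in> {..N}" and rs: "r \<le> s"
  then have "s \<le> N" by simp
  from rs this show "x r \<le> x s"
  proof (induction rule: dec_induct)
    case (step k)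
    then show ?case using assms[of k] by simp
  qed simp
qed

lemma bounded_variation_on_bounded:
  assumes "bounded_variation_on K c d"
  obtains G where "G \<ge> 0" "\<And>x. x \<in> {c..d} \<Longrightarrow> \<bar>K x\<bar> \<le> G"
proof -
  obtain V where V: "\<And>(N::nat) x. mono_on {..N} x \<Longrightarrow> x ` {..N} \<subseteq> {c..d} \<Longrightarrow>
      (\<Sum>l<N. \<bar>K (x (Suc l)) - K (x l)\<bar>) \<le> V"
    using assms unfolding bounded_variation_on_def by blast
  have "\<bar>K x\<bar> \<le> \<bar>K c\<bar> + \<bar>V\<bar>" if "x \<in> {c..d}" for x
  proof -
    have "mono_on {..1} (\<lambda>l::nat. if l = 0 then c else x)"
      using that by (intro mono_on_atMost_SucI) auto
    then show ?thesis
      using V[of 1 "\<lambda>l. if l = 0 then c else x"] that by (simp add: image_subset_iff)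
  qed
  then show ?thesis using that[of "\<bar>K c\<bar> + \<bar>V\<bar>"] by auto
qed

lemma bounded_variation_on_times_id:
  assumes K: "bounded_variation_on K (-1) 1"
  shows "bounded_variation_on (\<lambda>u. u * K u) (-1) 1"
proof -
  obtain V where V: "\<And>(N::nat) x. mono_on {..N} x \<Longrightarrow> x ` {..N} \<subseteq> {-1..1} \<Longrightarrow>
      (\<Sum>l<N. \<bar>K (x (Suc l)) - K (x l)\<bar>) \<le> V"
    using K unfolding bounded_variation_on_def by blast
  obtain G where G: "G \<ge> 0" "\<And>x. x \<in> {-1..1} \<Longrightarrow> \<bar>K x\<bar> \<le> G"
    using bounded_variation_on_bounded[OF K] by blast
  have "(\<Sum>l<N. \<bar>x (Suc l) * K (x (Suc l)) - x l * K (x l)\<bar>) \<le> V + 2 * G"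
    if x: "mono_on {..N} x" "x ` {..N} \<subseteq> {-1..1}" for N :: nat and x
  proof -
    have "\<bar>x (Suc l) * K (x (Suc l)) - x l * K (x l)\<bar>
        \<le> \<bar>K (x (Suc l)) - K (x l)\<bar> + G * (x (Suc l) - x l)" if "l < N" for l
    proof -
      have in1: "x (Suc l) \<in> {-1..1}" "x l \<in> {-1..1}" and le: "x l \<le> x (Suc l)"
        using x that by (auto simp: mono_on_def image_subset_iff)
      have "\<bar>x (Suc l) * K (x (Suc l)) - x l * K (x l)\<bar>
          = \<bar>x (Suc l) * (K (x (Suc l)) - K (x l)) + K (x l) * (x (Suc l) - x l)\<bar>"
        by (simp add: algebra_simps)
      also have "\<dots> \<le> \<bar>x (Suc l)\<bar> * \<bar>K (x (Suc l)) - K (x l)\<bar> + \<bar>K (x l)\<bar> * \<bar>x (Suc l) - x l\<bar>"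
        unfolding abs_mult[symmetric] by (rule abs_triangle_ineq)
      also have "\<dots> \<le> 1 * \<bar>K (x (Suc l)) - K (x l)\<bar> + G * \<bar>x (Suc l) - x l\<bar>"
        using in1 G by (intro add_mono mult_right_mono) auto
      finally show ?thesis using le by simp
    qed
    then have "(\<Sum>l<N. \<bar>x (Suc l) * K (x (Suc l)) - x l * K (x l)\<bar>)
        \<le> (\<Sum>l<N. \<bar>K (x (Suc l)) - K (x l)\<bar> + G * (x (Suc l) - x l))"
      by (intro sum_mono) auto
    also have "\<dots> = (\<Sum>l<N. \<bar>K (x (Suc l)) - K (x l)\<bar>) + G * (x N - x 0)"
      by (simp add: sum.distrib sum_distrib_left[symmetric] sum_lessThan_telescope)
    also have "\<dots> \<le> V + G * 2"
      using V[OF x] x(2) G(1) by (intro add_mono mult_left_mono) (auto simp: image_subset_iff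
          intro: order.trans[where b = "1 - x 0"])
    finally show ?thesis by simp
  qed
  then show ?thesis unfolding bounded_variation_on_def by blast
qed

text \<open>If K dips below \<epsilon>/2 in every interval while exceeding \<epsilon> at infinitely many points,
then it oscillates by \<epsilon>/2 between any two of these points, and finitely many of them already
exceed the variation bound. Infinitely many such points exist for some \<epsilon>, because otherwise K
would be positive only on a countable set.\<close>

lemma bounded_variation_positive_interval:
  assumes bv: "bounded_variation_on K c d"
    and pos: "\<not> (AE x in lborel. x \<in> {c..d} \<longrightarrow> K x \<le> 0)"
  obtains p q \<kappa> where "c \<le> p" "p < q" "q \<le> d" "\<kappa> > 0" "\<And>u. u \<in> {p..q} \<Longrightarrow> \<kappa> \<le> K u"
proof -
  obtain V where V: "\<And>(N::nat) x. mono_on {..N} x \<Longrightarrow> x ` {..N} \<subseteq> {c..d} \<Longrightarrow>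
      (\<Sum>l<N. \<bar>K (x (Suc l)) - K (x l)\<bar>) \<le> V"
    using bv unfolding bounded_variation_on_def by blast
  have "\<exists>\<epsilon>>0. infinite {x \<in> {c..d}. K x > \<epsilon>}"
  proof (rule ccontr)
    assume a: "\<not> ?thesis"
    have a': "countable {x \<in> {c..d}. \<epsilon> < K x}" if "0 < \<epsilon>" for \<epsilon>
      using a that countable_finite[of "{x \<in> {c..d}. \<epsilon> < K x}"] by fast
    have "countable (\<Union>k::nat. {x \<in> {c..d}. K x > 1 / real (Suc k)})"
    proof (rule countable_UN)
      fix k :: nat
      show "countable {x \<in> {c..d}. K x > 1 / real (Suc k)}"
        using a'[of "1 / real (Suc k)"] by simp
    qed simp
    moreover have "{x \<in> {c..d}. K x > 0} \<subseteq> (\<Union>k::nat. {x \<in> {c..d}. K x > 1 / real (Suc k)})"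
    proof
      fix x assume x: "x \<in> {x \<in> {c..d}. K x > 0}"
      then obtain k where "inverse (real (Suc k)) < K x"
        using reals_Archimedean[of "K x"] by auto
      then show "x \<in> (\<Union>k::nat. {x \<in> {c..d}. K x > 1 / real (Suc k)})"
        using x by (auto simp: inverse_eq_divide)
    qed
    ultimately have "countable {x \<in> {c..d}. K x > 0}" by (rule countable_subset[rotated])
    then have "{x \<in> {c..d}. K x > 0} \<in> null_sets lborel"
      by (rule countable_imp_null_set_lborel)
    then have "AE x in lborel. x \<in> {c..d} \<longrightarrow> K x \<le> 0"
      by (rule AE_I'[where N="{x \<in> {c..d}. K x > 0}"]) auto
    with pos show False by simp
  qed
  then obtain \<epsilon> where \<epsilon>: "\<epsilon> > 0" "infinite {x \<in> {c..d}. K x > \<epsilon>}" by blast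
  note intv = that
  show ?thesis
  proof (rule ccontr)
    assume no: "\<not> thesis"
    have low: "\<exists>z. p \<le> z \<and> z \<le> q \<and> K z < \<epsilon> / 2" if "c \<le> p" "p < q" "q \<le> d" for p q
    proof (rule ccontr)
      assume "\<not> ?thesis"
      then have "\<And>u. u \<in> {p..q} \<Longrightarrow> \<epsilon> / 2 \<le> K u" by force
      then show False using no \<epsilon>(1) intv[OF that(1) that(2) that(3), of "\<epsilon> / 2"] by simp
    qed
    obtain N :: nat where N: "V < real N * (\<epsilon> / 2)"
      using reals_Archimedean3[of "\<epsilon>/2"] \<epsilon> by (metis half_gt_zero)
    obtain F where F: "F \<subseteq> {x \<in> {c..d}. K x > \<epsilon>}" "finite F" "card F = Suc N"
      using infinite_arbitrarily_large[OF \<epsilon>(2), of "Suc N"] by blast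
    define ys where "ys = sorted_list_of_set F"
    have ys: "set ys = F" "length ys = Suc N" "sorted ys" "distinct ys"
      using F by (auto simp: ys_def)
    have ysF: "ys ! l \<in> F" if "l \<le> N" for l
      using ys that by (metis less_Suc_eq_le nth_mem)
    have ysl: "ys ! l < ys ! Suc l" if "l < N" for l
      using ys that by (auto simp: sorted_wrt_nth_less strict_sorted_iff)
    have "\<exists>z. ys ! l \<le> z \<and> z \<le> ys ! Suc l \<and> K z < \<epsilon> / 2" if "l < N" for l
      using ysF[of l] ysF[of "Suc l"] F(1) that by (intro low ysl) auto
    then obtain z where z: "\<And>l. l < N \<Longrightarrow> ys ! l \<le> z l \<and> z l \<le> ys ! Suc l \<and> K (z l) < \<epsilon> / 2"
      by metis
    \<comment> \<open>Peaks at even and dips at odd positions.\<close>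
    define x where "x n = (if even n then ys ! (n div 2) else z (n div 2))" for n
    have mono: "mono_on {..2 * N} x"
    proof (rule mono_on_atMost_SucI)
      fix l assume l: "l < 2 * N"
      show "x l \<le> x (Suc l)"
        using z[of "l div 2"] l by (auto simp: x_def elim!: evenE oddE)
    qed
    have range: "x ` {..2 * N} \<subseteq> {c..d}"
    proof -
      have "x n \<in> {c..d}" if "n \<le> 2 * N" for n
      proof (cases "even n")
        case True
        have "n div 2 \<le> N" using that by simp
        then show ?thesis using ysF[of "n div 2"] F(1) True by (auto simp: x_def)
      next
        case False
        then have l: "n div 2 < N" using that by presburger
        then show ?thesis
          using z[OF l] ysF[of "n div 2"] ysF[of "Suc (n div 2)"] F(1) False by (auto simp: x_def)
      qed
      then show ?thesis by auto
    qed
    have split: "(\<Sum>l<2 * N'. f l) = (\<Sum>l<N'. f (2 * l) + f (Suc (2 * l)))"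
      for f :: "nat \<Rightarrow> real" and N'
      by (induction N') auto
    have "real N * (\<epsilon> / 2) = (\<Sum>l<N. \<epsilon> / 2)" by simp
    also have "\<dots> \<le> (\<Sum>l<N. \<bar>K (x (Suc (2 * l))) - K (x (2 * l))\<bar>
        + \<bar>K (x (Suc (Suc (2 * l)))) - K (x (Suc (2 * l)))\<bar>)"
    proof (rule sum_mono)
      fix l assume "l \<in> {..<N}"
      then have "K (x (Suc (2 * l))) < \<epsilon> / 2" "K (x (2 * l)) > \<epsilon>"
        using z[of l] ysF[of l] F(1) by (auto simp: x_def)
      then show "\<epsilon> / 2 \<le> \<bar>K (x (Suc (2 * l))) - K (x (2 * l))\<bar>
        + \<bar>K (x (Suc (Suc (2 * l)))) - K (x (Suc (2 * l)))\<bar>"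
        by linarith
    qed
    also have "\<dots> = (\<Sum>l<2 * N. \<bar>K (x (Suc l)) - K (x l)\<bar>)"
      by (subst split) auto
    also have "\<dots> \<le> V" by (rule V[OF mono range])
    finally show False using N by simp
  qed
qed

section \<open>The local linear least squares problem\<close>

text \<open>An affine function that is small at a point of each of two intervals at distance l has small slope and
hence small intercept. So on one of the two intervals its square is comparable to the sum of the squares of its
coefficients.\<close>

lemma affine_form_lower_bound:
  fixes \<alpha> \<beta> l p :: real
  assumes l: "0 < l" "l \<le> 1" and p: "0 \<le> p" "p + 3 * l \<le> 1"
  shows "(\<forall>u\<in>{p..p + l}. (l / 6)\<^sup>2 * (\<alpha>\<^sup>2 + \<beta>\<^sup>2) \<le> (\<alpha> + \<beta> * u)\<^sup>2) \<or>
         (\<forall>u\<in>{p + 2 * l..p + 3 * l}. (l / 6)\<^sup>2 * (\<alpha>\<^sup>2 + \<beta>\<^sup>2) \<le> (\<alpha> + \<beta> * u)\<^sup>2)"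
proof (rule ccontr)
  assume "\<not> ?thesis"
  then obtain u v where u: "u \<in> {p..p + l}" "(\<alpha> + \<beta> * u)\<^sup>2 < (l / 6)\<^sup>2 * (\<alpha>\<^sup>2 + \<beta>\<^sup>2)"
    and v: "v \<in> {p + 2 * l..p + 3 * l}" "(\<alpha> + \<beta> * v)\<^sup>2 < (l / 6)\<^sup>2 * (\<alpha>\<^sup>2 + \<beta>\<^sup>2)"
    by force
  define s where "s = sqrt (\<alpha>\<^sup>2 + \<beta>\<^sup>2)"
  have s2: "s\<^sup>2 = \<alpha>\<^sup>2 + \<beta>\<^sup>2" and s0: "0 \<le> s" by (simp_all add: s_def)
  have 1: "\<bar>\<alpha> + \<beta> * w\<bar> < l / 6 * s" if "(\<alpha> + \<beta> * w)\<^sup>2 < (l / 6)\<^sup>2 * (\<alpha>\<^sup>2 + \<beta>\<^sup>2)" for w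
  proof -
    have "\<bar>\<alpha> + \<beta> * w\<bar>\<^sup>2 < (l / 6 * s)\<^sup>2" using that by (simp add: s2[symmetric] power_mult_distrib power_divide)
    then show ?thesis by (rule power2_less_imp_less) (use l s0 in auto)
  qed
  have "\<bar>\<beta>\<bar> * l \<le> \<bar>\<beta>\<bar> * (v - u)" using u v by (intro mult_left_mono) auto
  also have "\<dots> = \<bar>\<beta> * (v - u)\<bar>" using u v l by (simp add: abs_mult)
  also have "\<dots> = \<bar>(\<alpha> + \<beta> * v) - (\<alpha> + \<beta> * u)\<bar>" by (simp add: algebra_simps)
  also have "\<dots> \<le> 2 * (l / 6 * s)" using 1[OF u(2)] 1[OF v(2)] by linarith
  finally have "\<bar>\<beta>\<bar> * l \<le> (s / 3) * l" by (simp add: algebra_simps)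
  then have b: "\<bar>\<beta>\<bar> \<le> s / 3" using l by (simp add: mult_le_cancel_right)
  have "\<bar>\<beta> * u\<bar> \<le> \<bar>\<beta>\<bar> * 1" unfolding abs_mult using u p l by (intro mult_left_mono) auto
  moreover have "l / 6 * s \<le> 1 / 6 * s" using l s0 by (intro mult_right_mono) auto
  ultimately have a: "\<bar>\<alpha>\<bar> < s / 6 + s / 3" using 1[OF u(2)] b by linarith
  then have sp: "0 < s" by linarith
  have "s\<^sup>2 \<le> (s / 2)\<^sup>2 + (s / 3)\<^sup>2"
    unfolding s2 using a b s0 by (intro add_mono; subst abs_le_square_iff[symmetric]) auto
  also have "\<dots> < s\<^sup>2" using sp by (simp add: power2_eq_square)
  finally show False by simp
qed

text \<open>With e the residual at (\<mu> t, d) and (al, be) the rescaled parameter error, minimality makes the weighted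
sum of (al + be u)^2 at most twice the weighted sum of e (al + be u). The left side is at least
c (al^2 + be^2) h by the design counts low1 and low2, on the side of t selected by sg. The
right side is at most a multiple of h (|al| + |be|) times the noise level N plus the Taylor bias. Dividing by
the larger of |al| and |be| gives the bound.\<close>

lemma local_linear_error_bound:
  fixes A :: "'k set" and v \<tau> y \<zeta> :: "'k \<Rightarrow> real" and K \<mu> :: "real \<Rightarrow> real"
  assumes fin: "finite A" and v: "\<And>k. k \<in> A \<Longrightarrow> 0 \<le> v k" and h: "h > 0"
    and K0: "\<And>u. 0 \<le> K u" and KG: "\<And>u. K u \<le> G" and Ks: "\<And>u. u \<notin> {-1..1} \<Longrightarrow> K u = 0"
    and lp: "0 < l" "l \<le> 1" "0 \<le> p" "p + 3 * l \<le> 1" and \<kappa>: "\<kappa> > 0" and c1: "c1 > 0"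
    and sg: "sg = 1 \<or> sg = -1"
    and Kl: "\<And>u. u \<in> {p..p + 3 * l} \<Longrightarrow> \<kappa> \<le> K (sg * u)"
    and L: "0 \<le> L"
    and y: "\<And>k. k \<in> A \<Longrightarrow> y k = \<mu> (\<tau> k) + \<zeta> k"
    and taylor: "\<And>k. k \<in> A \<Longrightarrow> \<bar>\<mu> (\<tau> k) - \<mu> t - d * (\<tau> k - t)\<bar> \<le> L * (\<tau> k - t)\<^sup>2"
    and noise0: "\<bar>\<Sum>k\<in>A. v k * K ((\<tau> k - t) / h) * \<zeta> k\<bar> \<le> h * N"
    and noise1: "\<bar>\<Sum>k\<in>A. v k * ((\<tau> k - t) / h * K ((\<tau> k - t) / h)) * \<zeta> k\<bar> \<le> h * N"
    and up: "(\<Sum>k\<in>{k\<in>A. \<bar>\<tau> k - t\<bar> \<le> h}. v k) \<le> C1 * h"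
    and low1: "c1 * h \<le> (\<Sum>k\<in>{k\<in>A. sg * ((\<tau> k - t) / h) \<in> {p..p + l}}. v k)"
    and low2: "c1 * h \<le> (\<Sum>k\<in>{k\<in>A. sg * ((\<tau> k - t) / h) \<in> {p + 2 * l..p + 3 * l}}. v k)"
    and minimal: "(\<Sum>k\<in>A. v k * ((y k - a0 - a1 * (\<tau> k - t))\<^sup>2 * scaled_kernel K h (\<tau> k - t)))
      \<le> (\<Sum>k\<in>A. v k * ((y k - \<mu> t - d * (\<tau> k - t))\<^sup>2 * scaled_kernel K h (\<tau> k - t)))"
  shows "\<bar>a0 - \<mu> t\<bar> \<le> 4 * (N + G * L * C1 * h\<^sup>2) / (\<kappa> * c1 * (l / 6)\<^sup>2)"
proof -
  define u where "u k = (\<tau> k - t) / h" for k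
  define w where "w k = v k * K (u k)" for k
  define e where "e k = y k - \<mu> t - d * (\<tau> k - t)" for k
  define \<rho> where "\<rho> k = \<mu> (\<tau> k) - \<mu> t - d * (\<tau> k - t)" for k
  define al where "al = a0 - \<mu> t"
  define be where "be = h * (a1 - d)"
  define E where "E = N + G * L * C1 * h\<^sup>2"
  define c where "c = \<kappa> * c1 * (l / 6)\<^sup>2"
  have c: "c > 0" using \<kappa> c1 lp by (simp add: c_def)
  have w0: "0 \<le> w k" if "k \<in> A" for k using v[OF that] K0 by (simp add: w_def)
  have tau: "\<tau> k - t = h * u k" for k using h by (simp add: u_def)
  have e: "e k = \<zeta> k + \<rho> k" if "k \<in> A" for k using y[OF that] by (simp add: e_def \<rho>_def)
  have res: "y k - a0 - a1 * (\<tau> k - t) = e k - (al + be * u k)" for k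
    unfolding e_def al_def be_def tau by (simp add: algebra_simps)
  have "(\<Sum>k\<in>A. w k * (e k - (al + be * u k))\<^sup>2) / h \<le> (\<Sum>k\<in>A. w k * (e k)\<^sup>2) / h"
    using minimal unfolding res e_def[symmetric] scaled_kernel_def u_def[symmetric] sum_divide_distrib
    by (simp add: w_def mult_ac)
  then have "(\<Sum>k\<in>A. w k * (e k - (al + be * u k))\<^sup>2) \<le> (\<Sum>k\<in>A. w k * (e k)\<^sup>2)"
    using h by (simp add: divide_le_cancel)
  moreover have "(\<Sum>k\<in>A. w k * (e k - (al + be * u k))\<^sup>2) = (\<Sum>k\<in>A. w k * (e k)\<^sup>2)
      + (\<Sum>k\<in>A. w k * (al + be * u k)\<^sup>2)
      - 2 * (al * (\<Sum>k\<in>A. w k * e k) + be * (\<Sum>k\<in>A. w k * u k * e k))"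
    unfolding sum_distrib_left sum.distrib[symmetric] sum_subtractf[symmetric]
    by (intro sum.cong refl) (simp add: power2_eq_square algebra_simps)
  ultimately have q: "(\<Sum>k\<in>A. w k * (al + be * u k)\<^sup>2)
      \<le> 2 * (al * (\<Sum>k\<in>A. w k * e k) + be * (\<Sum>k\<in>A. w k * u k * e k))" by linarith
  have in1: "\<bar>\<tau> k - t\<bar> \<le> h \<longleftrightarrow> \<bar>u k\<bar> \<le> 1" for k
    using h by (simp add: tau abs_mult)
  have win: "w k = 0" if "\<not> \<bar>u k\<bar> \<le> 1" for k
    using Ks[of "u k"] that by (auto simp: w_def abs_le_iff)
  \<comment> \<open>Each remainder is at most L h^2 inside the window, so only the number of design points matters.\<close>
  have bias: "\<bar>\<Sum>k\<in>A. w k * g k * \<rho> k\<bar> \<le> h * (G * L * C1 * h\<^sup>2)"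
    if g: "\<And>k. k \<in> A \<Longrightarrow> \<bar>u k\<bar> \<le> 1 \<Longrightarrow> \<bar>g k\<bar> \<le> 1" for g
  proof -
    have "(\<Sum>k\<in>A. w k * g k * \<rho> k) = (\<Sum>k\<in>{k\<in>A. \<bar>u k\<bar> \<le> 1}. w k * g k * \<rho> k)"
      using fin win by (intro sum.mono_neutral_right) auto
    also have "\<bar>\<dots>\<bar> \<le> (\<Sum>k\<in>{k\<in>A. \<bar>u k\<bar> \<le> 1}. v k * (G * (L * h\<^sup>2)))"
    proof (rule order.trans[OF sum_abs], rule sum_mono)
      fix k assume k: "k \<in> {k \<in> A. \<bar>u k\<bar> \<le> 1}"
      have "\<bar>\<rho> k\<bar> \<le> L * (\<tau> k - t)\<^sup>2" unfolding \<rho>_def using taylor k by auto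
      also have "\<dots> \<le> L * h\<^sup>2"
        using k h L in1 by (intro mult_left_mono) (auto simp flip: abs_le_square_iff)
      finally have r: "\<bar>\<rho> k\<bar> \<le> L * h\<^sup>2" .
      have "\<bar>w k * g k * \<rho> k\<bar> = v k * (K (u k) * (\<bar>g k\<bar> * \<bar>\<rho> k\<bar>))"
        using k v K0 by (simp add: w_def abs_mult)
      also have "\<dots> \<le> v k * (G * (1 * (L * h\<^sup>2)))"
        using k v K0 KG g r order.trans[OF K0 KG] L by (intro mult_left_mono mult_mono) auto
      finally show "\<bar>w k * g k * \<rho> k\<bar> \<le> v k * (G * (L * h\<^sup>2))" by simp
    qed
    also have "\<dots> \<le> C1 * h * (G * (L * h\<^sup>2))"
      unfolding sum_distrib_right[symmetric]
      using up order.trans[OF K0 KG] L unfolding in1 by (intro mult_right_mono) auto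
    finally show ?thesis by (simp add: algebra_simps)
  qed
  have R0: "\<bar>\<Sum>k\<in>A. w k * e k\<bar> \<le> h * E"
  proof -
    have "(\<Sum>k\<in>A. w k * e k) = (\<Sum>k\<in>A. v k * K (u k) * \<zeta> k) + (\<Sum>k\<in>A. w k * 1 * \<rho> k)"
      unfolding sum.distrib[symmetric] by (intro sum.cong refl) (simp add: e w_def algebra_simps)
    then show ?thesis
      using noise0 bias[of "\<lambda>_. 1"] unfolding u_def[symmetric] E_def by (simp add: algebra_simps)
  qed
  have R1: "\<bar>\<Sum>k\<in>A. w k * u k * e k\<bar> \<le> h * E"
  proof -
    have "(\<Sum>k\<in>A. w k * u k * e k) = (\<Sum>k\<in>A. v k * (u k * K (u k)) * \<zeta> k) + (\<Sum>k\<in>A. w k * u k * \<rho> k)"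
      unfolding sum.distrib[symmetric] by (intro sum.cong refl) (simp add: e w_def algebra_simps)
    then show ?thesis
      using noise1 bias[of u] unfolding u_def[symmetric] E_def by (simp add: algebra_simps)
  qed
  have lower: "c * (al\<^sup>2 + be\<^sup>2) * h \<le> (\<Sum>k\<in>A. w k * (al + be * u k)\<^sup>2)"
  proof -
    have sub: "c * (al\<^sup>2 + be\<^sup>2) * h \<le> (\<Sum>k\<in>A. w k * (al + be * u k)\<^sup>2)"
      if S: "c1 * h \<le> (\<Sum>k\<in>{k\<in>A. sg * u k \<in> {r..s}}. v k)" and rs: "{r..s} \<subseteq> {p..p + 3 * l}"
        and low: "\<forall>x\<in>{r..s}. (l / 6)\<^sup>2 * (al\<^sup>2 + (sg * be)\<^sup>2) \<le> (al + (sg * be) * x)\<^sup>2" for r s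
    proof -
      have sg2: "sg * (sg * x) = x" "sg\<^sup>2 = 1" for x using sg by auto
      let ?B = "{k\<in>A. sg * u k \<in> {r..s}}"
      have "c * (al\<^sup>2 + be\<^sup>2) * h = \<kappa> * ((l / 6)\<^sup>2 * (al\<^sup>2 + be\<^sup>2)) * (c1 * h)"
        by (simp add: c_def)
      also have "\<dots> \<le> \<kappa> * ((l / 6)\<^sup>2 * (al\<^sup>2 + be\<^sup>2)) * (\<Sum>k\<in>?B. v k)"
        using S \<kappa> by (intro mult_left_mono) auto
      also have "\<dots> = (\<Sum>k\<in>?B. v k * (\<kappa> * ((l / 6)\<^sup>2 * (al\<^sup>2 + be\<^sup>2))))"
        unfolding sum_distrib_left by (simp add: mult_ac)
      also have "\<dots> \<le> (\<Sum>k\<in>?B. v k * (K (u k) * (al + be * u k)\<^sup>2))"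
      proof (intro sum_mono mult_left_mono mult_mono)
        fix k assume k: "k \<in> ?B"
        show "\<kappa> \<le> K (u k)" using Kl[of "sg * u k"] k rs by (auto simp: sg2)
        have "(l / 6)\<^sup>2 * (al\<^sup>2 + (sg * be)\<^sup>2) \<le> (al + (sg * be) * (sg * u k))\<^sup>2"
          using low k by blast
        moreover have "(sg * be) * (sg * u k) = be * u k" using sg by auto
        ultimately show "(l / 6)\<^sup>2 * (al\<^sup>2 + be\<^sup>2) \<le> (al + be * u k)\<^sup>2"
          by (simp add: power_mult_distrib sg2)
      qed (use v K0 in auto)
      also have "\<dots> \<le> (\<Sum>k\<in>A. v k * (K (u k) * (al + be * u k)\<^sup>2))"
        using fin v K0 by (intro sum_mono2) auto
      finally show ?thesis by (simp add: w_def mult.assoc)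
    qed
    have "{p..p + l} \<subseteq> {p..p + 3 * l}" "{p + 2 * l..p + 3 * l} \<subseteq> {p..p + 3 * l}" using lp by auto
    then show ?thesis
      using affine_form_lower_bound[OF lp, of al "sg * be"] sub low1 low2 unfolding u_def[symmetric] by blast
  qed
  define m where "m = max \<bar>al\<bar> \<bar>be\<bar>"
  have m: "0 \<le> m" "\<bar>al\<bar> \<le> m" "\<bar>be\<bar> \<le> m" by (auto simp: m_def)
  have E0: "0 \<le> h * E" using R0 by linarith
  have "m\<^sup>2 \<le> al\<^sup>2 + be\<^sup>2" unfolding m_def by (auto simp: max_def)
  then have "c * m\<^sup>2 * h \<le> c * (al\<^sup>2 + be\<^sup>2) * h" using c h by (intro mult_right_mono mult_left_mono) auto
  also have "\<dots> \<le> 2 * (al * (\<Sum>k\<in>A. w k * e k) + be * (\<Sum>k\<in>A. w k * u k * e k))"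
    using lower q by linarith
  also have "\<dots> \<le> 2 * (m * (h * E) + m * (h * E))"
  proof -
    have "al * (\<Sum>k\<in>A. w k * e k) \<le> m * (h * E)" "be * (\<Sum>k\<in>A. w k * u k * e k) \<le> m * (h * E)"
      using mult_mono[OF m(2) R0 m(1)] mult_mono[OF m(3) R1 m(1)]
      by (auto simp: abs_mult[symmetric] intro: order.trans[OF abs_ge_self])
    then show ?thesis by (intro mult_left_mono add_mono) auto
  qed
  finally have "(m * c) * (m * h) \<le> (4 * E) * (m * h)" by (simp add: power2_eq_square algebra_simps)
  then have "m * c \<le> 4 * E \<or> m = 0" using h m(1) by (auto simp: mult_le_cancel_right)
  then have "m * c \<le> 4 * E" using E0 h by (auto simp: zero_le_mult_iff)
  then have "m \<le> 4 * E / c" using c by (simp add: pos_le_divide_eq)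
  then show ?thesis using m unfolding al_def E_def c_def by linarith
qed

lemma second_order_taylor_bound:
  assumes C3: "condition_C3 a b \<mu>"
  obtains \<mu>' L where "L \<ge> 0"
    "\<And>s t. s \<in> {a..b} \<Longrightarrow> t \<in> {a..b} \<Longrightarrow> \<bar>\<mu> s - \<mu> t - \<mu>' t * (s - t)\<bar> \<le> L * (s - t)\<^sup>2"
proof -
  obtain \<mu>' \<mu>'' where d1: "\<And>t. t\<in>{a..b} \<Longrightarrow> (\<mu> has_real_derivative \<mu>' t) (at t within {a..b})"
    and d2: "\<And>t. t\<in>{a..b} \<Longrightarrow> (\<mu>' has_real_derivative \<mu>'' t) (at t within {a..b})"
    and bd: "bounded (\<mu>'' ` {a..b})"
    using C3 unfolding condition_C3_def by blast
  obtain L where L: "L > 0" "\<And>t. t \<in> {a..b} \<Longrightarrow> \<bar>\<mu>'' t\<bar> \<le> L"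
    using bd unfolding bounded_pos by auto
  have lip: "\<bar>\<mu>' s - \<mu>' t\<bar> \<le> L * \<bar>s - t\<bar>" if "s \<in> {a..b}" "t \<in> {a..b}" for s t
    using field_differentiable_bound[of "{a..b}" \<mu>' \<mu>'' L s t] d2 L that by simp
  have "\<bar>\<mu> s - \<mu> t - \<mu>' t * (s - t)\<bar> \<le> L * (s - t)\<^sup>2" if st: "s \<in> {a..b}" "t \<in> {a..b}" for s t
  proof -
    define I where "I = {min s t..max s t}"
    have I: "I \<subseteq> {a..b}" "convex I" "s \<in> I" "t \<in> I" using st by (auto simp: I_def)
    have "norm ((\<mu> s - \<mu>' t * s) - (\<mu> t - \<mu>' t * t)) \<le> (L * \<bar>s - t\<bar>) * norm (s - t)"
    proof (rule field_differentiable_bound[of I "\<lambda>x. \<mu> x - \<mu>' t * x" "\<lambda>x. \<mu>' x - \<mu>' t"])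
      fix x assume x: "x \<in> I"
      have "(\<mu> has_real_derivative \<mu>' x) (at x within I)"
        using x I by (intro DERIV_subset[OF d1, of x]) auto
      then show "((\<lambda>x. \<mu> x - \<mu>' t * x) has_field_derivative \<mu>' x - \<mu>' t) (at x within I)"
        by (auto intro!: derivative_eq_intros)
      have "\<bar>\<mu>' x - \<mu>' t\<bar> \<le> L * \<bar>x - t\<bar>" using lip x I st by auto
      also have "\<dots> \<le> L * \<bar>s - t\<bar>" using x L(1) by (intro mult_left_mono) (auto simp: I_def)
      finally show "norm (\<mu>' x - \<mu>' t) \<le> L * \<bar>s - t\<bar>" by simp
    qed (use I in auto)
    then show ?thesis by (simp add: power2_eq_square algebra_simps abs_mult[symmetric])
  qed
  with L(1) show ?thesis by (intro that[of L \<mu>']) auto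
qed

section \<open>Moment and exponential inequalities\<close>

lemma power_mean_inequality:
  fixes x :: "nat \<Rightarrow> real"
  assumes q: "q \<ge> 1" and x: "\<And>j. j < m \<Longrightarrow> 0 \<le> x j" and m: "m \<ge> 1"
  shows "((1 / real m) * (\<Sum>j<m. x j)) powr q \<le> (1 / real m) * (\<Sum>j<m. x j powr q)"
proof -
  define A where "A = (1 / real m) * (\<Sum>j<m. x j)"
  have A0: "0 \<le> A" using x by (auto simp: A_def intro!: sum_nonneg divide_nonneg_nonneg)
  show ?thesis
  proof (cases "A = 0")
    case True
    then show ?thesis using q unfolding A_def[symmetric] by (auto intro!: sum_nonneg divide_nonneg_nonneg)
  next
    case False
    then have A: "A > 0" using A0 by simp
    \<comment> \<open>Tangent line of the convex power function at A; at y = 0 it only says that q is at least 1.\<close>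
    have tangent: "A powr q + q * A powr (q - 1) * (y - A) \<le> y powr q" if "0 \<le> y" for y
    proof (cases "y = 0")
      case True
      have "A powr q = A * A powr (q - 1)" using A by (simp add: powr_mult_base)
      then show ?thesis using True q A by (simp add: mult_ac mult_le_cancel_left1)
    next
      case False
      have "y powr q - A powr q \<ge> (q * A powr (q - 1)) * (y - A)"
      proof (rule convex_on_imp_above_tangent[where A = "{0<..}"])
        show "convex_on {0<..} (\<lambda>x. x powr q)" using q by (rule powr_convex)
        show "((\<lambda>x. x powr q) has_real_derivative q * A powr (q - 1)) (at A within {0<..})"
          using A by (auto intro!: derivative_eq_intros)
      qed (use A False that in \<open>auto simp: interior_open\<close>)
      then show ?thesis by simp
    qed
    have "real m * A powr q = (\<Sum>j<m. A powr q + q * A powr (q - 1) * (x j - A))"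
    proof -
      have "(\<Sum>j<m. x j - A) = 0" using m by (simp add: sum_subtractf A_def)
      then show ?thesis by (simp add: sum.distrib flip: sum_distrib_left)
    qed
    also have "\<dots> \<le> (\<Sum>j<m. x j powr q)" using tangent x by (intro sum_mono) auto
    finally show ?thesis using m unfolding A_def[symmetric] by (simp add: field_simps)
  qed
qed

lemma exp_quadratic_bound:
  fixes y :: real
  assumes "\<bar>y\<bar> \<le> 1"
  shows "exp y \<le> 1 + y + y\<^sup>2"
proof (cases "0 \<le> y")
  case True
  then show ?thesis using assms exp_bound[of y] by simp
next
  case False
  define x where "x = - y"
  have x: "0 \<le> x" using False by (simp add: x_def)
  have "1 \<le> 1 + x\<^sup>2 / 2 + x ^ 3 / 2 + x ^ 4 / 2" using x by simp
  \<comment> \<open>Negative y: multiply the claim by exp (- y) and use the quadratic lower bound of the exponential.\<close>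
  also have "\<dots> = (1 - x + x\<^sup>2) * (1 + x + x\<^sup>2 / 2)"
    by (simp add: field_simps power2_eq_square power3_eq_cube power4_eq_xxxx)
  also have "\<dots> \<le> (1 - x + x\<^sup>2) * exp x"
  proof (rule mult_left_mono)
    show "1 + x + x\<^sup>2 / 2 \<le> exp x" using exp_lower_Taylor_quadratic[OF x] .
    have "0 \<le> (x - 1/2)\<^sup>2" by simp
    then show "0 \<le> 1 - x + x\<^sup>2" by (simp add: power2_eq_square algebra_simps)
  qed
  finally show ?thesis unfolding x_def by (simp add: exp_minus field_simps)
qed

context prob_space
begin

lemma
  fixes f :: "nat \<Rightarrow> 'a \<Rightarrow> real"
  assumes int: "\<And>k. integrable M (f k)" and nn: "\<And>k \<omega>. 0 \<le> f k \<omega>"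
    and sm: "summable (\<lambda>k. expectation (f k))"
  shows AE_summable_of_summable_expectation: "AE \<omega> in M. summable (\<lambda>k. f k \<omega>)"
    and nn_integral_suminf_finite: "(\<integral>\<^sup>+\<omega>. (\<Sum>k. ennreal (f k \<omega>)) \<partial>M) < \<infinity>"
proof -
  have m[measurable]: "f k \<in> borel_measurable M" for k using int by auto
  have "(\<integral>\<^sup>+\<omega>. (\<Sum>k. ennreal (f k \<omega>)) \<partial>M) = (\<Sum>k. \<integral>\<^sup>+\<omega>. ennreal (f k \<omega>) \<partial>M)"
    by (intro nn_integral_suminf) measurable
  also have "\<dots> = (\<Sum>k. ennreal (expectation (f k)))"
    using int nn by (simp add: nn_integral_eq_integral)
  also have "\<dots> = ennreal (\<Sum>k. expectation (f k))"
    using nn sm by (intro suminf_ennreal2 integral_nonneg_AE) auto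
  finally show fin: "(\<integral>\<^sup>+\<omega>. (\<Sum>k. ennreal (f k \<omega>)) \<partial>M) < \<infinity>" by simp
  have "AE \<omega> in M. (\<Sum>k. ennreal (f k \<omega>)) \<noteq> \<infinity>"
    using fin by (intro nn_integral_PInf_AE) auto
  then show "AE \<omega> in M. summable (\<lambda>k. f k \<omega>)"
    by eventually_elim (use nn in \<open>auto intro!: summable_suminf_not_top\<close>)
qed

lemma AE_tendsto_0_of_summable_expectation:
  fixes f :: "nat \<Rightarrow> 'a \<Rightarrow> real"
  assumes "\<And>k. integrable M (f k)" and "\<And>k \<omega>. 0 \<le> f k \<omega>" and "summable (\<lambda>k. expectation (f k))"
  shows "AE \<omega> in M. (\<lambda>k. f k \<omega>) \<longlonglongrightarrow> 0"
  using AE_summable_of_summable_expectation[OF assms] by eventually_elim (rule summable_LIMSEQ_zero)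

lemma
  fixes Z :: "'i \<Rightarrow> 'a \<Rightarrow> real"
  assumes fin: "finite I" and indep: "indep_vars (\<lambda>_. borel) Z I"
    and int: "\<And>i. i \<in> I \<Longrightarrow> integrable M (Z i)" and sq: "\<And>i. i \<in> I \<Longrightarrow> integrable M (\<lambda>\<omega>. (Z i \<omega>)\<^sup>2)"
    and mean: "\<And>i. i \<in> I \<Longrightarrow> expectation (Z i) = 0"
  shows integrable_square_sum_indep: "integrable M (\<lambda>\<omega>. (\<Sum>i\<in>I. Z i \<omega>)\<^sup>2)"
    and expectation_square_sum_indep:
      "expectation (\<lambda>\<omega>. (\<Sum>i\<in>I. Z i \<omega>)\<^sup>2) = (\<Sum>i\<in>I. expectation (\<lambda>\<omega>. (Z i \<omega>)\<^sup>2))"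
proof -
  have ij: "integrable M (\<lambda>\<omega>. Z i \<omega> * Z j \<omega>)" "expectation (\<lambda>\<omega>. Z i \<omega> * Z j \<omega>) = 0"
    if "i \<in> I" "j \<in> I" "i \<noteq> j" for i j
  proof -
    have sub: "indep_vars (\<lambda>_. borel) Z {i, j}"
      by (rule indep_vars_subset[OF indep]) (use that in auto)
    show "integrable M (\<lambda>\<omega>. Z i \<omega> * Z j \<omega>)"
      using indep_vars_integrable[OF _ sub int] that by auto
    have "expectation (\<lambda>\<omega>. Z i \<omega> * Z j \<omega>) = expectation (Z i) * expectation (Z j)"
      using indep_vars_lebesgue_integral[OF _ sub int] that by auto
    then show "expectation (\<lambda>\<omega>. Z i \<omega> * Z j \<omega>) = 0" using mean that by simp
  qed
  have all: "integrable M (\<lambda>\<omega>. Z i \<omega> * Z j \<omega>)" if "i \<in> I" "j \<in> I" for i j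
    using ij(1)[OF that] sq[OF that(1)] by (cases "i = j") (auto simp: power2_eq_square)
  have eq: "(\<Sum>i\<in>I. Z i \<omega>)\<^sup>2 = (\<Sum>i\<in>I. \<Sum>j\<in>I. Z i \<omega> * Z j \<omega>)" for \<omega>
    by (simp add: power2_eq_square sum_product)
  show "integrable M (\<lambda>\<omega>. (\<Sum>i\<in>I. Z i \<omega>)\<^sup>2)"
    unfolding eq using all by (intro Bochner_Integration.integrable_sum) auto
  have "expectation (\<lambda>\<omega>. (\<Sum>i\<in>I. Z i \<omega>)\<^sup>2) = (\<Sum>i\<in>I. \<Sum>j\<in>I. expectation (\<lambda>\<omega>. Z i \<omega> * Z j \<omega>))"
    unfolding eq using all by (simp add: Bochner_Integration.integral_sum Bochner_Integration.integrable_sum)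
  also have "\<dots> = (\<Sum>i\<in>I. \<Sum>j\<in>I. if j = i then expectation (\<lambda>\<omega>. (Z i \<omega>)\<^sup>2) else 0)"
    using ij(2) by (intro sum.cong refl) (auto simp: power2_eq_square)
  also have "\<dots> = (\<Sum>i\<in>I. expectation (\<lambda>\<omega>. (Z i \<omega>)\<^sup>2))" using fin by simp
  finally show "expectation (\<lambda>\<omega>. (\<Sum>i\<in>I. Z i \<omega>)\<^sup>2) = (\<Sum>i\<in>I. expectation (\<lambda>\<omega>. (Z i \<omega>)\<^sup>2))" .
qed

text \<open>The exponential moment is taken at 1/Q, the largest value for which the summands stay in the range where
exp y is at most 1 + y + y^2. This choice is optimal up to constants when S and t Q are of the same
order, as they are below.\<close>

lemma chernoff_bounded_sum:
  fixes Z :: "'i \<Rightarrow> 'a \<Rightarrow> real"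
  assumes fin: "finite I" and indep: "indep_vars (\<lambda>_. borel) Z I"
    and Q: "Q > 0" and bd: "\<And>i \<omega>. i \<in> I \<Longrightarrow> \<bar>Z i \<omega>\<bar> \<le> Q"
    and mean: "\<And>i. i \<in> I \<Longrightarrow> expectation (Z i) = 0"
    and var: "(\<Sum>i\<in>I. expectation (\<lambda>\<omega>. (Z i \<omega>)\<^sup>2)) \<le> S"
  shows "prob {\<omega> \<in> space M. t \<le> (\<Sum>i\<in>I. Z i \<omega>)} \<le> exp (S / Q\<^sup>2 - t / Q)"
proof -
  have m[measurable]: "Z i \<in> borel_measurable M" if "i \<in> I" for i
    using indep that by (auto simp: indep_vars_def)
  have int: "integrable M (Z i)" "integrable M (\<lambda>\<omega>. (Z i \<omega>)\<^sup>2)" "integrable M (\<lambda>\<omega>. exp (Z i \<omega> / Q))"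
    if i: "i \<in> I" for i
  proof -
    show "integrable M (Z i)"
      using i bd by (intro integrable_const_bound[of _ Q]) auto
    show "integrable M (\<lambda>\<omega>. (Z i \<omega>)\<^sup>2)"
      using i bd Q by (intro integrable_const_bound[of _ "Q\<^sup>2"]) (auto simp flip: abs_le_square_iff)
    have "Z i \<omega> / Q \<le> 1" for \<omega> using bd[OF i, of \<omega>] Q by (simp add: abs_le_iff)
    then show "integrable M (\<lambda>\<omega>. exp (Z i \<omega> / Q))"
      using i by (intro integrable_const_bound[of _ "exp 1"]) auto
  qed
  have one: "expectation (\<lambda>\<omega>. exp (Z i \<omega> / Q)) \<le> exp (expectation (\<lambda>\<omega>. (Z i \<omega>)\<^sup>2) / Q\<^sup>2)"
    if i: "i \<in> I" for i
  proof -
    have "exp (Z i \<omega> / Q) \<le> 1 + Z i \<omega> / Q + (Z i \<omega>)\<^sup>2 / Q\<^sup>2" for \<omega>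
      using exp_quadratic_bound[of "Z i \<omega> / Q"] bd[OF i, of \<omega>] Q by (simp add: power_divide)
    then have "expectation (\<lambda>\<omega>. exp (Z i \<omega> / Q))
        \<le> expectation (\<lambda>\<omega>. 1 + Z i \<omega> / Q + (Z i \<omega>)\<^sup>2 / Q\<^sup>2)"
      using int i by (intro integral_mono) auto
    also have "\<dots> = 1 + expectation (\<lambda>\<omega>. (Z i \<omega>)\<^sup>2) / Q\<^sup>2"
      using int i mean by (simp add: prob_space)
    also have "\<dots> \<le> exp (expectation (\<lambda>\<omega>. (Z i \<omega>)\<^sup>2) / Q\<^sup>2)" by (rule exp_ge_add_one_self)
    finally show ?thesis .
  qed
  have exps: "indep_vars (\<lambda>_. borel) (\<lambda>i \<omega>. exp (Z i \<omega> / Q)) I"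
    by (rule indep_vars_compose2[OF indep]) measurable
  have prod: "exp (1 / Q * (\<Sum>i\<in>I. Z i \<omega>)) = (\<Prod>i\<in>I. exp (Z i \<omega> / Q))" for \<omega>
    using fin by (simp add: exp_sum sum_divide_distrib)
  have iprod: "integrable M (\<lambda>\<omega>. \<Prod>i\<in>I. exp (Z i \<omega> / Q))"
    by (intro indep_vars_integrable[OF fin exps] int)
  have "integrable M (\<lambda>\<omega>. indicator (space M) \<omega> *\<^sub>R (\<Prod>i\<in>I. exp (Z i \<omega> / Q)))
      \<longleftrightarrow> integrable M (\<lambda>\<omega>. \<Prod>i\<in>I. exp (Z i \<omega> / Q))"
    by (intro Bochner_Integration.integrable_cong) auto
  with iprod have si: "set_integrable M (space M) (\<lambda>\<omega>. exp (1 / Q * (\<Sum>i\<in>I. Z i \<omega>)))"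
    unfolding prod set_integrable_def by simp
  have "prob {\<omega> \<in> space M. t \<le> (\<Sum>i\<in>I. Z i \<omega>)}
      \<le> exp (- (1 / Q) * t) * (\<integral>\<omega>\<in>space M. exp (1 / Q * (\<Sum>i\<in>I. Z i \<omega>)) \<partial>M)"
    using Q by (intro Chernoff_ineq_ge si) auto
  also have "(\<integral>\<omega>\<in>space M. exp (1 / Q * (\<Sum>i\<in>I. Z i \<omega>)) \<partial>M) = (\<Prod>i\<in>I. expectation (\<lambda>\<omega>. exp (Z i \<omega> / Q)))"
    unfolding prod
    by (subst set_integral_space) (use iprod indep_vars_lebesgue_integral[OF fin exps int(3)] in auto)
  also have "\<dots> \<le> (\<Prod>i\<in>I. exp (expectation (\<lambda>\<omega>. (Z i \<omega>)\<^sup>2) / Q\<^sup>2))"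
    using one by (intro prod_mono) (auto intro: integral_nonneg_AE)
  also have "\<dots> = exp ((\<Sum>i\<in>I. expectation (\<lambda>\<omega>. (Z i \<omega>)\<^sup>2)) / Q\<^sup>2)"
    using fin by (simp add: exp_sum sum_divide_distrib)
  also have "\<dots> \<le> exp (S / Q\<^sup>2)" using var by (simp add: divide_right_mono)
  finally have "prob {\<omega> \<in> space M. t \<le> (\<Sum>i\<in>I. Z i \<omega>)} \<le> exp (- (1 / Q) * t) * exp (S / Q\<^sup>2)"
    by simp
  then show ?thesis by (simp add: exp_add[symmetric] exp_diff exp_minus field_simps)
qed

end

section \<open>Linear growth of partial sums and maximal averages\<close>

lemma dyadic_tail_sum_le:
  fixes x :: real
  assumes "0 \<le> x"
  shows "(\<Sum>k<n. 2 ^ k * (if x > 2 ^ k then 1 else 0)) \<le> 2 * x"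
proof (induction n)
  case 0
  then show ?case using assms by simp
next
  case (Suc n)
  show ?case
  proof (cases "x > 2 ^ n")
    case True
    have "(\<Sum>k<Suc n. 2 ^ k * (if x > 2 ^ k then 1 else 0)) \<le> (\<Sum>k<Suc n. 2 ^ k :: real)"
      by (intro sum_mono) auto
    also have "\<dots> = 2 ^ Suc n - 1" by (induction n) auto
    also have "\<dots> \<le> 2 * x" using True by simp
    finally show ?thesis .
  qed (use Suc in simp)
qed

text \<open>The terms vanish until 2^k reaches x and decrease geometrically afterwards. The induction
carries the remainder 2 x^2 / 2^n of the geometric series.\<close>

lemma dyadic_truncated_square_sum_le:
  fixes x :: real
  assumes "0 \<le> x"
  shows "(\<Sum>k<n. (if x \<le> 2 ^ k then x else 0)\<^sup>2 / 2 ^ k) \<le> 2 * x"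
proof -
  have *: "(x \<le> 2 ^ n \<longrightarrow> (\<Sum>k<n. (if x \<le> 2 ^ k then x else 0)\<^sup>2 / 2 ^ k) \<le> 2 * x - 2 * x\<^sup>2 / 2 ^ n)
      \<and> (x > 2 ^ n \<longrightarrow> (\<Sum>k<n. (if x \<le> 2 ^ k then x else 0)\<^sup>2 / 2 ^ k) = 0)"
  proof (induction n)
    case 0
    have "x\<^sup>2 \<le> x" if "x \<le> 1" using that assms by (simp add: power2_eq_square mult_left_le)
    then show ?case by auto
  next
    case (Suc n)
    consider "x \<le> 2 ^ n" | "2 ^ n < x" "x \<le> 2 ^ Suc n" | "2 ^ Suc n < x" by linarith
    then show ?case
    proof cases
      case 1
      moreover have "x \<le> 2 ^ Suc n" using 1 assms by simp
      moreover have "2 * x\<^sup>2 / 2 ^ Suc n = x\<^sup>2 / 2 ^ n" "2 * x\<^sup>2 / 2 ^ n = 2 * (x\<^sup>2 / 2 ^ n)" by simp_all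
      ultimately show ?thesis using Suc 1 by auto
    next
      case 2
      have "x * x \<le> x * 2 ^ Suc n" using 2 assms by (intro mult_left_mono) auto
      then have "x\<^sup>2 / 2 ^ Suc n \<le> x" by (simp add: power2_eq_square field_simps)
      then show ?thesis using 2 Suc by simp
    next
      case 3
      moreover have "(2::real) ^ n \<le> 2 ^ Suc n" by simp
      ultimately have "2 ^ n < x" by linarith
      then show ?thesis using 3 Suc by simp
    qed
  qed
  have "0 \<le> 2 * x\<^sup>2 / 2 ^ n" by simp
  then show ?thesis using assms conjunct1[OF *] conjunct2[OF *] by linarith
qed

lemma exists_dyadic_between:
  fixes n :: nat
  assumes "n \<ge> 1"
  obtains k where "n \<le> 2 ^ k" "2 ^ k < 2 * n"
proof -
  define k where "k = (LEAST k. n \<le> 2 ^ k)"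
  have k: "n \<le> 2 ^ k" unfolding k_def by (rule LeastI[of _ n]) (simp add: less_imp_le)
  have "2 ^ k < 2 * n"
  proof (cases k)
    case 0
    then show ?thesis using assms by simp
  next
    case (Suc l)
    have "\<not> n \<le> 2 ^ l" using not_less_Least[of l "\<lambda>k. n \<le> 2 ^ k"] Suc by (simp add: k_def)
    then show ?thesis using Suc by simp
  qed
  with k show ?thesis by (rule that)
qed

text \<open>The upper half of the strong law of large numbers. In the k-th dyadic block the variables are
truncated at 2^k; the expected number of truncated variables and the normalized variances are both
summable over k, by the two preceding dyadic sums. Nonnegativity interpolates between powers of 2.\<close>

lemma (in prob_space) iid_partial_sums_linear:
  fixes H :: "nat \<Rightarrow> 'a \<Rightarrow> real"
  assumes indep: "indep_vars (\<lambda>_. borel) H UNIV" and nn: "\<And>i \<omega>. 0 \<le> H i \<omega>"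
    and int0: "integrable M (H 0)" and dist: "\<And>i. distr M borel (H i) = distr M borel (H 0)"
  shows "AE \<omega> in M. \<exists>C. \<forall>n. (\<Sum>i<n. H i \<omega>) \<le> C * real n"
proof -
  have m[measurable]: "H i \<in> borel_measurable M" for i using indep by (auto simp: indep_vars_def)
  have same: "expectation (\<lambda>\<omega>. g (H i \<omega>)) = expectation (\<lambda>\<omega>. g (H 0 \<omega>))"
    if g[measurable]: "g \<in> borel_measurable borel" for g :: "real \<Rightarrow> real" and i
    using integral_distr[of "H i" M borel g] integral_distr[of "H 0" M borel g] dist[of i] by simp
  define tr where "tr k x = (if x \<le> 2 ^ k then x else (0::real))" for k :: nat and x
  have [measurable]: "tr k \<in> borel_measurable borel" for k unfolding tr_def by measurable
  have tr_bd: "\<bar>tr k (H i \<omega>)\<bar> \<le> 2 ^ k" for k i \<omega> using nn[of i \<omega>] by (auto simp: tr_def)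
  have tr_int: "integrable M (\<lambda>\<omega>. tr k (H i \<omega>))" "integrable M (\<lambda>\<omega>. (tr k (H i \<omega>))\<^sup>2)" for k i
  proof -
    show "integrable M (\<lambda>\<omega>. tr k (H i \<omega>))"
      using tr_bd by (intro integrable_const_bound[of _ "2 ^ k"]) auto
    show "integrable M (\<lambda>\<omega>. (tr k (H i \<omega>))\<^sup>2)"
      using tr_bd by (intro integrable_const_bound[of _ "(2 ^ k)\<^sup>2"]) (auto simp flip: abs_le_square_iff)
  qed
  define e where "e k = expectation (\<lambda>\<omega>. tr k (H 0 \<omega>))" for k
  have e: "e k \<le> expectation (H 0)" for k
    unfolding e_def using int0 tr_int nn by (intro integral_mono) (auto simp: tr_def)
  define f1 where "f1 k \<omega> = (\<Sum>i<2 ^ k. if H i \<omega> > 2 ^ k then 1 else (0::real))" for k \<omega>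
  define f2 where "f2 k \<omega> = ((\<Sum>i<2 ^ k. tr k (H i \<omega>) - e k) / 2 ^ k)\<^sup>2" for k \<omega>
  have ind_int: "integrable M (\<lambda>\<omega>. if H i \<omega> > 2 ^ k then 1 else (0::real))" for i k
    by (intro integrable_const_bound[of _ 1]) auto
  have E1: "expectation (f1 k) = expectation (\<lambda>\<omega>. 2 ^ k * (if H 0 \<omega> > 2 ^ k then 1 else 0))" for k
  proof -
    have "expectation (f1 k) = (\<Sum>i<2 ^ k. expectation (\<lambda>\<omega>. if H i \<omega> > 2 ^ k then 1 else (0::real)))"
      unfolding f1_def using ind_int by (intro Bochner_Integration.integral_sum)
    also have "\<dots> = (\<Sum>i<(2::nat) ^ k. expectation (\<lambda>\<omega>. if H 0 \<omega> > 2 ^ k then 1 else (0::real)))"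
      by (intro sum.cong refl same) measurable
    finally show ?thesis by simp
  qed
  have T1: "AE \<omega> in M. (\<lambda>k. f1 k \<omega>) \<longlonglongrightarrow> 0"
  proof (rule AE_tendsto_0_of_summable_expectation)
    show "integrable M (f1 k)" for k
      unfolding f1_def using ind_int by (intro Bochner_Integration.integrable_sum)
    show "0 \<le> f1 k \<omega>" for k \<omega> by (auto simp: f1_def intro: sum_nonneg)
    show "summable (\<lambda>k. expectation (f1 k))"
    proof (rule summableI_nonneg_bounded)
      show "0 \<le> expectation (f1 k)" for k
        unfolding f1_def by (intro integral_nonneg_AE AE_I2 sum_nonneg) auto
      fix n
      have "(\<Sum>k<n. expectation (f1 k))
          = expectation (\<lambda>\<omega>. \<Sum>k<n. 2 ^ k * (if H 0 \<omega> > 2 ^ k then 1 else 0))"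
        unfolding E1 using ind_int
        by (intro Bochner_Integration.integral_sum[symmetric] integrable_mult_right)
      also have "\<dots> \<le> expectation (\<lambda>\<omega>. 2 * H 0 \<omega>)"
        using int0 ind_int nn
        by (intro integral_mono dyadic_tail_sum_le Bochner_Integration.integrable_sum integrable_mult_right) auto
      finally show "(\<Sum>k<n. expectation (f1 k)) \<le> expectation (\<lambda>\<omega>. 2 * H 0 \<omega>)" .
    qed
  qed
  have Ztr: "indep_vars (\<lambda>_. borel) (\<lambda>i \<omega>. tr k (H i \<omega>) - e k) {..<2 ^ k}" for k
    by (rule indep_vars_compose2[OF indep_vars_subset[OF indep]]) auto
  have Zmean: "expectation (\<lambda>\<omega>. tr k (H i \<omega>) - e k) = 0" for i k
    using tr_int same[of "tr k" i] by (simp add: prob_space e_def)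
  have Zint: "integrable M (\<lambda>\<omega>. tr k (H i \<omega>) - e k)" "integrable M (\<lambda>\<omega>. (tr k (H i \<omega>) - e k)\<^sup>2)" for i k
    using tr_int by (auto simp: power2_diff)
  have E2: "expectation (f2 k) \<le> expectation (\<lambda>\<omega>. (tr k (H 0 \<omega>))\<^sup>2 / 2 ^ k)" for k
  proof -
    have "expectation (f2 k) = expectation (\<lambda>\<omega>. (\<Sum>i<2 ^ k. tr k (H i \<omega>) - e k)\<^sup>2) / (2 ^ k)\<^sup>2"
      by (simp add: f2_def[abs_def] power_divide)
    also have "\<dots> = (\<Sum>i<(2::nat) ^ k. expectation (\<lambda>\<omega>. (tr k (H i \<omega>) - e k)\<^sup>2)) / (2 ^ k)\<^sup>2"
      by (subst expectation_square_sum_indep[OF _ Ztr]) (use Zint Zmean in auto)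
    also have "\<dots> \<le> (\<Sum>i<(2::nat) ^ k. expectation (\<lambda>\<omega>. (tr k (H 0 \<omega>))\<^sup>2)) / (2 ^ k)\<^sup>2"
    proof (intro divide_right_mono sum_mono)
      fix i
      have "expectation (\<lambda>\<omega>. (tr k (H i \<omega>) - e k)\<^sup>2) = expectation (\<lambda>\<omega>. (tr k (H 0 \<omega>) - e k)\<^sup>2)"
        by (rule same) measurable
      also have "\<dots> = expectation (\<lambda>\<omega>. (tr k (H 0 \<omega>))\<^sup>2) - (e k)\<^sup>2"
        using variance_eq[OF tr_int(1)[of k 0] tr_int(2)[of k 0]] by (simp add: e_def)
      also have "\<dots> \<le> expectation (\<lambda>\<omega>. (tr k (H 0 \<omega>))\<^sup>2)" by simp
      finally show "expectation (\<lambda>\<omega>. (tr k (H i \<omega>) - e k)\<^sup>2) \<le> expectation (\<lambda>\<omega>. (tr k (H 0 \<omega>))\<^sup>2)" .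
    qed simp
    also have "\<dots> = expectation (\<lambda>\<omega>. (tr k (H 0 \<omega>))\<^sup>2 / 2 ^ k)"
      by (simp add: power2_eq_square)
    finally show ?thesis .
  qed
  have T2: "AE \<omega> in M. (\<lambda>k. f2 k \<omega>) \<longlonglongrightarrow> 0"
  proof (rule AE_tendsto_0_of_summable_expectation)
    show "integrable M (f2 k)" for k
      unfolding f2_def power_divide
      by (intro integrable_divide integrable_square_sum_indep[OF _ Ztr]) (use Zint Zmean in auto)
    show "0 \<le> f2 k \<omega>" for k \<omega> by (simp add: f2_def)
    show "summable (\<lambda>k. expectation (f2 k))"
    proof (rule summableI_nonneg_bounded)
      show "0 \<le> expectation (f2 k)" for k by (auto simp: f2_def intro!: integral_nonneg_AE)
      fix n
      have "(\<Sum>k<n. expectation (f2 k)) \<le> (\<Sum>k<n. expectation (\<lambda>\<omega>. (tr k (H 0 \<omega>))\<^sup>2 / 2 ^ k))"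
        by (intro sum_mono E2)
      also have "\<dots> = expectation (\<lambda>\<omega>. \<Sum>k<n. (tr k (H 0 \<omega>))\<^sup>2 / 2 ^ k)"
        using tr_int by (intro Bochner_Integration.integral_sum[symmetric]) auto
      also have "\<dots> \<le> expectation (\<lambda>\<omega>. 2 * H 0 \<omega>)"
        using int0 tr_int(2) nn dyadic_truncated_square_sum_le
        by (intro integral_mono Bochner_Integration.integrable_sum) (auto simp: tr_def)
      finally show "(\<Sum>k<n. expectation (f2 k)) \<le> expectation (\<lambda>\<omega>. 2 * H 0 \<omega>)" .
    qed
  qed
  from T1 T2 show ?thesis
  proof eventually_elim
    fix \<omega> assume t: "(\<lambda>k. f1 k \<omega>) \<longlonglongrightarrow> 0" "(\<lambda>k. f2 k \<omega>) \<longlonglongrightarrow> 0"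
    define D where "D = expectation (H 0) + 1"
    have D: "D \<ge> 1" using nn by (auto simp: D_def intro: integral_nonneg_AE)
    have "\<forall>\<^sub>F k in sequentially. f1 k \<omega> < 1" "\<forall>\<^sub>F k in sequentially. f2 k \<omega> < 1"
      using order_tendstoD(2)[OF t(1), of 1] order_tendstoD(2)[OF t(2), of 1] by auto
    then have "\<forall>\<^sub>F k in sequentially. (\<Sum>i<2 ^ k. H i \<omega>) \<le> D * 2 ^ k"
    proof eventually_elim
      fix k assume f: "f1 k \<omega> < 1" "f2 k \<omega> < 1"
      have small: "H i \<omega> \<le> 2 ^ k" if "i < 2 ^ k" for i
      proof (rule ccontr)
        assume "\<not> H i \<omega> \<le> 2 ^ k"
        then have "1 \<le> (if H i \<omega> > 2 ^ k then 1 else (0::real))" by simp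
        also have "\<dots> \<le> f1 k \<omega>" unfolding f1_def using that
          by (intro member_le_sum[where f = "\<lambda>i. if H i \<omega> > 2 ^ k then 1 else (0::real)"]) auto
        finally show False using f by simp
      qed
      have "\<bar>(\<Sum>i<2 ^ k. tr k (H i \<omega>) - e k) / 2 ^ k\<bar> < 1"
        using f(2) unfolding f2_def by (simp add: abs_square_less_1)
      then have "(\<Sum>i<2 ^ k. tr k (H i \<omega>) - e k) \<le> 2 ^ k" by (simp add: abs_less_iff field_simps)
      moreover have "(\<Sum>i<2 ^ k. tr k (H i \<omega>)) = (\<Sum>i<2 ^ k. H i \<omega>)"
        using small by (intro sum.cong) (auto simp: tr_def)
      ultimately have "(\<Sum>i<2 ^ k. H i \<omega>) \<le> 2 ^ k + 2 ^ k * e k" by (simp add: sum_subtractf)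
      also have "\<dots> \<le> 2 ^ k + 2 ^ k * expectation (H 0)" using e by simp
      finally show "(\<Sum>i<2 ^ k. H i \<omega>) \<le> D * 2 ^ k" by (simp add: D_def algebra_simps)
    qed
    then obtain k0 where k0: "\<And>k. k \<ge> k0 \<Longrightarrow> (\<Sum>i<2 ^ k. H i \<omega>) \<le> D * 2 ^ k"
      by (auto simp: eventually_sequentially)
    define C where "C = 2 * D + (\<Sum>i<2 ^ k0. H i \<omega>)"
    have S0: "0 \<le> (\<Sum>i<2 ^ k0. H i \<omega>)" by (intro sum_nonneg nn)
    have "(\<Sum>i<n. H i \<omega>) \<le> C * real n" for n
    proof (cases "n = 0")
      case False
      then obtain k where k: "n \<le> 2 ^ k" "2 ^ k < 2 * n"
        using exists_dyadic_between[of n] by auto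
      have le: "(\<Sum>i<n. H i \<omega>) \<le> (\<Sum>i<2 ^ k. H i \<omega>)" using k nn by (intro sum_mono2) auto
      show ?thesis
      proof (cases "k \<ge> k0")
        case True
        have k': "(2::real) ^ k < 2 * real n"
          using k(2) by (metis of_nat_less_iff of_nat_mult of_nat_numeral of_nat_power)
        have "(\<Sum>i<n. H i \<omega>) \<le> D * 2 ^ k" using le k0[OF True] by linarith
        also have "\<dots> \<le> D * (2 * real n)" using k' D by (intro mult_left_mono) auto
        also have "\<dots> \<le> C * real n" using S0 by (simp add: C_def algebra_simps)
        finally show ?thesis .
      next
        case False
        have "(\<Sum>i<2 ^ k. H i \<omega>) \<le> (\<Sum>i<2 ^ k0. H i \<omega>)"
          using False nn by (intro sum_mono2) (auto intro: order.strict_trans2 power_increasing)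
        then have "(\<Sum>i<n. H i \<omega>) \<le> C * 1" using le D by (simp add: C_def)
        also have "\<dots> \<le> C * real n" using \<open>n \<noteq> 0\<close> D S0 by (intro mult_left_mono) (auto simp: C_def)
        finally show ?thesis .
      qed
    qed simp
    then show "\<exists>C. \<forall>n. (\<Sum>i<n. H i \<omega>) \<le> C * real n" by blast
  qed
qed

text \<open>An average over m terms is at most twice the average over the next power of two, by nonnegativity, so
the deviations along powers of two control all averages simultaneously.\<close>

lemma averages_square_le_dyadic_deviations:
  fixes V :: "nat \<Rightarrow> real"
  assumes V: "\<And>j. 0 \<le> V j" and m: "m \<ge> 1"
    and sm: "summable (\<lambda>k. ((\<Sum>j<2 ^ k. V j - v) / 2 ^ k)\<^sup>2)"
  shows "((1 / real m) * (\<Sum>j<m. V j))\<^sup>2 \<le> 8 * v\<^sup>2 + 8 * (\<Sum>k. ((\<Sum>j<2 ^ k. V j - v) / 2 ^ k)\<^sup>2)"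
proof -
  obtain k where k: "m \<le> 2 ^ k" "2 ^ k < 2 * m" using exists_dyadic_between[OF m] by blast
  define d where "d = (\<Sum>j<2 ^ k. V j - v) / 2 ^ k"
  have k': "(2::real) ^ k < 2 * real m"
    using k(2) by (metis of_nat_less_iff of_nat_mult of_nat_numeral of_nat_power)
  have S: "(\<Sum>j<2 ^ k. V j) = 2 ^ k * (v + d)" by (simp add: d_def sum_subtractf field_simps)
  have vd: "0 \<le> v + d"
  proof -
    have "0 \<le> (\<Sum>j<2 ^ k. V j)" by (intro sum_nonneg V)
    then have "\<not> v + d < 0" unfolding S using mult_pos_neg[of "2 ^ k" "v + d"] by auto
    then show ?thesis by simp
  qed
  have "(\<Sum>j<m. V j) \<le> (\<Sum>j<2 ^ k. V j)" using k V by (intro sum_mono2) auto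
  also have "\<dots> \<le> 2 * real m * (v + d)" unfolding S using k' vd by (intro mult_right_mono) auto
  finally have "(1 / real m) * (\<Sum>j<m. V j) \<le> 2 * (v + d)" using m by (simp add: field_simps)
  moreover have "0 \<le> (1 / real m) * (\<Sum>j<m. V j)" using V by (auto intro!: sum_nonneg divide_nonneg_nonneg)
  ultimately have "((1 / real m) * (\<Sum>j<m. V j))\<^sup>2 \<le> (2 * (v + d))\<^sup>2" by (intro power_mono)
  also have "\<dots> \<le> 8 * v\<^sup>2 + 8 * d\<^sup>2"
  proof -
    have "0 \<le> (v - d)\<^sup>2" by simp
    then show ?thesis by (simp add: power2_eq_square algebra_simps)
  qed
  also have "d\<^sup>2 \<le> (\<Sum>k. ((\<Sum>j<2 ^ k. V j - v) / 2 ^ k)\<^sup>2)"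
    unfolding d_def using sum_le_suminf[OF sm, of "{k}"] by simp
  finally show ?thesis by simp
qed

lemma (in prob_space)
  fixes V :: "nat \<Rightarrow> 'a \<Rightarrow> real"
  assumes indep: "indep_vars (\<lambda>_. borel) V UNIV"
    and int: "\<And>j. integrable M (V j)" and sq: "\<And>j. integrable M (\<lambda>\<omega>. (V j \<omega>)\<^sup>2)"
    and mean: "\<And>j. expectation (V j) = v" and sq_le: "\<And>j. expectation (\<lambda>\<omega>. (V j \<omega>)\<^sup>2) \<le> c"
  shows AE_summable_dyadic_deviations:
      "AE \<omega> in M. summable (\<lambda>k. ((\<Sum>j<2 ^ k. V j \<omega> - v) / 2 ^ k)\<^sup>2)"
    and dyadic_deviations_integral_finite:
      "(\<integral>\<^sup>+\<omega>. (\<Sum>k. ennreal (((\<Sum>j<2 ^ k. V j \<omega> - v) / 2 ^ k)\<^sup>2)) \<partial>M) < \<infinity>"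
proof -
  have Zi: "indep_vars (\<lambda>_. borel) (\<lambda>j \<omega>. V j \<omega> - v) {..<2 ^ k}" for k
    by (rule indep_vars_compose2[OF indep_vars_subset[OF indep]]) auto
  have Zmean: "expectation (\<lambda>\<omega>. V j \<omega> - v) = 0" for j using int mean by (simp add: prob_space)
  have Zint: "integrable M (\<lambda>\<omega>. V j \<omega> - v)" "integrable M (\<lambda>\<omega>. (V j \<omega> - v)\<^sup>2)" for j
    using int sq by (auto simp: power2_diff)
  let ?f = "\<lambda>k \<omega>. ((\<Sum>j<2 ^ k. V j \<omega> - v) / 2 ^ k)\<^sup>2"
  have i: "integrable M (?f k)" for k
    unfolding power_divide
    by (intro integrable_divide integrable_square_sum_indep[OF _ Zi]) (use Zint Zmean in auto)
  have le: "expectation (?f k) \<le> c * (1 / 2) ^ k" for k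
  proof -
    have "expectation (?f k) = (\<Sum>j<(2::nat) ^ k. expectation (\<lambda>\<omega>. (V j \<omega> - v)\<^sup>2)) / (2 ^ k)\<^sup>2"
      unfolding power_divide
      by (simp, subst expectation_square_sum_indep[OF _ Zi]) (use Zint Zmean in auto)
    also have "\<dots> \<le> (\<Sum>j<(2::nat) ^ k. c) / (2 ^ k)\<^sup>2"
    proof (intro divide_right_mono sum_mono)
      fix j
      have "expectation (\<lambda>\<omega>. (V j \<omega> - v)\<^sup>2) = expectation (\<lambda>\<omega>. (V j \<omega>)\<^sup>2) - v\<^sup>2"
        using variance_eq[OF int[of j] sq[of j]] by (simp add: mean)
      also have "\<dots> \<le> c" using sq_le[of j] by (smt (verit) zero_le_power2)
      finally show "expectation (\<lambda>\<omega>. (V j \<omega> - v)\<^sup>2) \<le> c" .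
    qed simp
    finally show ?thesis by (simp add: power2_eq_square power_divide)
  qed
  have s: "summable (\<lambda>k. expectation (?f k))"
  proof (rule summable_comparison_test'[where g = "\<lambda>k. c * (1 / 2) ^ k" and N = 0])
    show "summable (\<lambda>k. c * (1 / 2) ^ k)" by (intro summable_mult summable_geometric) simp
    show "norm (expectation (?f k)) \<le> c * (1 / 2) ^ k" for k
      using le[of k] by (simp add: integral_nonneg_AE)
  qed
  show "AE \<omega> in M. summable (\<lambda>k. ?f k \<omega>)"
    by (rule AE_summable_of_summable_expectation[OF i _ s]) simp
  show "(\<integral>\<^sup>+\<omega>. (\<Sum>k. ennreal (?f k \<omega>)) \<partial>M) < \<infinity>"
    by (rule nn_integral_suminf_finite[OF i _ s]) simp
qed

section \<open>The bandwidth and the stochastic rate\<close>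

definition window_var :: "(nat \<Rightarrow> nat \<Rightarrow> nat) \<Rightarrow> (nat \<Rightarrow> real) \<Rightarrow> nat \<Rightarrow> real" where
  "window_var m h n = (h n)\<^sup>2 + h n / gamma_n m n 1"

definition window_rate :: "(nat \<Rightarrow> nat \<Rightarrow> nat) \<Rightarrow> (nat \<Rightarrow> real) \<Rightarrow> nat \<Rightarrow> real" where
  "window_rate m h n = sqrt (window_var m h n * (ln (real n) / real n))"

abbreviation on_short_windows :: "real \<Rightarrow> real \<Rightarrow> real \<Rightarrow> (real \<Rightarrow> real \<Rightarrow> bool) \<Rightarrow> bool" where
  "on_short_windows a b w P \<equiv>
     (\<forall>s t. a \<le> s \<longrightarrow> s \<le> t \<longrightarrow> t \<le> b \<longrightarrow> t - s \<le> 2 * w \<longrightarrow> P s t)"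

lemma inverse_gamma_n: "1 / gamma_n m n 1 = (1 / real n) * (\<Sum>i<n. 1 / real (m n i))"
  by (simp add: gamma_n_def inverse_eq_divide)

lemma inverse_gamma_n_bounds:
  assumes "\<And>i. i < n \<Longrightarrow> 2 \<le> m n i"
  shows "0 \<le> 1 / gamma_n m n 1" "1 / gamma_n m n 1 \<le> 1 / 2"
proof -
  show "0 \<le> 1 / gamma_n m n 1" unfolding inverse_gamma_n by (intro mult_nonneg_nonneg sum_nonneg) auto
  have "(\<Sum>i<n. 1 / real (m n i)) \<le> (\<Sum>i<n. 1 / 2)"
  proof (rule sum_mono)
    fix i assume "i \<in> {..<n}"
    then have "2 \<le> real (m n i)" using assms[of i] by simp
    then show "1 / real (m n i) \<le> 1 / 2" by (simp add: field_simps)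
  qed
  then have "(1 / real n) * (\<Sum>i<n. 1 / real (m n i)) \<le> (1 / real n) * (real n / 2)"
    by (intro mult_left_mono) auto
  also have "\<dots> \<le> 1 / 2" by simp
  finally show "1 / gamma_n m n 1 \<le> 1 / 2" unfolding inverse_gamma_n .
qed

lemma window_rate_over_bandwidth:
  assumes "h n > 0"
  shows "window_rate m h n / h n = delta_n1 m n (h n)"
proof -
  have "window_rate m h n / h n = sqrt (window_var m h n * (ln (real n) / real n)) / sqrt ((h n)\<^sup>2)"
    using assms by (simp add: window_rate_def)
  also have "\<dots> = sqrt (window_var m h n * (ln (real n) / real n) / (h n)\<^sup>2)"
    by (simp only: real_sqrt_divide)
  also have "window_var m h n * (ln (real n) / real n) / (h n)\<^sup>2
      = (1 + inverse (h n * gamma_n m n 1)) * ln (real n) / real n"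
    using assms by (simp add: window_var_def power2_eq_square field_simps add_divide_distrib inverse_eq_divide)
  finally show ?thesis by (simp add: delta_n1_def)
qed

text \<open>What the bandwidth condition provides. Since 1/\<gamma> is at most 1/2, the variance proxy is
eventually at most h, and the condition says that it dominates (log n / n)^(1 - 2/\<rho>), hence also
log n / n. This gives the lower bounds on the rate and on h, and \<delta> tends to 0. The inequality with
exponent 1 - \<rho> says that truncation at the ratio of variance and rate is negligible; after taking
logarithms it states that the variance proxy dominates (log n / n)^(1 - 2/\<rho>).\<close>

lemma
  fixes h :: "nat \<Rightarrow> real"
  assumes h: "\<And>n. h n > 0" and h0: "h \<longlonglongrightarrow> 0" and \<rho>: "\<rho> > 2"
    and m: "\<And>n i. i < n \<Longrightarrow> 2 \<le> m n i"
    and lim: "(\<lambda>n. inverse ((h n)\<^sup>2 + h n / gamma_n m n 1) *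
              (ln (real n) / real n) powr (1 - 2 / \<rho>)) \<longlonglongrightarrow> 0"
  shows window_rates_eventually: "\<forall>\<^sub>F n in sequentially. n \<ge> 3 \<and> window_var m h n > 0 \<and> window_rate m h n > 0 \<and>
      1 / real n \<le> window_rate m h n \<and> 1 / real n \<le> h n \<and>
      (window_var m h n / window_rate m h n) powr (1 - \<rho>) \<le> window_rate m h n"
    and delta_n1_tendsto_0: "(\<lambda>n. delta_n1 m n (h n)) \<longlonglongrightarrow> 0"
proof -
  define e where "e = 1 - 2 / \<rho>"
  have e: "0 < e" "e < 1" using \<rho> by (auto simp: e_def)
  define r where "r n = inverse (window_var m h n) * (ln (real n) / real n) powr e" for n
  have r0: "r \<longlonglongrightarrow> 0" using lim by (simp add: r_def[abs_def] window_var_def e_def)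
  have L0: "(\<lambda>n. ln (real n) / real n) \<longlonglongrightarrow> 0" by (rule lim_ln_over_n)
  have basic: "\<forall>\<^sub>F n in sequentially. n \<ge> 3 \<and> ln (real n) \<ge> 1 \<and> ln (real n) / real n \<le> 1 \<and> h n \<le> 1 / 2 \<and> r n < 1"
    (is "eventually ?B _")
  proof -
    have "\<forall>\<^sub>F n in sequentially. h n < 1 / 2" "\<forall>\<^sub>F n in sequentially. r n < 1"
      "\<forall>\<^sub>F n in sequentially. ln (real n) / real n < 1" "\<forall>\<^sub>F n::nat in sequentially. n \<ge> 3"
      using order_tendstoD(2)[OF h0, of "1/2"] order_tendstoD(2)[OF r0, of 1] order_tendstoD(2)[OF L0, of 1]
        eventually_ge_at_top by auto
    then show ?thesis
    proof eventually_elim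
      fix n :: nat assume *: "h n < 1 / 2" "r n < 1" "ln (real n) / real n < 1" "n \<ge> 3"
      have "exp 1 \<le> real n" using exp_le *(4) by linarith
      then have "ln (real n) \<ge> 1" using *(4) by (simp add: ln_ge_iff)
      with * show "?B n" by (intro conjI; linarith)
    qed
  qed
  have core: "\<And>n. ?B n \<Longrightarrow> 0 < ln (real n) / real n \<and> ln (real n) / real n \<le> window_var m h n \<and>
      (ln (real n) / real n) powr e \<le> window_var m h n \<and> window_var m h n \<le> h n"
  proof -
    fix n assume B: "?B n"
    define lam where "lam = ln (real n) / real n"
    have lam: "0 < lam" "lam \<le> 1" using B by (auto simp: lam_def)
    have g: "0 \<le> 1 / gamma_n m n 1" "1 / gamma_n m n 1 \<le> 1 / 2"
      using inverse_gamma_n_bounds[of n m] m by auto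
    have hg: "h n / gamma_n m n 1 = h n * (1 / gamma_n m n 1)" by simp
    have v0: "0 < window_var m h n"
      unfolding window_var_def hg using h[of n] g by (intro add_pos_nonneg mult_nonneg_nonneg) auto
    have pw: "lam powr e \<le> window_var m h n"
      using B v0 by (simp add: r_def lam_def field_simps)
    have "lam powr 1 \<le> lam powr e" using lam e by (intro powr_mono') auto
    then have "lam \<le> window_var m h n" using pw lam by simp
    moreover have "window_var m h n \<le> h n * (1 / 2) + h n * (1 / 2)"
      unfolding window_var_def hg power2_eq_square using h[of n] g B by (intro add_mono mult_left_mono) auto
    ultimately show "0 < ln (real n) / real n \<and> ln (real n) / real n \<le> window_var m h n \<and>
      (ln (real n) / real n) powr e \<le> window_var m h n \<and> window_var m h n \<le> h n"
      using pw lam by (auto simp: lam_def)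
  qed
  show "\<forall>\<^sub>F n in sequentially. n \<ge> 3 \<and> window_var m h n > 0 \<and> window_rate m h n > 0 \<and>
      1 / real n \<le> window_rate m h n \<and> 1 / real n \<le> h n \<and>
      (window_var m h n / window_rate m h n) powr (1 - \<rho>) \<le> window_rate m h n"
    using basic
  proof eventually_elim
    fix n assume B: "?B n"
    define lam where "lam = ln (real n) / real n"
    define v where "v = window_var m h n"
    define w where "w = window_rate m h n"
    have c: "0 < lam" "lam \<le> v" "lam powr e \<le> v" "v \<le> h n" using core[OF B] by (auto simp: lam_def v_def)
    have v: "0 < v" using c by linarith
    have weq: "w = sqrt (v * lam)" by (simp add: w_def window_rate_def v_def lam_def)
    have w: "0 < w" using v c by (simp add: weq)
    have "1 / real n \<le> lam" using B by (simp add: lam_def divide_right_mono)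
    moreover have "lam \<le> w"
    proof -
      have "lam = sqrt (lam * lam)" using c by simp
      also have "\<dots> \<le> w" unfolding weq real_sqrt_le_iff using c by (intro mult_right_mono) auto
      finally show ?thesis .
    qed
    moreover have "(v / w) powr (1 - \<rho>) \<le> w"
    proof -
      have "e * ln lam \<le> ln v"
        using c(3) c(1) v ln_mono[of "lam powr e" v] by (simp add: ln_powr)
      then have "\<rho> * (e * ln lam) \<le> \<rho> * ln v" using \<rho> by (intro mult_left_mono) auto
      moreover have "\<rho> * (e * ln lam) = (\<rho> - 2) * ln lam" using \<rho> by (simp add: e_def right_diff_distrib)
      ultimately have 1: "(\<rho> - 2) * ln lam \<le> \<rho> * ln v" by simp
      have lw: "ln w = (ln v + ln lam) / 2" using v c by (simp add: weq ln_sqrt ln_mult)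
      have "(1 - \<rho>) * ln (v / w) \<le> ln w"
        using v w 1 by (simp add: ln_div lw field_simps)
      then have "exp ((1 - \<rho>) * ln (v / w)) \<le> exp (ln w)" by simp
      then show ?thesis using v w by (simp add: powr_def)
    qed
    ultimately show "n \<ge> 3 \<and> window_var m h n > 0 \<and> window_rate m h n > 0 \<and>
      1 / real n \<le> window_rate m h n \<and> 1 / real n \<le> h n \<and>
      (window_var m h n / window_rate m h n) powr (1 - \<rho>) \<le> window_rate m h n"
      using B c v w unfolding v_def[symmetric] w_def[symmetric] by auto
  qed
  have "(\<lambda>n. ln (real n) / real n + r n) \<longlonglongrightarrow> 0" using tendsto_add[OF L0 r0] by simp
  then have S: "(\<lambda>n. sqrt (ln (real n) / real n + r n)) \<longlonglongrightarrow> 0"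
    using tendsto_real_sqrt by fastforce
  show "(\<lambda>n. delta_n1 m n (h n)) \<longlonglongrightarrow> 0"
  proof (rule tendsto_sandwich[OF _ _ tendsto_const S])
    show "\<forall>\<^sub>F n in sequentially. 0 \<le> delta_n1 m n (h n)"
      using basic
    proof eventually_elim
      fix n assume "?B n"
      from core[OF this] have "0 \<le> window_var m h n * (ln (real n) / real n)"
        by (intro mult_nonneg_nonneg) linarith+
      then have "0 \<le> window_rate m h n" by (simp only: window_rate_def real_sqrt_ge_zero)
      then show "0 \<le> delta_n1 m n (h n)"
        using window_rate_over_bandwidth[where n = n and m = m and h = h, OF h] h[of n] by (metis divide_nonneg_pos)
    qed
    show "\<forall>\<^sub>F n in sequentially. delta_n1 m n (h n) \<le> sqrt (ln (real n) / real n + r n)"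
      using basic
    proof eventually_elim
      fix n assume B: "?B n"
      define lam where "lam = ln (real n) / real n"
      have c: "0 < lam" "lam \<le> window_var m h n" "lam powr e \<le> window_var m h n" "window_var m h n \<le> h n"
        using core[OF B] by (auto simp: lam_def)
      have lam1: "lam \<le> 1" using B by (simp add: lam_def)
      have "inverse (h n * gamma_n m n 1) * lam = (1 / gamma_n m n 1) * (inverse (h n) * lam)"
        by (simp add: inverse_eq_divide)
      also have "\<dots> \<le> 1 * (inverse (window_var m h n) * lam powr e)"
      proof (intro mult_mono)
        show "1 / gamma_n m n 1 \<le> 1" using inverse_gamma_n_bounds(2)[of n m] m by fastforce
        show "inverse (h n) \<le> inverse (window_var m h n)" using c by (intro le_imp_inverse_le) auto
        have "lam powr 1 \<le> lam powr e" using c lam1 e by (intro powr_mono') auto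
        then show "lam \<le> lam powr e" using c by simp
      qed (use c h[of n] in auto)
      finally have "inverse (h n * gamma_n m n 1) * lam \<le> r n" by (simp add: r_def lam_def)
      then show "delta_n1 m n (h n) \<le> sqrt (ln (real n) / real n + r n)"
        unfolding delta_n1_def real_sqrt_le_iff by (simp add: lam_def algebra_simps add_divide_distrib)
    qed
  qed
qed

section \<open>Uniform deviations over short intervals\<close>

text \<open>D n i s t stands for the average of nonnegative marks over those of the m n i observation points of the
i-th curve that lie in [s, t]. Monotonicity and subadditivity replace additivity in the interval, so that
closed intervals may be used throughout. The two terms in the second moment bound D_sq come from pairs of
distinct points and from single points. The variable H i dominates the \<rho>-th power of D n i s t for every n at
once, which is what makes H_lln applicable although D depends on n.\<close>

locale interval_array = prob_space M
  for M :: "'w measure"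
    and D :: "nat \<Rightarrow> nat \<Rightarrow> real \<Rightarrow> real \<Rightarrow> 'w \<Rightarrow> real"
    and m :: "nat \<Rightarrow> nat \<Rightarrow> nat" and h :: "nat \<Rightarrow> real"
    and H :: "nat \<Rightarrow> 'w \<Rightarrow> real" and a b c \<rho> :: real +
  assumes ab: "a < b" and c0: "c \<ge> 0" and \<rho>: "\<rho> > 2"
    and D_indep: "\<And>n s t. indep_vars (\<lambda>_. borel) (\<lambda>i. D n i s t) {..<n}"
    and D_nonneg: "\<And>n i s t \<omega>. 0 \<le> D n i s t \<omega>"
    and D_mono: "\<And>n i s t s' t' \<omega>. s' \<le> s \<Longrightarrow> t \<le> t' \<Longrightarrow> D n i s t \<omega> \<le> D n i s' t' \<omega>"
    and D_sub: "\<And>n i s t s' t' \<omega>. s' \<le> s \<Longrightarrow> s \<le> t \<Longrightarrow> t \<le> t' \<Longrightarrow>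
      D n i s' t' \<omega> \<le> D n i s' s \<omega> + D n i s t \<omega> + D n i t t' \<omega>"
    and D_int: "\<And>n i s t. i < n \<Longrightarrow> integrable M (D n i s t)"
    and D_int2: "\<And>n i s t. i < n \<Longrightarrow> integrable M (\<lambda>\<omega>. (D n i s t \<omega>)\<^sup>2)"
    and D_mean: "\<And>n i s t. i < n \<Longrightarrow> s \<le> t \<Longrightarrow> expectation (D n i s t) \<le> c * (t - s)"
    and D_sq: "\<And>n i s t. i < n \<Longrightarrow> s \<le> t \<Longrightarrow>
      expectation (\<lambda>\<omega>. (D n i s t \<omega>)\<^sup>2) \<le> c * ((t - s)\<^sup>2 + (t - s) / real (m n i))"
    and D_env: "AE \<omega> in M. \<forall>n i s t. i < n \<longrightarrow> D n i s t \<omega> powr \<rho> \<le> H i \<omega>"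
    and H_int: "\<And>i. integrable M (H i)" and H_mean: "\<And>i. expectation (H i) \<le> c"
    and H_lln: "AE \<omega> in M. \<exists>C. \<forall>n. (\<Sum>i<n. H i \<omega>) \<le> C * real n"
    and m2: "\<And>n i. i < n \<Longrightarrow> 2 \<le> m n i"
    and h_pos: "\<And>n. h n > 0" and h_lim: "h \<longlonglongrightarrow> 0"
    and bandwidth: "(\<lambda>n. inverse ((h n)\<^sup>2 + h n / gamma_n m n 1) *
              (ln (real n) / real n) powr (1 - 2 / \<rho>)) \<longlonglongrightarrow> 0"
begin

definition rates_hold :: "nat \<Rightarrow> bool" where
  "rates_hold n \<longleftrightarrow> n \<ge> 3 \<and> window_var m h n > 0 \<and> window_rate m h n > 0 \<and>
      1 / real n \<le> window_rate m h n \<and> 1 / real n \<le> h n \<and>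
      (window_var m h n / window_rate m h n) powr (1 - \<rho>) \<le> window_rate m h n"

text \<open>At this level the Chernoff exponents are multiples of log n: n times the variance divided by the square of
the level, and n times the rate divided by the level, are both equal to log n.\<close>

definition level :: "nat \<Rightarrow> real" where
  "level n = window_var m h n / window_rate m h n"

definition grid :: "nat \<Rightarrow> nat \<Rightarrow> real" where
  "grid n k = a + (b - a) * (real k / real n)"

definition truncated_deviation :: "nat \<Rightarrow> real \<Rightarrow> real \<Rightarrow> 'w \<Rightarrow> real" where
  "truncated_deviation n s t \<omega> =
    (\<Sum>i<n. min (D n i s t \<omega>) (level n) - expectation (\<lambda>\<omega>. min (D n i s t \<omega>) (level n)))"

text \<open>The first summand absorbs the variance of a row average over an interval of length 2 h + 2 (b - a) / n, and the
remaining 4 leaves the power n^-4 for the union bound over about n^2 pairs of grid points.\<close>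

definition tail_const :: real where
  "tail_const = c * (2 + 2 * (b - a))\<^sup>2 + 4"

lemma eventually_rates_hold: "\<forall>\<^sub>F n in sequentially. rates_hold n"
  unfolding rates_hold_def by (rule window_rates_eventually[OF h_pos h_lim \<rho> m2 bandwidth])

lemma level_pos: "rates_hold n \<Longrightarrow> 0 < level n"
  by (simp add: rates_hold_def level_def)

lemma D_measurable: "i < n \<Longrightarrow> D n i s t \<in> borel_measurable M"
  using D_int by blast

lemma truncated_deviation_tail:
  assumes g: "rates_hold n" and st: "s \<le> t" "t - s \<le> 2 * h n + 2 * (b - a) / real n"
  shows "prob {\<omega> \<in> space M. real n * (tail_const * window_rate m h n) \<le> \<bar>truncated_deviation n s t \<omega>\<bar>}
    \<le> 2 / real n ^ 4"
proof -
  define Q where "Q = level n"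
  define w where "w = window_rate m h n"
  define v where "v = window_var m h n"
  have n: "real n \<ge> 3" and w: "w > 0" and v: "v > 0" and Q: "Q > 0" and nh: "1 / real n \<le> h n"
    using g level_pos[OF g] by (auto simp: rates_hold_def w_def v_def Q_def)
  define Z where "Z i \<omega> = min (D n i s t \<omega>) Q - expectation (\<lambda>\<omega>. min (D n i s t \<omega>) Q)" for i \<omega>
  have mi: "integrable M (\<lambda>\<omega>. min (D n i s t \<omega>) Q)" "integrable M (\<lambda>\<omega>. (min (D n i s t \<omega>) Q)\<^sup>2)"
    if i: "i < n" for i
  proof -
    note [measurable] = D_measurable[OF i]
    show "integrable M (\<lambda>\<omega>. min (D n i s t \<omega>) Q)"
      using D_nonneg Q by (intro integrable_const_bound[of _ Q]) (auto simp: min_def)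
    show "integrable M (\<lambda>\<omega>. (min (D n i s t \<omega>) Q)\<^sup>2)"
      using D_nonneg Q by (intro integrable_const_bound[of _ "Q\<^sup>2"]) (auto simp: min_def intro!: power_mono)
  qed
  have em: "0 \<le> expectation (\<lambda>\<omega>. min (D n i s t \<omega>) Q)" "expectation (\<lambda>\<omega>. min (D n i s t \<omega>) Q) \<le> Q"
    if i: "i < n" for i
  proof -
    show "0 \<le> expectation (\<lambda>\<omega>. min (D n i s t \<omega>) Q)"
      using D_nonneg Q by (intro integral_nonneg_AE) (auto simp: min_def)
    show "expectation (\<lambda>\<omega>. min (D n i s t \<omega>) Q) \<le> Q"
      using integral_mono[OF mi(1)[OF i], of "\<lambda>_. Q"] by (simp add: prob_space)
  qed
  have indep: "indep_vars (\<lambda>_. borel) Z {..<n}"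
    unfolding Z_def by (rule indep_vars_compose2[OF D_indep]) measurable
  have bd: "\<bar>Z i \<omega>\<bar> \<le> Q" if "i < n" for i \<omega>
    using em[OF that] D_nonneg[of n i s t \<omega>] Q by (auto simp: Z_def min_def abs_le_iff)
  have mean: "expectation (Z i) = 0" if "i < n" for i
    using mi[OF that] by (simp add: Z_def[abs_def] prob_space)
  define L where "L = (2 + 2 * (b - a)) * h n"
  have hL: "t - s \<le> L"
  proof -
    have "(b - a) * (1 / real n) \<le> (b - a) * h n" using nh ab by (intro mult_left_mono) auto
    moreover have "L = 2 * h n + 2 * ((b - a) * h n)" by (simp add: L_def algebra_simps)
    moreover have "2 * (b - a) / real n = 2 * ((b - a) * (1 / real n))" by simp
    ultimately show ?thesis using st by linarith
  qed
  have var: "(\<Sum>i<n. expectation (\<lambda>\<omega>. (Z i \<omega>)\<^sup>2)) \<le> c * (2 + 2 * (b - a))\<^sup>2 * (real n * v)"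
  proof -
    have one: "expectation (\<lambda>\<omega>. (Z i \<omega>)\<^sup>2) \<le> c * (L\<^sup>2 + L / real (m n i))" if i: "i < n" for i
    proof -
      have "expectation (\<lambda>\<omega>. (Z i \<omega>)\<^sup>2) = expectation (\<lambda>\<omega>. (min (D n i s t \<omega>) Q)\<^sup>2)
          - (expectation (\<lambda>\<omega>. min (D n i s t \<omega>) Q))\<^sup>2"
        unfolding Z_def using mi[OF i] by (rule variance_eq)
      also have "\<dots> \<le> expectation (\<lambda>\<omega>. (min (D n i s t \<omega>) Q)\<^sup>2)" by simp
      also have "\<dots> \<le> expectation (\<lambda>\<omega>. (D n i s t \<omega>)\<^sup>2)"
        using mi[OF i] D_int2[OF i] D_nonneg Q by (intro integral_mono power_mono) (auto simp: min_def)
      also have "\<dots> \<le> c * ((t - s)\<^sup>2 + (t - s) / real (m n i))" by (rule D_sq[OF i st(1)])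
      also have "\<dots> \<le> c * (L\<^sup>2 + L / real (m n i))"
        using c0 st hL by (intro mult_left_mono add_mono power_mono divide_right_mono) auto
      finally show ?thesis .
    qed
    have "(\<Sum>i<n. expectation (\<lambda>\<omega>. (Z i \<omega>)\<^sup>2)) \<le> (\<Sum>i<n. c * (L\<^sup>2 + L / real (m n i)))"
      using one by (intro sum_mono) auto
    also have "\<dots> = c * (\<Sum>i<n. L\<^sup>2 + L * (1 / real (m n i)))"
      unfolding sum_distrib_left by simp
    also have "(\<Sum>i<n. L\<^sup>2 + L * (1 / real (m n i))) = real n * L\<^sup>2 + L * (\<Sum>i<n. 1 / real (m n i))"
      unfolding sum.distrib sum_distrib_left[symmetric] by simp
    also have "(\<Sum>i<n. 1 / real (m n i)) = real n * (1 / gamma_n m n 1)"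
      unfolding inverse_gamma_n using n by simp
    also have "c * (real n * L\<^sup>2 + L * (real n * (1 / gamma_n m n 1))) = c * (real n * (L\<^sup>2 + L * (1 / gamma_n m n 1)))"
      by (simp add: algebra_simps)
    also have "\<dots> \<le> c * (real n * ((2 + 2 * (b - a))\<^sup>2 * v))"
    proof (intro mult_left_mono)
      have C: "1 \<le> 2 + 2 * (b - a)" using ab by simp
      have "(2 + 2 * (b - a)) * 1 \<le> (2 + 2 * (b - a)) * (2 + 2 * (b - a))"
        using C by (intro mult_left_mono) auto
      then have "L * (1 / gamma_n m n 1) \<le> (2 + 2 * (b - a))\<^sup>2 * (h n * (1 / gamma_n m n 1))"
        unfolding L_def mult.assoc[of _ "h n"] power2_eq_square
        using h_pos[of n] inverse_gamma_n_bounds(1)[of n m] m2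
        by (intro mult_right_mono mult_nonneg_nonneg) auto
      then show "L\<^sup>2 + L * (1 / gamma_n m n 1) \<le> (2 + 2 * (b - a))\<^sup>2 * v"
        by (simp add: v_def window_var_def L_def power_mult_distrib distrib_left)
    qed (use c0 in auto)
    finally show ?thesis by (simp add: mult_ac)
  qed
  have expo: "exp (c * (2 + 2 * (b - a))\<^sup>2 * (real n * v) / Q\<^sup>2 - real n * (tail_const * w) / Q) = 1 / real n ^ 4"
  proof -
    have w2: "w\<^sup>2 = v * (ln (real n) / real n)"
      using v n unfolding w_def window_rate_def v_def[symmetric] by simp
    have Q1: "real n * w / Q = ln (real n)" "real n * v / Q\<^sup>2 = ln (real n)"
      using w v n w2 by (simp_all add: Q_def level_def v_def[symmetric] w_def[symmetric] power_divide field_simps power2_eq_square)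
    have "c * (2 + 2 * (b - a))\<^sup>2 * (real n * v) / Q\<^sup>2 - real n * (tail_const * w) / Q
        = c * (2 + 2 * (b - a))\<^sup>2 * (real n * v / Q\<^sup>2) - tail_const * (real n * w / Q)"
      by simp
    also have "\<dots> = - 4 * ln (real n)" unfolding Q1 tail_const_def by (simp add: algebra_simps)
    also have "exp (- 4 * ln (real n)) = 1 / exp (4 * ln (real n))" by (simp add: exp_minus inverse_eq_divide)
    also have "exp (4 * ln (real n)) = real n ^ 4"
      using n by (subst exp_of_nat_mult[of 4, simplified]) simp
    finally show ?thesis .
  qed
  define t' where "t' = real n * (tail_const * w)"
  have up: "prob {\<omega> \<in> space M. t' \<le> (\<Sum>i<n. Z i \<omega>)} \<le> 1 / real n ^ 4"
    using chernoff_bounded_sum[OF _ indep Q, of _ t'] bd mean var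
    unfolding expo[symmetric] t'_def by auto
  have indep': "indep_vars (\<lambda>_. borel) (\<lambda>i \<omega>. - Z i \<omega>) {..<n}"
    by (rule indep_vars_compose2[OF indep]) measurable
  have lo: "prob {\<omega> \<in> space M. t' \<le> (\<Sum>i<n. - Z i \<omega>)} \<le> 1 / real n ^ 4"
    using chernoff_bounded_sum[OF _ indep' Q, of _ t'] bd mean var
    unfolding expo[symmetric] t'_def by auto
  have [measurable]: "Z i \<in> borel_measurable M" if "i < n" for i
    using indep that by (auto simp: indep_vars_def)
  have sum_m [measurable]: "(\<lambda>\<omega>. \<Sum>i<n. Z i \<omega>) \<in> borel_measurable M"
    by (intro borel_measurable_sum) auto
  have "{\<omega> \<in> space M. t' \<le> \<bar>truncated_deviation n s t \<omega>\<bar>}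
      = {\<omega> \<in> space M. t' \<le> (\<Sum>i<n. Z i \<omega>)} \<union> {\<omega> \<in> space M. t' \<le> (\<Sum>i<n. - Z i \<omega>)}"
    by (auto simp: truncated_deviation_def Z_def[symmetric] Q_def[symmetric] sum_negf abs_if)
  also have "prob \<dots> \<le> prob {\<omega> \<in> space M. t' \<le> (\<Sum>i<n. Z i \<omega>)} + prob {\<omega> \<in> space M. t' \<le> (\<Sum>i<n. - Z i \<omega>)}"
    unfolding sum_negf by (intro measure_Un_le) measurable
  also have "\<dots> \<le> 2 / real n ^ 4" using up lo by simp
  finally show ?thesis by (simp add: t'_def w_def)
qed

text \<open>Intervals of length at most 2 h are enlarged by at most one mesh on each side, hence the slack. The index n + 1
is included for right end points in the last cell.\<close>

definition close_pairs :: "nat \<Rightarrow> (nat \<times> nat) set" where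
  "close_pairs n = {(k, l). k \<le> l \<and> l \<le> Suc n \<and> grid n l - grid n k \<le> 2 * h n + 2 * (b - a) / real n}"

lemma close_pairs: "finite (close_pairs n)" "n \<ge> 1 \<Longrightarrow> real (card (close_pairs n)) \<le> 9 * (real n)\<^sup>2"
proof -
  have sub: "close_pairs n \<subseteq> {..Suc n} \<times> {..Suc n}" by (auto simp: close_pairs_def)
  then show "finite (close_pairs n)" by (rule finite_subset) auto
  assume n: "n \<ge> 1"
  have "card (close_pairs n) \<le> (n + 2) * (n + 2)" using card_mono[OF _ sub] by simp
  also have "\<dots> \<le> (3 * n) * (3 * n)" using n by (intro mult_mono) auto
  finally have "card (close_pairs n) \<le> 9 * n\<^sup>2" by (simp add: power2_eq_square)
  then have "real (card (close_pairs n)) \<le> real (9 * n\<^sup>2)" by (rule of_nat_mono)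
  then show "real (card (close_pairs n)) \<le> 9 * (real n)\<^sup>2" by simp
qed

lemma truncated_deviations_on_grid:
  "AE \<omega> in M. \<forall>\<^sub>F n in sequentially. \<forall>(k, l)\<in>close_pairs n.
     \<bar>truncated_deviation n (grid n k) (grid n l) \<omega>\<bar> < real n * (tail_const * window_rate m h n)"
proof -
  define bad where "bad n p = {\<omega> \<in> space M. real n * (tail_const * window_rate m h n)
      \<le> \<bar>truncated_deviation n (grid n (fst p)) (grid n (snd p)) \<omega>\<bar>}" for n p
  define f where "f n \<omega> = (if rates_hold n then \<Sum>p\<in>close_pairs n. indicator (bad n p) \<omega> else (0::real))" for n \<omega>
  have [measurable]: "bad n p \<in> sets M" for n p
  proof -
    have "(\<lambda>\<omega>. truncated_deviation n s t \<omega>) \<in> borel_measurable M" for s t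
      unfolding truncated_deviation_def using D_measurable by (intro borel_measurable_sum) auto
    then show ?thesis unfolding bad_def by measurable
  qed
  have bad_int: "integrable M (indicator (bad n p) :: 'w \<Rightarrow> real)" for n p
    by (intro integrable_const_bound[of _ 1]) auto
  have int: "integrable M (f n)" for n
    unfolding f_def using bad_int by (cases "rates_hold n") (auto intro!: Bochner_Integration.integrable_sum)
  have f0: "0 \<le> f n \<omega>" for n \<omega> unfolding f_def by (auto intro!: sum_nonneg)
  have Ef: "expectation (f n) \<le> 18 / (real n)\<^sup>2" for n
  proof (cases "rates_hold n")
    case True
    have n: "n \<ge> 1" "real n > 0" using True by (auto simp: rates_hold_def)
    have "expectation (f n) = (\<Sum>p\<in>close_pairs n. prob (bad n p))"
      using True bad_int by (simp add: f_def[abs_def])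
    also have "\<dots> \<le> (\<Sum>p\<in>close_pairs n. 2 / real n ^ 4)"
    proof (rule sum_mono)
      fix p assume p: "p \<in> close_pairs n"
      have "grid n (fst p) \<le> grid n (snd p)"
        using p ab by (auto simp: close_pairs_def grid_def intro!: mult_left_mono divide_right_mono)
      moreover have "grid n (snd p) - grid n (fst p) \<le> 2 * h n + 2 * (b - a) / real n"
        using p by (auto simp: close_pairs_def)
      ultimately show "prob (bad n p) \<le> 2 / real n ^ 4"
        unfolding bad_def by (rule truncated_deviation_tail[OF True])
    qed
    also have "\<dots> \<le> 9 * (real n)\<^sup>2 * (2 / real n ^ 4)"
      unfolding sum_constant using close_pairs(2)[OF n(1)] by (intro mult_right_mono) auto
    also have "\<dots> = 18 / (real n)\<^sup>2" using n by (simp add: field_simps power2_eq_square power4_eq_xxxx)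
    finally show ?thesis .
  qed (simp add: f_def[abs_def])
  have "AE \<omega> in M. (\<lambda>n. f n \<omega>) \<longlonglongrightarrow> 0"
  proof (rule AE_tendsto_0_of_summable_expectation[OF int f0])
    show "summable (\<lambda>n. expectation (f n))"
    proof (rule summable_comparison_test'[where g = "\<lambda>n. 18 * (1 / (real n)\<^sup>2)" and N = 0])
      show "summable (\<lambda>n. 18 * (1 / (real n)\<^sup>2))"
        using inverse_power_summable[of 2, where 'a = real] by (intro summable_mult) (simp add: inverse_eq_divide)
      show "norm (expectation (f n)) \<le> 18 * (1 / (real n)\<^sup>2)" for n
        using Ef[of n] f0 by (simp add: integral_nonneg_AE)
    qed
  qed
  with AE_space show ?thesis
  proof eventually_elim
    fix \<omega> assume sp: "\<omega> \<in> space M" and "(\<lambda>n. f n \<omega>) \<longlonglongrightarrow> 0"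
    then have "\<forall>\<^sub>F n in sequentially. f n \<omega> < 1" using order_tendstoD(2) zero_less_one by blast
    with eventually_rates_hold show "\<forall>\<^sub>F n in sequentially. \<forall>(k, l)\<in>close_pairs n.
      \<bar>truncated_deviation n (grid n k) (grid n l) \<omega>\<bar> < real n * (tail_const * window_rate m h n)"
    proof eventually_elim
      fix n assume g: "rates_hold n" and f: "f n \<omega> < 1"
      have "\<omega> \<notin> bad n p" if p: "p \<in> close_pairs n" for p
      proof
        assume "\<omega> \<in> bad n p"
        then have "1 \<le> (indicator (bad n p) \<omega> :: real)" by simp
        also have "\<dots> \<le> f n \<omega>"
          using g p close_pairs(1) unfolding f_def
          by (simp, intro member_le_sum[where f = "\<lambda>p. indicator (bad n p) \<omega>"]) auto
        finally show False using f by simp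
      qed
      then show "\<forall>(k, l)\<in>close_pairs n.
        \<bar>truncated_deviation n (grid n k) (grid n l) \<omega>\<bar> < real n * (tail_const * window_rate m h n)"
        using sp by (force simp: bad_def not_le)
    qed
  qed
qed

lemma truncation_error:
  assumes "0 < Q" "0 \<le> x" "x powr \<rho> \<le> y"
  shows "0 \<le> x - min x Q" "x - min x Q \<le> Q powr (1 - \<rho>) * y"
proof -
  have y: "0 \<le> y" using assms(3) powr_ge_zero order_trans by blast
  show "0 \<le> x - min x Q" by simp
  show "x - min x Q \<le> Q powr (1 - \<rho>) * y"
  proof (cases "x \<le> Q")
    case True
    then show ?thesis using y by (simp add: min_def)
  next
    case False
    then have "x - min x Q \<le> x powr 1" using assms by simp
    also have "\<dots> = x powr (1 - \<rho>) * x powr \<rho>" by (simp flip: powr_add)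
    also have "\<dots> \<le> Q powr (1 - \<rho>) * y"
      using assms False \<rho> by (intro mult_mono powr_mono2') auto
    finally show ?thesis .
  qed
qed

text \<open>An interval is squeezed between two grid intervals that differ from it by at most one mesh at each end. Monotonicity transfers
the grid estimate, and the mean changes by at most c times the mesh, which is below the rate.\<close>

theorem uniform_interval_deviation:
  "AE \<omega> in M. \<exists>C. \<forall>\<^sub>F n in sequentially. on_short_windows a b (h n) (\<lambda>s t.
      \<bar>(1 / real n) * (\<Sum>i<n. D n i s t \<omega> - expectation (D n i s t))\<bar> \<le> C * window_rate m h n)"
  using truncated_deviations_on_grid H_lln D_env
proof eventually_elim
  fix \<omega>
  assume tr: "\<forall>\<^sub>F n in sequentially. \<forall>(k, l)\<in>close_pairs n.
     \<bar>truncated_deviation n (grid n k) (grid n l) \<omega>\<bar> < real n * (tail_const * window_rate m h n)"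
    and lln: "\<exists>C. \<forall>n. (\<Sum>i<n. H i \<omega>) \<le> C * real n"
    and env: "\<forall>n i s t. i < n \<longrightarrow> D n i s t \<omega> powr \<rho> \<le> H i \<omega>"
  from lln obtain CH where CH: "\<And>n. (\<Sum>i<n. H i \<omega>) \<le> CH * real n" by blast
  define A where "A = tail_const + CH + c"
  define C where "C = A + 2 * c * (b - a)"
  have ED: "expectation (\<lambda>\<omega>. D n i s t \<omega> - min (D n i s t \<omega>) Q) \<le> Q powr (1 - \<rho>) * c"
      "integrable M (\<lambda>\<omega>. min (D n i s t \<omega>) Q)"
    if i: "i < n" and Q: "0 < Q" for n i s t Q
  proof -
    note [measurable] = D_measurable[OF i]
    show mi: "integrable M (\<lambda>\<omega>. min (D n i s t \<omega>) Q)"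
      using D_nonneg Q by (intro integrable_const_bound[of _ Q]) (auto simp: min_def)
    have "expectation (\<lambda>\<omega>. D n i s t \<omega> - min (D n i s t \<omega>) Q) \<le> expectation (\<lambda>\<omega>. Q powr (1 - \<rho>) * H i \<omega>)"
    proof (rule integral_mono_AE)
      show "AE \<omega> in M. D n i s t \<omega> - min (D n i s t \<omega>) Q \<le> Q powr (1 - \<rho>) * H i \<omega>"
        using D_env by eventually_elim (use truncation_error Q D_nonneg i in auto)
    qed (use D_int[OF i] mi H_int in auto)
    also have "\<dots> \<le> Q powr (1 - \<rho>) * c" using H_mean by (simp add: mult_left_mono)
    finally show "expectation (\<lambda>\<omega>. D n i s t \<omega> - min (D n i s t \<omega>) Q) \<le> Q powr (1 - \<rho>) * c" .
  qed
  have "\<forall>\<^sub>F n in sequentially. on_short_windows a b (h n) (\<lambda>s t.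
      \<bar>(1 / real n) * (\<Sum>i<n. D n i s t \<omega> - expectation (D n i s t))\<bar> \<le> C * window_rate m h n)"
    using tr eventually_rates_hold
  proof eventually_elim
    fix n
    assume tr: "\<forall>(k, l)\<in>close_pairs n.
       \<bar>truncated_deviation n (grid n k) (grid n l) \<omega>\<bar> < real n * (tail_const * window_rate m h n)"
      and g: "rates_hold n"
    define w where "w = window_rate m h n"
    define Q where "Q = level n"
    have n: "real n > 0" and w: "w > 0" and Q: "Q > 0" and nw: "1 / real n \<le> w"
      and Qw: "Q powr (1 - \<rho>) \<le> w"
      using g level_pos[OF g] by (auto simp: rates_hold_def w_def Q_def level_def)
    define \<delta> where "\<delta> = (b - a) / real n"
    have \<delta>: "0 < \<delta>" "\<delta> \<le> (b - a) * w"
      using ab n nw mult_left_mono[OF nw, of "b - a"] by (auto simp: \<delta>_def)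
    have two_cells: "2 * (b - a) / real n = 2 * \<delta>" by (simp add: \<delta>_def)
    have grid_Suc: "grid n (Suc k) = grid n k + \<delta>" for k
      by (simp add: grid_def \<delta>_def field_simps add_divide_distrib)
    define av where "av s t = (1 / real n) * (\<Sum>i<n. D n i s t \<omega>)" for s t
    define ev where "ev s t = (1 / real n) * (\<Sum>i<n. expectation (D n i s t))" for s t
    have dev: "(1 / real n) * (\<Sum>i<n. D n i s t \<omega> - expectation (D n i s t)) = av s t - ev s t" for s t
      by (simp add: av_def ev_def sum_subtractf algebra_simps)
    have avg_const: "(1 / real n) * (\<Sum>i<n. x) = x" for x :: real using n by simp
    have H0: "0 \<le> (\<Sum>i<n. H i \<omega>)"
      using env by (intro sum_nonneg) (meson lessThan_iff order_trans powr_ge_zero)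
    have grid_dev: "\<bar>av (grid n k) (grid n l) - ev (grid n k) (grid n l)\<bar> \<le> A * w"
      if kl: "(k, l) \<in> close_pairs n" for k l
    proof -
      let ?D = "\<lambda>i. D n i (grid n k) (grid n l)"
      \<comment> \<open>Splitting into truncated deviation, random truncation error and mean truncation error.\<close>
      define x where "x = (1 / real n) * (\<Sum>i<n. ?D i \<omega> - min (?D i \<omega>) Q)"
      define y where "y = (1 / real n) * (\<Sum>i<n. expectation (\<lambda>\<omega>. ?D i \<omega> - min (?D i \<omega>) Q))"
      define z where "z = (1 / real n) * truncated_deviation n (grid n k) (grid n l) \<omega>"
      have "av (grid n k) (grid n l) - ev (grid n k) (grid n l) = z + x - y"
        using ED(2)[OF _ Q] D_int unfolding dev[symmetric] x_def y_def z_def truncated_deviation_def Q_def[symmetric]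
        by (simp add: sum_subtractf algebra_simps)
      moreover have "\<bar>z\<bar> \<le> tail_const * w"
      proof -
        have "\<bar>truncated_deviation n (grid n k) (grid n l) \<omega>\<bar> \<le> real n * (tail_const * w)"
          using tr kl by (force simp: w_def)
        then show ?thesis using n by (simp add: z_def abs_mult field_simps)
      qed
      moreover have "0 \<le> x" unfolding x_def by (intro mult_nonneg_nonneg sum_nonneg) auto
      moreover have "x \<le> CH * w"
      proof -
        have "x \<le> (1 / real n) * (\<Sum>i<n. Q powr (1 - \<rho>) * H i \<omega>)"
          unfolding x_def using truncation_error(2)[OF Q D_nonneg] env n by (intro mult_left_mono sum_mono) auto
        also have "\<dots> = Q powr (1 - \<rho>) * ((1 / real n) * (\<Sum>i<n. H i \<omega>))"
          by (simp add: sum_distrib_left[symmetric])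
        also have "\<dots> \<le> w * ((1 / real n) * (CH * real n))"
          using Qw CH[of n] n w H0 by (intro mult_mono mult_left_mono) auto
        finally show ?thesis using n by (simp add: mult.commute)
      qed
      moreover have "0 \<le> y" unfolding y_def by (intro mult_nonneg_nonneg sum_nonneg integral_nonneg_AE) auto
      moreover have "y \<le> c * w"
      proof -
        have "y \<le> (1 / real n) * (\<Sum>i<n. Q powr (1 - \<rho>) * c)"
          unfolding y_def using ED(1)[OF _ Q] n by (intro mult_left_mono sum_mono) auto
        also have "\<dots> = Q powr (1 - \<rho>) * c" by (rule avg_const)
        also have "\<dots> \<le> w * c" using Qw c0 by (intro mult_right_mono)
        finally show ?thesis by (simp add: mult.commute)
      qed
      ultimately show ?thesis unfolding A_def by (simp add: algebra_simps abs_le_iff)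
    qed
    have av_mono: "av s t \<le> av s' t'" if "s' \<le> s" "t \<le> t'" for s t s' t'
      unfolding av_def using n D_mono[OF that] by (intro mult_left_mono sum_mono) auto
    have ev_mean: "ev s t \<le> c * (t - s)" if "s \<le> t" for s t
    proof -
      have "ev s t \<le> (1 / real n) * (\<Sum>i<n. c * (t - s))"
        unfolding ev_def using n D_mean that by (intro mult_left_mono sum_mono) auto
      then show ?thesis unfolding avg_const .
    qed
    have ev_sub: "ev s' t' \<le> ev s t + c * (s - s') + c * (t' - t)" if st: "s' \<le> s" "s \<le> t" "t \<le> t'" for s t s' t'
    proof -
      have "expectation (D n i s' t') \<le> expectation (D n i s' s) + expectation (D n i s t) + expectation (D n i t t')"
        if i: "i < n" for i
      proof -
        have "expectation (D n i s' t') \<le> expectation (\<lambda>\<omega>. D n i s' s \<omega> + D n i s t \<omega> + D n i t t' \<omega>)"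
          using D_int[OF i] D_sub[OF st] by (intro integral_mono) auto
        also have "\<dots> = expectation (D n i s' s) + expectation (D n i s t) + expectation (D n i t t')"
          using D_int[OF i] by simp
        finally show ?thesis .
      qed
      then have "ev s' t' \<le> (1 / real n) * (\<Sum>i<n. expectation (D n i s' s) + expectation (D n i s t) + expectation (D n i t t'))"
        unfolding ev_def using n by (intro mult_left_mono sum_mono) auto
      also have "\<dots> = ev s' s + ev s t + ev t t'"
        by (simp add: ev_def sum.distrib algebra_simps)
      finally show ?thesis using ev_mean[OF st(1)] ev_mean[OF st(3)] by linarith
    qed
    show "on_short_windows a b (h n) (\<lambda>s t.
      \<bar>(1 / real n) * (\<Sum>i<n. D n i s t \<omega> - expectation (D n i s t))\<bar> \<le> C * window_rate m h n)"
    proof (intro allI impI)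
      fix s t assume as: "a \<le> s" and st: "s \<le> t" and tb: "t \<le> b" and len: "t - s \<le> 2 * h n"
      have cell: "\<exists>k\<le>n. grid n k \<le> x \<and> x \<le> grid n (Suc k) \<and> k = nat \<lfloor>(x - a) / \<delta>\<rfloor>" if x: "a \<le> x" "x \<le> b" for x
      proof -
        define k where "k = nat \<lfloor>(x - a) / \<delta>\<rfloor>"
        have p: "0 \<le> (x - a) / \<delta>" using x \<delta> by simp
        have k1: "real k \<le> (x - a) / \<delta>" "(x - a) / \<delta> \<le> real k + 1" using p by (simp_all add: k_def)
        have g: "grid n k = a + \<delta> * real k" for k by (simp add: grid_def \<delta>_def)
        have "real k * \<delta> \<le> x - a" "x - a \<le> (real k + 1) * \<delta>"
          using k1 \<delta> by (simp_all add: pos_le_divide_eq pos_divide_le_eq)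
        then have "grid n k \<le> x" "x \<le> grid n (Suc k)" unfolding g by (simp_all add: algebra_simps)
        moreover have "k \<le> n"
        proof -
          have "(x - a) / \<delta> \<le> (b - a) / \<delta>" using x \<delta> by (intro divide_right_mono) auto
          also have "\<dots> = real n" using ab n by (simp add: \<delta>_def)
          finally show ?thesis using k1(1) by linarith
        qed
        ultimately show ?thesis using k_def by blast
      qed
      obtain k where k: "k \<le> n" "grid n k \<le> s" "s \<le> grid n (Suc k)" "k = nat \<lfloor>(s - a) / \<delta>\<rfloor>"
        using cell[of s] as st tb by auto
      obtain l where l: "l \<le> n" "grid n l \<le> t" "t \<le> grid n (Suc l)" "l = nat \<lfloor>(t - a) / \<delta>\<rfloor>"
        using cell[of t] as st tb by auto
      have kl: "k \<le> l" unfolding k(4) l(4) using st \<delta> by (intro nat_mono floor_mono divide_right_mono) auto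
      have outer: "(k, Suc l) \<in> close_pairs n"
      proof -
        have "grid n (Suc l) \<le> t + \<delta>" "s \<le> grid n k + \<delta>" using l(2) k(3) by (simp_all add: grid_Suc)
        then show ?thesis using len kl l(1) unfolding close_pairs_def two_cells by auto
      qed
      have e1: "grid n (Suc l) - t \<le> \<delta>" "s - grid n k \<le> \<delta>" "grid n (Suc k) - s \<le> \<delta>" "t - grid n l \<le> \<delta>"
        using k l by (simp_all add: grid_Suc)
      have mul: "c * x \<le> c * \<delta>" if "x \<le> \<delta>" for x using that c0 by (intro mult_left_mono)
      have c\<delta>: "c * \<delta> \<le> c * (b - a) * w" using \<delta> c0 by (simp add: mult.assoc mult_left_mono)
      have up: "av s t - ev s t \<le> A * w + 2 * (c * \<delta>)"
        using av_mono[OF k(2) l(3)] grid_dev[OF outer] ev_sub[OF k(2) st l(3)] mul[OF e1(1)] mul[OF e1(2)]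
        unfolding abs_le_iff by linarith
      have A0: "0 \<le> A * w" using grid_dev[OF outer] by linarith
      \<comment> \<open>Without an inner grid interval, s and t share a cell, and the mean itself is of the order of the mesh.\<close>
      have low: "ev s t - av s t \<le> A * w + 2 * (c * \<delta>)"
      proof (cases "Suc k \<le> l")
        case True
        have le: "grid n (Suc k) \<le> grid n l"
          unfolding grid_def using True ab n by (intro add_left_mono mult_left_mono divide_right_mono) auto
        have "(Suc k, l) \<in> close_pairs n"
          using True l k(3) len \<delta>(1) unfolding close_pairs_def two_cells by auto
        from grid_dev[OF this] show ?thesis
          using av_mono[OF k(3) l(2)] ev_sub[OF k(3) le l(2)] mul[OF e1(3)] mul[OF e1(4)]
          unfolding abs_le_iff by linarith
      next
        case False
        then have "k = l" using kl by simp
        then have "t - s \<le> \<delta>" using k l by (simp add: grid_Suc)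
        then have "ev s t \<le> c * \<delta>" using ev_mean[OF st] mul by fastforce
        moreover have "0 \<le> av s t" unfolding av_def using D_nonneg by (intro mult_nonneg_nonneg sum_nonneg) auto
        moreover have "0 \<le> c * \<delta>" using c0 \<delta> by simp
        ultimately show ?thesis using A0 by linarith
      qed
      have "C * w = A * w + 2 * (c * (b - a) * w)" by (simp add: C_def algebra_simps)
      then show "\<bar>(1 / real n) * (\<Sum>i<n. D n i s t \<omega> - expectation (D n i s t))\<bar> \<le> C * window_rate m h n"
        unfolding dev w_def[symmetric] abs_le_iff using up low c\<delta> by linarith
    qed
  qed
  then show "\<exists>C. \<forall>\<^sub>F n in sequentially. on_short_windows a b (h n) (\<lambda>s t.
      \<bar>(1 / real n) * (\<Sum>i<n. D n i s t \<omega> - expectation (D n i s t))\<bar> \<le> C * window_rate m h n)" by blast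
qed

end

section \<open>Independence and measurability of the sampled data\<close>

lemma powr_add_le:
  fixes x y :: real
  assumes "0 \<le> x" "0 \<le> y" "0 \<le> \<rho>"
  shows "(x + y) powr \<rho> \<le> 2 powr \<rho> * (x powr \<rho> + y powr \<rho>)"
proof -
  have "(x + y) powr \<rho> \<le> (2 * max x y) powr \<rho>" using assms by (intro powr_mono2) auto
  also have "\<dots> = 2 powr \<rho> * (max x y) powr \<rho>" using assms by (simp add: powr_mult)
  also have "(max x y) powr \<rho> \<le> x powr \<rho> + y powr \<rho>" by (auto simp: max_def)
  finally show ?thesis by simp
qed

lemma square_le_one_plus_powr:
  fixes x :: real
  assumes "0 \<le> x" "2 \<le> \<rho>"
  shows "x\<^sup>2 \<le> 1 + x powr \<rho>"
proof (cases "x \<le> 1")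
  case True
  then have "x\<^sup>2 \<le> 1" using assms by (simp add: power_le_one)
  then show ?thesis by (simp add: add_increasing2)
next
  case False
  then have "x\<^sup>2 = x powr 2" by (simp add: powr_numeral)
  also have "\<dots> \<le> x powr \<rho>" using False assms by (intro powr_mono) auto
  finally show ?thesis by simp
qed

lemma le_one_plus_square: "(x::real) \<le> 1 + x\<^sup>2"
  using zero_le_power2[of "x - 1/2"] by (simp add: power2_eq_square algebra_simps)

lemma Int_stable_generated_events: "Int_stable (generated_events M N f)"
  unfolding Int_stable_def generated_events_def
proof safe
  fix A B assume "A \<in> sets N" "B \<in> sets N"
  then show "\<exists>C. f -` A \<inter> space M \<inter> (f -` B \<inter> space M) = f -` C \<inter> space M \<and> C \<in> sets N"
    by (intro exI[of _ "A \<inter> B"]) auto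
qed

context functional_data
begin

definition source_events :: "source \<Rightarrow> 'w set set" where
  "source_events k = (case k of
      Curve i \<Rightarrow> generated_events M S (Xs i)
    | Time i j \<Rightarrow> generated_events M borel (T i j)
    | Error i j \<Rightarrow> generated_events M borel (U i j))"

text \<open>Independence is stated for three kinds of sources with values in different spaces. It is used through the
events that depend on a set of sources only: functions measurable for disjoint sets of sources are independent.\<close>

definition source_sigma :: "source set \<Rightarrow> 'w measure" where
  "source_sigma J = sigma (space M) (\<Union>k\<in>J. source_events k)"

definition row :: "nat \<Rightarrow> source set" where
  "row i = insert (Curve i) (range (Time i) \<union> range (Error i))"

lemma T_measurable: "T i j \<in> borel_measurable M"
  using distributed_measurable[OF T_density[of i j]] by simp

lemma source_events_sub: "source_events k \<subseteq> events"
  using Xs_measurable T_measurable U_measurable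
  by (cases k) (auto simp: source_events_def generated_events_def intro: measurable_sets)

lemma Int_stable_source_events: "Int_stable (source_events k)"
  by (cases k) (simp_all add: source_events_def Int_stable_generated_events)

lemma source_sigma: "space (source_sigma J) = space M"
  "sets (source_sigma J) = sigma_sets (space M) (\<Union>k\<in>J. source_events k)"
  "sets (source_sigma J) \<subseteq> events"
proof -
  have sub: "(\<Union>k\<in>J. source_events k) \<subseteq> events" using source_events_sub by blast
  then have pow: "(\<Union>k\<in>J. source_events k) \<subseteq> Pow (space M)" using sets.space_closed by blast
  show "space (source_sigma J) = space M" by (simp add: source_sigma_def pow)
  show *: "sets (source_sigma J) = sigma_sets (space M) (\<Union>k\<in>J. source_events k)"
    by (simp add: source_sigma_def pow)
  show "sets (source_sigma J) \<subseteq> events"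
    unfolding * by (rule sets.sigma_sets_subset[OF sub])
qed

lemma source_measurable_imp_measurable:
  assumes "f \<in> measurable (source_sigma J) N"
  shows "f \<in> measurable M N"
  using assms source_sigma(1,3)[of J] by (auto simp: measurable_def)

lemma measurable_source:
  assumes f: "f \<in> measurable M N" and sub: "generated_events M N f = source_events k" and k: "k \<in> J"
  shows "f \<in> measurable (source_sigma J) N"
proof (rule measurableI)
  show "f x \<in> space N" if "x \<in> space (source_sigma J)" for x
    using that measurable_space[OF f] by (simp add: source_sigma)
  fix A assume "A \<in> sets N"
  then have "f -` A \<inter> space M \<in> source_events k" unfolding sub[symmetric] by (auto simp: generated_events_def)
  then show "f -` A \<inter> space (source_sigma J) \<in> sets (source_sigma J)"
    using k by (auto simp: source_sigma intro!: sigma_sets.Basic)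
qed

lemma Xs_source: "Curve i \<in> J \<Longrightarrow> Xs i \<in> measurable (source_sigma J) S"
  by (rule measurable_source[OF Xs_measurable, of _ "Curve i"]) (auto simp: source_events_def)

lemma T_source: "Time i j \<in> J \<Longrightarrow> T i j \<in> borel_measurable (source_sigma J)"
  by (rule measurable_source[OF T_measurable, of _ _ "Time i j"]) (auto simp: source_events_def)

lemma U_source: "Error i j \<in> J \<Longrightarrow> U i j \<in> borel_measurable (source_sigma J)"
  by (rule measurable_source[OF U_measurable, of _ _ "Error i j"]) (auto simp: source_events_def)

lemma T_restrict_source: "Time i j \<in> J \<Longrightarrow> T i j \<in> measurable (source_sigma J) (restrict_space borel {a..b})"
  using T_range by (intro measurable_restrict_space2 T_source) (auto simp: source_sigma)

lemma indep_sets_source_sigma: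
  assumes "disjoint_family_on J L"
  shows "indep_sets (\<lambda>l. sets (source_sigma (J l))) L"
proof -
  have "indep_sets source_events UNIV"
    using independent unfolding source_events_def[abs_def] .
  then have "indep_sets source_events (\<Union>l\<in>L. J l)" by (rule indep_sets_mono_index[rotated]) auto
  then show ?thesis
    unfolding source_sigma(2) using Int_stable_source_events assms by (rule indep_sets_collect_sigma)
qed

lemma indep_source_functions:
  assumes disj: "disjoint_family_on J L"
    and Y: "\<And>l. l \<in> L \<Longrightarrow> Y l \<in> measurable (source_sigma (J l)) (N l)"
  shows "indep_vars N Y L"
  unfolding indep_vars_def2
proof
  show "\<forall>l\<in>L. Y l \<in> measurable M (N l)" using Y source_measurable_imp_measurable by blast
  show "indep_sets (\<lambda>l. {Y l -` A \<inter> space M |A. A \<in> sets (N l)}) L"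
  proof (rule indep_sets_mono_sets[OF indep_sets_source_sigma[OF disj]])
    fix l assume "l \<in> L"
    then show "{Y l -` A \<inter> space M |A. A \<in> sets (N l)} \<subseteq> sets (source_sigma (J l))"
      using measurable_sets[OF Y[of l]] by (auto simp: source_sigma(1))
  qed
qed

lemma source_indep_var:
  assumes "J1 \<inter> J2 = {}" "Y1 \<in> measurable (source_sigma J1) N1" "Y2 \<in> measurable (source_sigma J2) N2"
  shows "indep_var N1 Y1 N2 Y2"
  unfolding indep_var_def
proof (rule indep_source_functions[where J = "case_bool J1 J2"])
  show "disjoint_family_on (case_bool J1 J2) UNIV"
    using assms(1) by (auto simp: disjoint_family_on_def split: bool.splits)
  show "case_bool Y1 Y2 l \<in> measurable (source_sigma (case_bool J1 J2 l)) (case_bool N1 N2 l)" for l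
    using assms by (cases l) auto
qed

lemma source_indep_prob:
  assumes "J1 \<inter> J2 = {}" "A \<in> sets (source_sigma J1)" "B \<in> sets (source_sigma J2)"
  shows "prob (A \<inter> B) = prob A * prob B"
proof -
  have "indep_sets (\<lambda>l. sets (source_sigma (case_bool J1 J2 l))) UNIV"
    using assms(1) by (intro indep_sets_source_sigma) (auto simp: disjoint_family_on_def split: bool.splits)
  then have "indep_set (sets (source_sigma J1)) (sets (source_sigma J2))"
    unfolding indep_set_def by (rule indep_sets_cong[THEN iffD1, rotated 2]) (auto split: bool.splits)
  then show ?thesis by (rule indep_setD) (use assms in auto)
qed

text \<open>The two functions may take values in different spaces, as needed for a curve together with an observation time.\<close>

lemma source_pair_law:
  assumes J: "J1 \<inter> J2 = {}"
    and Y1: "Y1 \<in> measurable (source_sigma J1) N1" and Y2: "Y2 \<in> measurable (source_sigma J2) N2"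
  shows "distr M (N1 \<Otimes>\<^sub>M N2) (\<lambda>\<omega>. (Y1 \<omega>, Y2 \<omega>)) = distr M N1 Y1 \<Otimes>\<^sub>M distr M N2 Y2"
proof -
  have m1: "Y1 \<in> measurable M N1" and m2: "Y2 \<in> measurable M N2"
    using Y1 Y2 source_measurable_imp_measurable by auto
  interpret p1: prob_space "distr M N1 Y1" by (rule prob_space_distr[OF m1])
  interpret p2: prob_space "distr M N2 Y2" by (rule prob_space_distr[OF m2])
  show ?thesis
  proof (rule pair_measure_eqI[symmetric])
    show "sigma_finite_measure (distr M N1 Y1)" "sigma_finite_measure (distr M N2 Y2)" by unfold_locales
    show "sets (distr M N1 Y1 \<Otimes>\<^sub>M distr M N2 Y2) = sets (distr M (N1 \<Otimes>\<^sub>M N2) (\<lambda>\<omega>. (Y1 \<omega>, Y2 \<omega>)))"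
      by (simp cong: sets_pair_measure_cong)
    fix A B assume A: "A \<in> sets (distr M N1 Y1)" and B: "B \<in> sets (distr M N2 Y2)"
    have "(\<lambda>\<omega>. (Y1 \<omega>, Y2 \<omega>)) -` (A \<times> B) \<inter> space M = (Y1 -` A \<inter> space M) \<inter> (Y2 -` B \<inter> space M)" by auto
    moreover have "prob ((Y1 -` A \<inter> space M) \<inter> (Y2 -` B \<inter> space M))
        = prob (Y1 -` A \<inter> space M) * prob (Y2 -` B \<inter> space M)"
      using measurable_sets[OF Y1, of A] measurable_sets[OF Y2, of B] A B
      by (intro source_indep_prob[OF J]) (auto simp: source_sigma(1))
    ultimately show "emeasure (distr M N1 Y1) A * emeasure (distr M N2 Y2) B
        = emeasure (distr M (N1 \<Otimes>\<^sub>M N2) (\<lambda>\<omega>. (Y1 \<omega>, Y2 \<omega>))) (A \<times> B)"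
      using A B m1 m2 by (simp add: emeasure_distr emeasure_eq_measure ennreal_mult'')
  qed
qed

lemma disjoint_rows: "disjoint_family_on row L"
  by (auto simp: disjoint_family_on_def row_def)

definition path_norm :: "(real \<Rightarrow> real) \<Rightarrow> ennreal" where
  "path_norm x = (SUP t\<in>{a..b}. ennreal \<bar>x t\<bar>)"

lemma path_norm_measurable: "path_norm \<in> borel_measurable S"
  using path_space unfolding path_space_def path_norm_def[abs_def] by simp

lemma evaluation_measurable:
  "(\<lambda>(x, t). x t) \<in> borel_measurable (S \<Otimes>\<^sub>M restrict_space borel {a..b})"
  using path_space unfolding path_space_def by simp

lemma T_probability_le:
  assumes f: "\<And>x. x \<in> {a..b} \<Longrightarrow> f\<^sub>T x \<le> C" and C: "0 \<le> C" and st: "s \<le> t"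
  shows "prob (T i j -` {s..t} \<inter> space M) \<le> C * (t - s)"
proof -
  have "emeasure M (T i j -` {s..t} \<inter> space M)
      = (\<integral>\<^sup>+x. ennreal (f\<^sub>T x) * indicator {a..b} x * indicator {s..t} x \<partial>lborel)"
    by (rule distributed_emeasure[OF T_density]) simp
  also have "\<dots> \<le> (\<integral>\<^sup>+x. ennreal C * indicator {s..t} x \<partial>lborel)"
    using f by (intro nn_integral_mono) (auto simp: indicator_def intro!: ennreal_leI)
  also have "\<dots> = ennreal (C * (t - s))"
    using st C by (simp add: nn_integral_cmult ennreal_mult)
  finally show ?thesis using C st by (simp add: emeasure_eq_measure)
qed

lemma T_probability_ge:
  assumes f: "\<And>x. x \<in> {a..b} \<Longrightarrow> c \<le> f\<^sub>T x" and c: "0 \<le> c" and st: "a \<le> s" "s \<le> t" "t \<le> b"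
  shows "c * (t - s) \<le> prob (T i j -` {s..t} \<inter> space M)"
proof -
  have "ennreal (c * (t - s)) = (\<integral>\<^sup>+x. ennreal c * indicator {s..t} x \<partial>lborel)"
    using st c by (simp add: nn_integral_cmult ennreal_mult)
  also have "\<dots> \<le> (\<integral>\<^sup>+x. ennreal (f\<^sub>T x) * indicator {a..b} x * indicator {s..t} x \<partial>lborel)"
    using f st by (intro nn_integral_mono) (auto simp: indicator_def intro!: ennreal_leI)
  also have "\<dots> = emeasure M (T i j -` {s..t} \<inter> space M)"
    by (rule distributed_emeasure[OF T_density, symmetric]) simp
  finally show ?thesis by (simp add: emeasure_eq_measure)
qed

end

section \<open>Moment bounds for a single curve\<close>

locale functional_data_moments = functional_data M a b S X Xs T U f\<^sub>T \<sigma> m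
  for M :: "'w measure" and a b S X Xs T U f\<^sub>T \<sigma> m +
  fixes h :: "nat \<Rightarrow> real" and \<rho> c\<^sub>T C\<^sub>T C\<^sub>\<mu> :: real
  assumes h_pos: "\<And>n. h n > 0" and h_lim: "h \<longlonglongrightarrow> 0" and \<rho>: "\<rho> > 2"
    and bandwidth: "(\<lambda>n. inverse ((h n)\<^sup>2 + h n / gamma_n m n 1) *
              (ln (real n) / real n) powr (1 - 2 / \<rho>)) \<longlonglongrightarrow> 0"
    and U_moment: "\<And>i j. integrable M (\<lambda>\<omega>. \<bar>U i j \<omega>\<bar> powr \<rho>)"
    and X_moment: "(\<integral>\<^sup>+\<omega>. (SUP t\<in>{a..b}. ennreal (\<bar>X \<omega> t\<bar> powr \<rho>)) \<partial>M) < \<infinity>"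
    and density_bounds: "\<And>x. x \<in> {a..b} \<Longrightarrow> c\<^sub>T \<le> f\<^sub>T x" "\<And>x. x \<in> {a..b} \<Longrightarrow> f\<^sub>T x \<le> C\<^sub>T" "0 < c\<^sub>T"
    and mean_continuous: "continuous_on {a..b} (mean_function M X)"
    and mean_bound: "\<And>t. t \<in> {a..b} \<Longrightarrow> \<bar>mean_function M X t\<bar> \<le> C\<^sub>\<mu>"
begin

lemma C\<^sub>T_nonneg: "0 \<le> C\<^sub>T"
  using density_bounds(1,2)[of a] density_bounds(3) interval by simp

lemma C\<^sub>\<mu>_nonneg: "0 \<le> C\<^sub>\<mu>"
  using mean_bound[of a] interval by simp

lemma T_interval_prob: "s \<le> t \<Longrightarrow> prob (T i j -` {s..t} \<inter> space M) \<le> C\<^sub>T * (t - s)"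
  by (rule T_probability_le[OF density_bounds(2) C\<^sub>T_nonneg])

lemma expectation_U_transfer:
  assumes [measurable]: "g \<in> borel_measurable borel"
  shows "expectation (\<lambda>\<omega>. g (U i j \<omega>)) = expectation (\<lambda>\<omega>. g (U 0 0 \<omega>) :: real)"
  using integral_distr[of "U i j" M borel g] integral_distr[of "U 0 0" M borel g] U_distr[of i j 0 0] U_measurable
  by simp

definition curve_sup :: "nat \<Rightarrow> 'w \<Rightarrow> real" where
  "curve_sup i \<omega> = enn2real (path_norm (Xs i \<omega>))"

lemma path_norm_powr:
  assumes r: "(SUP t\<in>{a..b}. ennreal (\<bar>x t\<bar> powr \<rho>)) = ennreal r" "0 \<le> r"
  shows "path_norm x \<le> ennreal (r powr (1 / \<rho>))"
  unfolding path_norm_def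
proof (rule SUP_least)
  fix t assume t: "t \<in> {a..b}"
  have "ennreal (\<bar>x t\<bar> powr \<rho>) \<le> ennreal r" unfolding r(1)[symmetric] using t by (rule SUP_upper)
  then have "\<bar>x t\<bar> powr \<rho> \<le> r" using r(2) by simp
  then have "(\<bar>x t\<bar> powr \<rho>) powr (1 / \<rho>) \<le> r powr (1 / \<rho>)" using \<rho> by (intro powr_mono2) auto
  then show "ennreal \<bar>x t\<bar> \<le> ennreal (r powr (1 / \<rho>))" using \<rho> by (simp add: powr_powr)
qed

text \<open>The law of the path determines integrals of measurable functionals, and measurability is known for the
supremum of |x t|. Its power, set to infinity where the supremum is infinite, is such a functional and lies
below the supremum of the powers.\<close>

lemma
  shows AE_path_norm_finite: "AE \<omega> in M. path_norm (Xs i \<omega>) \<noteq> \<infinity>"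
    and integrable_curve_sup_powr: "integrable M (\<lambda>\<omega>. curve_sup i \<omega> powr \<rho>)"
proof -
  note [measurable] = path_norm_measurable Xs_measurable X_measurable
  define A :: "(real \<Rightarrow> real) \<Rightarrow> ennreal" where
    "A x = (if path_norm x = \<infinity> then \<infinity> else ennreal (enn2real (path_norm x) powr \<rho>))" for x
  have A_m [measurable]: "A \<in> borel_measurable S" unfolding A_def by measurable
  have A_le: "A x \<le> (SUP t\<in>{a..b}. ennreal (\<bar>x t\<bar> powr \<rho>))" (is "_ \<le> ?R") for x
  proof (cases ?R)
    case (real r)
    then have n: "path_norm x \<le> ennreal (r powr (1 / \<rho>))" by (intro path_norm_powr) auto
    then have "path_norm x \<noteq> \<infinity>" by (auto simp: top_unique)
    moreover have "enn2real (path_norm x) powr \<rho> \<le> (r powr (1 / \<rho>)) powr \<rho>"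
      using n \<rho> by (intro powr_mono2 enn2real_leI) auto
    ultimately show ?thesis using real \<rho> by (simp add: A_def powr_powr)
  next
    case top
    show ?thesis unfolding top by (rule top_greatest)
  qed
  have "(\<integral>\<^sup>+\<omega>. A (Xs i \<omega>) \<partial>M) = (\<integral>\<^sup>+x. A x \<partial>distr M S (Xs i))" by (simp add: nn_integral_distr)
  also have "\<dots> = (\<integral>\<^sup>+\<omega>. A (X \<omega>) \<partial>M)" unfolding Xs_distr by (simp add: nn_integral_distr)
  also have "\<dots> \<le> (\<integral>\<^sup>+\<omega>. (SUP t\<in>{a..b}. ennreal (\<bar>X \<omega> t\<bar> powr \<rho>)) \<partial>M)"
    using A_le by (intro nn_integral_mono)
  also have "\<dots> < \<infinity>" by (rule X_moment)
  finally have fin: "(\<integral>\<^sup>+\<omega>. A (Xs i \<omega>) \<partial>M) < \<infinity>" .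
  then have "AE \<omega> in M. A (Xs i \<omega>) \<noteq> \<infinity>" by (intro nn_integral_PInf_AE) auto
  then show "AE \<omega> in M. path_norm (Xs i \<omega>) \<noteq> \<infinity>" by eventually_elim (auto simp: A_def)
  show "integrable M (\<lambda>\<omega>. curve_sup i \<omega> powr \<rho>)"
  proof (rule integrableI_bounded)
    show "(\<lambda>\<omega>. curve_sup i \<omega> powr \<rho>) \<in> borel_measurable M" unfolding curve_sup_def by measurable
    have "(\<integral>\<^sup>+\<omega>. ennreal (norm (curve_sup i \<omega> powr \<rho>)) \<partial>M) \<le> (\<integral>\<^sup>+\<omega>. A (Xs i \<omega>) \<partial>M)"
      by (intro nn_integral_mono) (auto simp: A_def curve_sup_def)
    with fin show "(\<integral>\<^sup>+\<omega>. ennreal (norm (curve_sup i \<omega> powr \<rho>)) \<partial>M) < \<infinity>" by (rule le_less_trans[rotated])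
  qed
qed

lemma AE_curve_le_curve_sup: "AE \<omega> in M. \<forall>i. \<forall>t\<in>{a..b}. \<bar>Xs i \<omega> t\<bar> \<le> curve_sup i \<omega>"
proof -
  have "AE \<omega> in M. \<forall>i. path_norm (Xs i \<omega>) \<noteq> \<infinity>"
    using AE_path_norm_finite by (simp add: AE_all_countable)
  then show ?thesis
  proof eventually_elim
    fix \<omega> assume *: "\<forall>i. path_norm (Xs i \<omega>) \<noteq> \<infinity>"
    show "\<forall>i. \<forall>t\<in>{a..b}. \<bar>Xs i \<omega> t\<bar> \<le> curve_sup i \<omega>"
    proof (intro allI ballI)
      fix i t assume t: "t \<in> {a..b}"
      have "ennreal \<bar>Xs i \<omega> t\<bar> \<le> path_norm (Xs i \<omega>)" unfolding path_norm_def using t by (rule SUP_upper)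
      also have "\<dots> = ennreal (curve_sup i \<omega>)" unfolding curve_sup_def using * by (simp add: less_top)
      finally show "\<bar>Xs i \<omega> t\<bar> \<le> curve_sup i \<omega>" by (simp add: curve_sup_def)
    qed
  qed
qed

text \<open>Dominates |X_i(t) - \<mu>(t)| for all t almost surely. The summand 1 makes it an envelope of the
constant mark 1 as well.\<close>

definition curve_env :: "nat \<Rightarrow> 'w \<Rightarrow> real" where
  "curve_env i \<omega> = 1 + C\<^sub>\<mu> + curve_sup i \<omega>"

lemma curve_env_ge_1: "1 \<le> curve_env i \<omega>"
  using C\<^sub>\<mu>_nonneg by (simp add: curve_env_def curve_sup_def)

lemma curve_env_source: "Curve i \<in> J \<Longrightarrow> curve_env i \<in> borel_measurable (source_sigma J)"
proof -
  assume "Curve i \<in> J"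
  note [measurable] = Xs_source[OF this] path_norm_measurable
  show ?thesis unfolding curve_env_def[abs_def] curve_sup_def by measurable
qed

lemma curve_env_measurable [measurable]: "curve_env i \<in> borel_measurable M"
  by (rule source_measurable_imp_measurable[OF curve_env_source[of i UNIV]]) simp

lemma curve_env_distr: "distr M borel (curve_env i) = distr M borel (curve_env 0)"
proof -
  note [measurable] = path_norm_measurable Xs_measurable
  define g where "g x = 1 + C\<^sub>\<mu> + enn2real (path_norm x)" for x
  have g [measurable]: "g \<in> borel_measurable S" unfolding g_def by measurable
  have "distr M borel (curve_env i) = distr (distr M S (Xs i)) borel g" for i
    by (subst distr_distr) (auto simp: comp_def g_def curve_env_def[abs_def] curve_sup_def)
  then show ?thesis by (simp add: Xs_distr)
qed

lemma curve_env_transfer: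
  assumes [measurable]: "g \<in> borel_measurable borel"
  shows "expectation (\<lambda>\<omega>. g (curve_env i \<omega>)) = expectation (\<lambda>\<omega>. g (curve_env 0 \<omega>) :: real)"
  using integral_distr[of "curve_env i" M borel g] integral_distr[of "curve_env 0" M borel g] curve_env_distr[of i]
  by simp

lemma integrable_curve_env_powr: "integrable M (\<lambda>\<omega>. curve_env i \<omega> powr \<rho>)"
proof (rule Bochner_Integration.integrable_bound)
  show "integrable M (\<lambda>\<omega>. 2 powr \<rho> * ((1 + C\<^sub>\<mu>) powr \<rho> + curve_sup i \<omega> powr \<rho>))"
    using integrable_curve_sup_powr by auto
  have "0 \<le> curve_sup i \<omega>" for \<omega> by (simp add: curve_sup_def)
  then show "AE \<omega> in M. norm (curve_env i \<omega> powr \<rho>) \<le> norm (2 powr \<rho> * ((1 + C\<^sub>\<mu>) powr \<rho> + curve_sup i \<omega> powr \<rho>))"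
    unfolding curve_env_def using C\<^sub>\<mu>_nonneg \<rho> powr_add_le[of "1 + C\<^sub>\<mu>" "curve_sup i _" \<rho>] by (intro AE_I2) auto
qed measurable

lemma integrable_square_of_powr:
  assumes "f \<in> borel_measurable M" "\<And>\<omega>. 0 \<le> f \<omega>" "integrable M (\<lambda>\<omega>. f \<omega> powr \<rho>)"
  shows "integrable M (\<lambda>\<omega>. (f \<omega>)\<^sup>2)"
proof (rule Bochner_Integration.integrable_bound)
  show "integrable M (\<lambda>\<omega>. 1 + f \<omega> powr \<rho>)" using assms by auto
  show "AE \<omega> in M. norm ((f \<omega>)\<^sup>2) \<le> norm (1 + f \<omega> powr \<rho>)"
    using square_le_one_plus_powr[of "f _" \<rho>] assms(2) \<rho> by (intro AE_I2) auto
qed (use assms in measurable)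

definition env :: "nat \<Rightarrow> nat \<Rightarrow> 'w \<Rightarrow> real" where
  "env i j \<omega> = curve_env i \<omega> + \<bar>U i j \<omega>\<bar>"

lemma env_measurable [measurable]: "env i j \<in> borel_measurable M"
  unfolding env_def[abs_def] using U_measurable by measurable

lemma env_nonneg: "0 \<le> env i j \<omega>"
  using curve_env_ge_1[of i \<omega>] by (simp add: env_def)

definition env_const :: real where
  "env_const = 2 * expectation (\<lambda>\<omega>. (curve_env 0 \<omega>)\<^sup>2) + 2 * \<sigma>\<^sup>2"

lemma env_square: "integrable M (\<lambda>\<omega>. (env i j \<omega>)\<^sup>2)" "expectation (\<lambda>\<omega>. (env i j \<omega>)\<^sup>2) \<le> env_const"
proof -
  have c2: "integrable M (\<lambda>\<omega>. (curve_env i \<omega>)\<^sup>2)"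
    using curve_env_ge_1[of i] integrable_curve_env_powr[of i]
    by (intro integrable_square_of_powr) (auto intro: order.trans[of 0 1])
  have le: "(env i j \<omega>)\<^sup>2 \<le> 2 * (curve_env i \<omega>)\<^sup>2 + 2 * (U i j \<omega>)\<^sup>2" for \<omega>
    using zero_le_power2[of "curve_env i \<omega> - \<bar>U i j \<omega>\<bar>"]
    by (simp add: env_def power2_eq_square algebra_simps)
  show i: "integrable M (\<lambda>\<omega>. (env i j \<omega>)\<^sup>2)"
    by (rule Bochner_Integration.integrable_bound[of _ "\<lambda>\<omega>. 2 * (curve_env i \<omega>)\<^sup>2 + 2 * (U i j \<omega>)\<^sup>2"])
      (use c2 U_square_integrable le in auto)
  have "expectation (\<lambda>\<omega>. (env i j \<omega>)\<^sup>2) \<le> expectation (\<lambda>\<omega>. 2 * (curve_env i \<omega>)\<^sup>2 + 2 * (U i j \<omega>)\<^sup>2)"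
    using i c2 U_square_integrable le by (intro integral_mono) auto
  also have "\<dots> = env_const"
    using c2 U_square_integrable[of i j] curve_env_transfer[of "\<lambda>x. x\<^sup>2" i] U_variance[of i j] U_mean[of i j]
    by (simp add: env_const_def)
  finally show "expectation (\<lambda>\<omega>. (env i j \<omega>)\<^sup>2) \<le> env_const" .
qed

lemma env_integrable: "integrable M (env i j)" "expectation (env i j) \<le> 1 + env_const"
proof -
  show i: "integrable M (env i j)"
    by (rule square_integrable_imp_integrable[OF env_measurable env_square(1)])
  have "expectation (env i j) \<le> expectation (\<lambda>\<omega>. 1 + (env i j \<omega>)\<^sup>2)"
    using i env_square(1) le_one_plus_square by (intro integral_mono) auto
  also have "\<dots> \<le> 1 + env_const" using env_square[of i j] by (simp add: prob_space)
  finally show "expectation (env i j) \<le> 1 + env_const" .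
qed

lemma env_product: "integrable M (\<lambda>\<omega>. env i j \<omega> * env i k \<omega>)"
  "expectation (\<lambda>\<omega>. env i j \<omega> * env i k \<omega>) \<le> env_const"
proof -
  have le: "env i j \<omega> * env i k \<omega> \<le> (env i j \<omega>)\<^sup>2 / 2 + (env i k \<omega>)\<^sup>2 / 2" for \<omega>
    using zero_le_power2[of "env i j \<omega> - env i k \<omega>"] by (simp add: power2_eq_square algebra_simps)
  show i: "integrable M (\<lambda>\<omega>. env i j \<omega> * env i k \<omega>)"
    by (rule Bochner_Integration.integrable_bound[of _ "\<lambda>\<omega>. (env i j \<omega>)\<^sup>2 / 2 + (env i k \<omega>)\<^sup>2 / 2"])
      (use env_square le env_nonneg in auto)
  have "expectation (\<lambda>\<omega>. env i j \<omega> * env i k \<omega>) \<le> expectation (\<lambda>\<omega>. (env i j \<omega>)\<^sup>2 / 2 + (env i k \<omega>)\<^sup>2 / 2)"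
    using i env_square le by (intro integral_mono) auto
  also have "\<dots> \<le> env_const" using env_square[of i j] env_square[of i k] by simp
  finally show "expectation (\<lambda>\<omega>. env i j \<omega> * env i k \<omega>) \<le> env_const" .
qed

lemma env_const_nonneg: "0 \<le> env_const"
  by (simp add: env_const_def)

definition half_moment :: real where
  "half_moment = expectation (\<lambda>\<omega>. \<bar>U 0 0 \<omega>\<bar> powr (\<rho> / 2))"

text \<open>The majorant of averages_square_le_dyadic_deviations for |u|^(\<rho>/2). The sum is taken in the extended
nonnegative reals because it converges only almost surely, while measurability is needed everywhere.\<close>

definition dyadic_max :: "(nat \<Rightarrow> real) \<Rightarrow> real" where
  "dyadic_max u = 8 * half_moment\<^sup>2 +
     8 * enn2real (\<Sum>k. ennreal (((\<Sum>j<2 ^ k. \<bar>u j\<bar> powr (\<rho> / 2) - half_moment) / 2 ^ k)\<^sup>2))"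

definition error_max :: "nat \<Rightarrow> 'w \<Rightarrow> real" where
  "error_max i \<omega> = dyadic_max (\<lambda>j. U i j \<omega>)"

lemma dyadic_max_measurable [measurable]: "dyadic_max \<in> borel_measurable (\<Pi>\<^sub>M j\<in>UNIV. borel)"
  unfolding dyadic_max_def[abs_def] by measurable

lemma U_row_measurable: "(\<lambda>\<omega> j. U i j \<omega>) \<in> measurable (source_sigma (row i)) (\<Pi>\<^sub>M j\<in>UNIV. borel)"
  by (rule measurable_PiM_single') (auto simp: row_def intro!: U_source)

lemma error_max_source: "error_max i \<in> borel_measurable (source_sigma (row i))"
  unfolding error_max_def[abs_def] by (rule measurable_compose[OF U_row_measurable]) simp

text \<open>All rows of errors have the same joint law, namely the infinite product of the common error law.\<close>

lemma error_max_distr: "distr M borel (error_max i) = distr M borel (error_max 0)"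
proof -
  have "distr M borel (error_max i)
      = distr (\<Pi>\<^sub>M j\<in>UNIV. distr M borel (U 0 0)) borel dyadic_max" for i
  proof -
    have indep: "indep_vars (\<lambda>_. borel) (U i) UNIV"
      by (rule indep_source_functions[where J = "\<lambda>j. {Error i j}"])
        (auto simp: disjoint_family_on_def intro: U_source)
    have "distr M (\<Pi>\<^sub>M j\<in>UNIV. borel) (\<lambda>\<omega> j. U i j \<omega>) = (\<Pi>\<^sub>M j\<in>UNIV. distr M borel (U i j))"
      using indep indep_vars_iff_distr_eq_PiM[where I = UNIV and M' = "\<lambda>_. borel" and X = "U i"] U_measurable
      by (simp add: restrict_UNIV)
    also have "\<dots> = (\<Pi>\<^sub>M j\<in>UNIV. distr M borel (U 0 0))" by (intro PiM_cong refl U_distr)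
    finally have "distr (distr M (\<Pi>\<^sub>M j\<in>UNIV. borel) (\<lambda>\<omega> j. U i j \<omega>)) borel dyadic_max
        = distr (\<Pi>\<^sub>M j\<in>UNIV. distr M borel (U 0 0)) borel dyadic_max" by simp
    then show ?thesis
      using source_measurable_imp_measurable[OF U_row_measurable[of i]]
      by (subst (asm) distr_distr) (auto simp: comp_def error_max_def[abs_def])
  qed
  then show ?thesis by simp
qed

lemma error_half_moments:
  "integrable M (\<lambda>\<omega>. \<bar>U i j \<omega>\<bar> powr (\<rho> / 2))"
  "integrable M (\<lambda>\<omega>. (\<bar>U i j \<omega>\<bar> powr (\<rho> / 2))\<^sup>2)"
  "expectation (\<lambda>\<omega>. \<bar>U i j \<omega>\<bar> powr (\<rho> / 2)) = half_moment"
  "expectation (\<lambda>\<omega>. (\<bar>U i j \<omega>\<bar> powr (\<rho> / 2))\<^sup>2) = expectation (\<lambda>\<omega>. (\<bar>U 0 0 \<omega>\<bar> powr (\<rho> / 2))\<^sup>2)"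
proof -
  note [measurable] = U_measurable
  have sq: "(\<bar>u\<bar> powr (\<rho> / 2))\<^sup>2 = \<bar>u\<bar> powr \<rho>" for u :: real
    by (simp add: power2_eq_square flip: powr_add)
  show 2: "integrable M (\<lambda>\<omega>. (\<bar>U i j \<omega>\<bar> powr (\<rho> / 2))\<^sup>2)" unfolding sq by (rule U_moment)
  show "integrable M (\<lambda>\<omega>. \<bar>U i j \<omega>\<bar> powr (\<rho> / 2))"
    by (rule square_integrable_imp_integrable[OF _ 2]) measurable
  show "expectation (\<lambda>\<omega>. \<bar>U i j \<omega>\<bar> powr (\<rho> / 2)) = half_moment"
    unfolding half_moment_def by (rule expectation_U_transfer) measurable
  show "expectation (\<lambda>\<omega>. (\<bar>U i j \<omega>\<bar> powr (\<rho> / 2))\<^sup>2) = expectation (\<lambda>\<omega>. (\<bar>U 0 0 \<omega>\<bar> powr (\<rho> / 2))\<^sup>2)"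
    by (rule expectation_U_transfer) measurable
qed

text \<open>The maximal inequality for error averages. By convexity the \<rho>/2-th power of an average of |U_ij| is at
most the average of |U_ij|^(\<rho>/2), whose square is controlled for all block lengths by second moments.\<close>

lemma
  shows AE_error_mean_le_error_max:
      "AE \<omega> in M. \<forall>k\<ge>1. ((1 / real k) * (\<Sum>j<k. \<bar>U i j \<omega>\<bar>)) powr \<rho> \<le> error_max i \<omega>"
    and integrable_error_max: "integrable M (error_max i)"
proof -
  note [measurable] = U_measurable
  have indep: "indep_vars (\<lambda>_. borel) (\<lambda>j \<omega>. \<bar>U i j \<omega>\<bar> powr (\<rho> / 2)) UNIV"
  proof (rule indep_source_functions[where J = "\<lambda>j. {Error i j}"])
    fix j
    have [measurable]: "U i j \<in> borel_measurable (source_sigma {Error i j})" by (rule U_source) simp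
    show "(\<lambda>\<omega>. \<bar>U i j \<omega>\<bar> powr (\<rho> / 2)) \<in> borel_measurable (source_sigma {Error i j})" by measurable
  qed (auto simp: disjoint_family_on_def)
  let ?f = "\<lambda>\<omega> k. ((\<Sum>j<2 ^ k. \<bar>U i j \<omega>\<bar> powr (\<rho> / 2) - half_moment) / 2 ^ k)\<^sup>2"
  note dev = indep error_half_moments(1,2,3) order.eq_iff[THEN iffD1, THEN conjunct1, OF error_half_moments(4)]
  have sm: "AE \<omega> in M. summable (?f \<omega>)"
    by (rule AE_summable_dyadic_deviations[OF dev])
  then show "AE \<omega> in M. \<forall>k\<ge>1. ((1 / real k) * (\<Sum>j<k. \<bar>U i j \<omega>\<bar>)) powr \<rho> \<le> error_max i \<omega>"
  proof eventually_elim
    fix \<omega> assume sm: "summable (?f \<omega>)"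
    show "\<forall>k\<ge>1. ((1 / real k) * (\<Sum>j<k. \<bar>U i j \<omega>\<bar>)) powr \<rho> \<le> error_max i \<omega>"
    proof (intro allI impI)
      fix k :: nat assume k: "k \<ge> 1"
      have "((1 / real k) * (\<Sum>j<k. \<bar>U i j \<omega>\<bar>)) powr \<rho> = (((1 / real k) * (\<Sum>j<k. \<bar>U i j \<omega>\<bar>)) powr (\<rho> / 2))\<^sup>2"
        by (simp add: power2_eq_square flip: powr_add)
      also have "\<dots> \<le> ((1 / real k) * (\<Sum>j<k. \<bar>U i j \<omega>\<bar> powr (\<rho> / 2)))\<^sup>2"
        using \<rho> k by (intro power_mono power_mean_inequality) auto
      also have "\<dots> \<le> 8 * half_moment\<^sup>2 + 8 * (\<Sum>k. ?f \<omega> k)"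
        using k sm by (intro averages_square_le_dyadic_deviations) auto
      also have "\<dots> = error_max i \<omega>"
        unfolding error_max_def dyadic_max_def using sm by (simp add: suminf_ennreal2 suminf_nonneg)
      finally show "((1 / real k) * (\<Sum>j<k. \<bar>U i j \<omega>\<bar>)) powr \<rho> \<le> error_max i \<omega>" .
    qed
  qed
  have fin: "(\<integral>\<^sup>+\<omega>. (\<Sum>k. ennreal (?f \<omega> k)) \<partial>M) < \<infinity>"
    by (rule dyadic_deviations_integral_finite[OF dev])
  have "integrable M (\<lambda>\<omega>. enn2real (\<Sum>k. ennreal (?f \<omega> k)))"
  proof (rule integrableI_bounded)
    have "(\<integral>\<^sup>+\<omega>. ennreal (norm (enn2real (\<Sum>k. ennreal (?f \<omega> k)))) \<partial>M) \<le> (\<integral>\<^sup>+\<omega>. (\<Sum>k. ennreal (?f \<omega> k)) \<partial>M)"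
      by (intro nn_integral_mono) (simp add: ennreal_enn2real_if)
    then show "(\<integral>\<^sup>+\<omega>. ennreal (norm (enn2real (\<Sum>k. ennreal (?f \<omega> k)))) \<partial>M) < \<infinity>"
      using fin by (rule le_less_trans)
  qed measurable
  then show "integrable M (error_max i)" unfolding error_max_def[abs_def] dyadic_max_def by auto
qed

definition row_env :: "nat \<Rightarrow> 'w \<Rightarrow> real" where
  "row_env i \<omega> = 2 powr \<rho> * (curve_env i \<omega> powr \<rho> + error_max i \<omega>)"

lemma row_env_integrable: "integrable M (row_env i)"
  unfolding row_env_def[abs_def] using integrable_curve_env_powr integrable_error_max by auto

lemma row_env_expectation: "expectation (row_env i) = expectation (row_env 0)"
proof -
  have [measurable]: "error_max i \<in> borel_measurable M" for i using integrable_error_max by blast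
  have "expectation (error_max i) = integral\<^sup>L (distr M borel (error_max i)) (\<lambda>x. x)" for i
    by (subst integral_distr) auto
  then have em: "expectation (error_max i) = expectation (error_max 0)"
    by (simp only: error_max_distr[of i])
  have "expectation (row_env i) = 2 powr \<rho> * (expectation (\<lambda>\<omega>. curve_env i \<omega> powr \<rho>) + expectation (error_max i))" for i
    unfolding row_env_def[abs_def]
    by (simp only: integral_mult_right_zero
        Bochner_Integration.integral_add[OF integrable_curve_env_powr integrable_error_max])
  moreover have "expectation (\<lambda>\<omega>. curve_env i \<omega> powr \<rho>) = expectation (\<lambda>\<omega>. curve_env 0 \<omega> powr \<rho>)"
    by (rule curve_env_transfer) measurable
  ultimately show ?thesis using em by simp
qed

lemma row_env_lln: "AE \<omega> in M. \<exists>C. \<forall>n. (\<Sum>i<n. row_env i \<omega>) \<le> C * real n"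
proof -
  have 1: "AE \<omega> in M. \<exists>C. \<forall>n. (\<Sum>i<n. curve_env i \<omega> powr \<rho>) \<le> C * real n"
  proof (rule iid_partial_sums_linear)
    show "indep_vars (\<lambda>_. borel) (\<lambda>i \<omega>. curve_env i \<omega> powr \<rho>) UNIV"
    proof (rule indep_source_functions[OF disjoint_rows])
      fix i
      have [measurable]: "curve_env i \<in> borel_measurable (source_sigma (row i))"
        by (rule curve_env_source) (simp add: row_def)
      show "(\<lambda>\<omega>. curve_env i \<omega> powr \<rho>) \<in> borel_measurable (source_sigma (row i))" by measurable
    qed
    show "distr M borel (\<lambda>\<omega>. curve_env i \<omega> powr \<rho>) = distr M borel (\<lambda>\<omega>. curve_env 0 \<omega> powr \<rho>)" for i
    proof -
      have "distr M borel (\<lambda>\<omega>. curve_env i \<omega> powr \<rho>) = distr (distr M borel (curve_env i)) borel (\<lambda>x. x powr \<rho>)" for i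
        by (subst distr_distr) (auto simp: comp_def)
      then show ?thesis by (simp only: curve_env_distr[of i])
    qed
  qed (auto intro: integrable_curve_env_powr)
  have 2: "AE \<omega> in M. \<exists>C. \<forall>n. (\<Sum>i<n. error_max i \<omega>) \<le> C * real n"
  proof (rule iid_partial_sums_linear)
    show "indep_vars (\<lambda>_. borel) error_max UNIV"
      by (rule indep_source_functions[OF disjoint_rows error_max_source])
    show "0 \<le> error_max i \<omega>" for i \<omega> by (simp add: error_max_def dyadic_max_def)
  qed (rule integrable_error_max error_max_distr)+
  from 1 2 show ?thesis
  proof eventually_elim
    fix \<omega> assume "\<exists>C. \<forall>n. (\<Sum>i<n. curve_env i \<omega> powr \<rho>) \<le> C * real n"
      "\<exists>C. \<forall>n. (\<Sum>i<n. error_max i \<omega>) \<le> C * real n"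
    then obtain C1 C2 where C: "\<And>n. (\<Sum>i<n. curve_env i \<omega> powr \<rho>) \<le> C1 * real n"
      "\<And>n. (\<Sum>i<n. error_max i \<omega>) \<le> C2 * real n" by blast
    have "(\<Sum>i<n. row_env i \<omega>) \<le> (2 powr \<rho> * (C1 + C2)) * real n" for n
    proof -
      have "(\<Sum>i<n. row_env i \<omega>) = 2 powr \<rho> * ((\<Sum>i<n. curve_env i \<omega> powr \<rho>) + (\<Sum>i<n. error_max i \<omega>))"
        by (simp add: row_env_def sum_distrib_left[symmetric] sum.distrib)
      also have "\<dots> \<le> 2 powr \<rho> * (C1 * real n + C2 * real n)"
        using C[of n] by (intro mult_left_mono add_mono) auto
      finally show ?thesis by (simp add: algebra_simps)
    qed
    then show "\<exists>C. \<forall>n. (\<Sum>i<n. row_env i \<omega>) \<le> C * real n" by blast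
  qed
qed

section \<open>Window sums of design points and noise\<close>

definition window_sum :: "(nat \<Rightarrow> nat \<Rightarrow> 'w \<Rightarrow> real) \<Rightarrow> nat \<Rightarrow> nat \<Rightarrow> real \<Rightarrow> real \<Rightarrow> 'w \<Rightarrow> real" where
  "window_sum Z n i s t \<omega> = (1 / real (m n i)) * (\<Sum>j<m n i. Z i j \<omega> * indicator {s..t} (T i j \<omega>))"

abbreviation mean_deviation :: "(nat \<Rightarrow> nat \<Rightarrow> 'w \<Rightarrow> real) \<Rightarrow> nat \<Rightarrow> real \<Rightarrow> real \<Rightarrow> 'w \<Rightarrow> real" where
  "mean_deviation Z n s t \<omega> \<equiv>
     (1 / real n) * (\<Sum>i<n. window_sum Z n i s t \<omega> - expectation (window_sum Z n i s t))"

definition window_const :: real where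
  "window_const = (1 + env_const) * C\<^sub>T + env_const * (C\<^sub>T + C\<^sub>T\<^sup>2) + \<bar>expectation (row_env 0)\<bar>"

lemma indicator_T_source:
  "Time i j \<in> J \<Longrightarrow> (\<lambda>\<omega>. indicator {s..t} (T i j \<omega>) :: real) \<in> borel_measurable (source_sigma J)"
  using T_source[of i j J] by measurable

lemma env_source:
  assumes "Curve i \<in> J" "Error i j \<in> J"
  shows "env i j \<in> borel_measurable (source_sigma J)"
proof -
  note [measurable] = curve_env_source[OF assms(1)] U_source[OF assms(2)]
  show ?thesis unfolding env_def[abs_def] by measurable
qed

lemma expectation_indicator_T:
  "expectation (\<lambda>\<omega>. indicator {s..t} (T i j \<omega>)) = prob (T i j -` {s..t} \<inter> space M)"
  "integrable M (\<lambda>\<omega>. indicator {s..t} (T i j \<omega>) :: real)"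
proof -
  note [measurable] = T_measurable[of i j]
  have "expectation (\<lambda>\<omega>. indicator {s..t} (T i j \<omega>)) = expectation (indicator (T i j -` {s..t} \<inter> space M))"
    by (intro Bochner_Integration.integral_cong) (auto simp: indicator_def)
  also have "\<dots> = prob (T i j -` {s..t} \<inter> space M)" by simp
  finally show "expectation (\<lambda>\<omega>. indicator {s..t} (T i j \<omega>)) = prob (T i j -` {s..t} \<inter> space M)" .
  show "integrable M (\<lambda>\<omega>. indicator {s..t} (T i j \<omega>) :: real)"
    by (intro integrable_const_bound[of _ 1]) auto
qed

lemma env_window:
  assumes "s \<le> t"
  shows "integrable M (\<lambda>\<omega>. env i j \<omega> * indicator {s..t} (T i j \<omega>))"
    "expectation (\<lambda>\<omega>. env i j \<omega> * indicator {s..t} (T i j \<omega>)) \<le> (1 + env_const) * (C\<^sub>T * (t - s))"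
proof -
  have iv: "indep_var borel (env i j) borel (\<lambda>\<omega>. indicator {s..t} (T i j \<omega>) :: real)"
    by (rule source_indep_var[of "{Curve i, Error i j}" "{Time i j}"]) (auto intro: env_source indicator_T_source)
  show "integrable M (\<lambda>\<omega>. env i j \<omega> * indicator {s..t} (T i j \<omega>))"
    by (rule indep_var_integrable[OF iv env_integrable(1) expectation_indicator_T(2)])
  have "expectation (\<lambda>\<omega>. env i j \<omega> * indicator {s..t} (T i j \<omega>))
      = expectation (env i j) * prob (T i j -` {s..t} \<inter> space M)"
    unfolding indep_var_lebesgue_integral[OF iv env_integrable(1) expectation_indicator_T(2)] expectation_indicator_T(1) ..
  also have "\<dots> \<le> (1 + env_const) * (C\<^sub>T * (t - s))"
    using env_integrable(2) T_interval_prob[OF assms] env_const_nonneg by (intro mult_mono) auto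
  finally show "expectation (\<lambda>\<omega>. env i j \<omega> * indicator {s..t} (T i j \<omega>)) \<le> (1 + env_const) * (C\<^sub>T * (t - s))" .
qed

text \<open>The marks and the observation times are independent, and two distinct times are independent of each other.
So a pair of distinct points contributes the square of the length of the window, a single point only the length.\<close>

lemma env_window_product:
  assumes st: "s \<le> t"
  shows "integrable M (\<lambda>\<omega>. (env i j \<omega> * env i k \<omega>) * (indicator {s..t} (T i j \<omega>) * indicator {s..t} (T i k \<omega>)))"
      (is "integrable M ?f")
    and "expectation (\<lambda>\<omega>. (env i j \<omega> * env i k \<omega>) * (indicator {s..t} (T i j \<omega>) * indicator {s..t} (T i k \<omega>)))
      \<le> env_const * ((if j = k then C\<^sub>T * (t - s) else 0) + (C\<^sub>T * (t - s))\<^sup>2)"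
proof -
  let ?V = "\<lambda>\<omega>. env i j \<omega> * env i k \<omega>"
  let ?I = "\<lambda>\<omega>. indicator {s..t} (T i j \<omega>) * indicator {s..t} (T i k \<omega>) :: real"
  let ?J1 = "{Curve i, Error i j, Error i k}" let ?J2 = "{Time i j, Time i k}"
  note [measurable] = T_measurable
  have iv: "indep_var borel ?V borel ?I"
    by (rule source_indep_var[of ?J1 ?J2])
      (auto intro!: borel_measurable_times env_source indicator_T_source)
  have iI: "integrable M ?I" by (intro integrable_const_bound[of _ 1]) (auto simp: indicator_def)
  show "integrable M ?f"
    by (rule indep_var_integrable[OF iv env_product(1) iI])
  have EI: "expectation ?I \<le> (if j = k then C\<^sub>T * (t - s) else 0) + (C\<^sub>T * (t - s))\<^sup>2"
  proof (cases "j = k")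
    case True
    have "expectation ?I = expectation (\<lambda>\<omega>. indicator {s..t} (T i j \<omega>))"
      using True by (intro Bochner_Integration.integral_cong) (auto simp: indicator_def)
    also have "\<dots> \<le> C\<^sub>T * (t - s)" unfolding expectation_indicator_T by (rule T_interval_prob[OF st])
    finally show ?thesis using True by (simp add: add_increasing2)
  next
    case False
    have iv': "indep_var borel (\<lambda>\<omega>. indicator {s..t} (T i j \<omega>) :: real) borel (\<lambda>\<omega>. indicator {s..t} (T i k \<omega>) :: real)"
      using False by (intro source_indep_var[of "{Time i j}" "{Time i k}"] indicator_T_source) auto
    have "expectation ?I = prob (T i j -` {s..t} \<inter> space M) * prob (T i k -` {s..t} \<inter> space M)"
      unfolding indep_var_lebesgue_integral[OF iv' expectation_indicator_T(2) expectation_indicator_T(2)] expectation_indicator_T(1) ..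
    also have "\<dots> \<le> (C\<^sub>T * (t - s)) * (C\<^sub>T * (t - s))"
      using T_interval_prob[OF st] C\<^sub>T_nonneg st by (intro mult_mono) auto
    finally show ?thesis using False by (simp add: power2_eq_square)
  qed
  have "expectation ?f = expectation ?V * expectation ?I"
    by (rule indep_var_lebesgue_integral[OF iv env_product(1) iI])
  also have "\<dots> \<le> env_const * ((if j = k then C\<^sub>T * (t - s) else 0) + (C\<^sub>T * (t - s))\<^sup>2)"
    using EI env_product(2) env_const_nonneg by (intro mult_mono) (auto intro!: integral_nonneg_AE simp: indicator_def)
  finally show "expectation ?f \<le> env_const * ((if j = k then C\<^sub>T * (t - s) else 0) + (C\<^sub>T * (t - s))\<^sup>2)" .
qed

text \<open>Applies to the marks 1 and to the positive and negative parts of the noise alike: all that is needed is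
that the marks of a curve depend on the sources of that curve and lie below its envelope.\<close>

lemma interval_array_window_sum:
  assumes Z_m: "\<And>i j. Z i j \<in> borel_measurable (source_sigma (row i))" and Z0: "\<And>i j \<omega>. 0 \<le> Z i j \<omega>"
    and Z_le: "AE \<omega> in M. \<forall>i j. Z i j \<omega> \<le> env i j \<omega>"
  shows "interval_array M (window_sum Z) m h row_env a b window_const \<rho>"
proof -
  let ?D = "window_sum Z"
  have D_src: "?D n i s t \<in> borel_measurable (source_sigma (row i))" for n i s t
  proof -
    note [measurable] = Z_m
    have [measurable]: "T i j \<in> borel_measurable (source_sigma (row i))" for j
      by (rule T_source) (simp add: row_def)
    show ?thesis unfolding window_sum_def[abs_def] by measurable
  qed
  note D_m [measurable] = source_measurable_imp_measurable[OF D_src]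
  have D0: "0 \<le> ?D n i s t \<omega>" for n i s t \<omega>
    unfolding window_sum_def using Z0 by (intro mult_nonneg_nonneg sum_nonneg) auto
  let ?E = "\<lambda>n i s t \<omega>. (1 / real (m n i)) * (\<Sum>j<m n i. env i j \<omega> * indicator {s..t} (T i j \<omega>))"
  have D_le: "AE \<omega> in M. ?D n i s t \<omega> \<le> ?E n i s t \<omega>" for n i s t
    using Z_le by eventually_elim (auto simp: window_sum_def intro!: mult_left_mono mult_right_mono sum_mono divide_right_mono)
  have sqE: "(?E n i s t \<omega>)\<^sup>2 = (1 / real (m n i))\<^sup>2 * (\<Sum>j<m n i. \<Sum>k<m n i.
      (env i j \<omega> * env i k \<omega>) * (indicator {s..t} (T i j \<omega>) * indicator {s..t} (T i k \<omega>)))" for n i s t \<omega>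
    unfolding power_mult_distrib power2_eq_square[of "sum _ _"] sum_product by (simp add: mult_ac)
  have D2_le: "AE \<omega> in M. (?D n i s t \<omega>)\<^sup>2 \<le> (?E n i s t \<omega>)\<^sup>2" for n i s t
    using D_le[of n i s t] by eventually_elim (intro power_mono D0)
  have D_empty: "?D n i s t \<omega> = 0" if "t < s" for n i s t \<omega> using that by (simp add: window_sum_def)
  have E2_int: "integrable M (\<lambda>\<omega>. (?E n i s t \<omega>)\<^sup>2)" if "s \<le> t" for n i s t
    unfolding sqE using env_window_product(1)[OF that] by (intro integrable_mult_right Bochner_Integration.integrable_sum)
  have D2_int: "integrable M (\<lambda>\<omega>. (?D n i s t \<omega>)\<^sup>2)" for n i s t
  proof (cases "s \<le> t")
    case True
    show ?thesis
      by (rule Bochner_Integration.integrable_bound[OF E2_int[OF True]])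
        (use D2_le[of n i s t] in \<open>auto elim: eventually_mono\<close>)
  qed (simp add: D_empty)
  have D_int: "integrable M (?D n i s t)" for n i s t
    by (rule square_integrable_imp_integrable[OF D_m D2_int])
  have mult_T: "0 \<le> C\<^sub>T * x" if "0 \<le> x" for x using that C\<^sub>T_nonneg by simp
  show ?thesis
  proof
    show "a < b" by (rule interval)
    show "0 \<le> window_const"
      unfolding window_const_def using env_const_nonneg C\<^sub>T_nonneg by auto
    show "2 < \<rho>" by (rule \<rho>)
    show "indep_vars (\<lambda>_. borel) (\<lambda>i. ?D n i s t) {..<n}" for n s t
      by (rule indep_source_functions[OF disjoint_rows D_src])
    show "0 \<le> ?D n i s t \<omega>" for n i s t \<omega> by (rule D0)
    show "?D n i s t \<omega> \<le> ?D n i s' t' \<omega>" if "s' \<le> s" "t \<le> t'" for n i s t s' t' \<omega>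
      unfolding window_sum_def using that Z0
      by (intro mult_left_mono sum_mono) (auto simp: indicator_def)
    show "?D n i s' t' \<omega> \<le> ?D n i s' s \<omega> + ?D n i s t \<omega> + ?D n i t t' \<omega>"
      if "s' \<le> s" "s \<le> t" "t \<le> t'" for n i s t s' t' \<omega>
      unfolding window_sum_def distrib_left[symmetric] sum.distrib[symmetric] using that Z0
      by (intro mult_left_mono sum_mono) (auto simp: indicator_def)
    show "integrable M (?D n i s t)" for n i s t by (rule D_int)
    show "integrable M (\<lambda>\<omega>. (?D n i s t \<omega>)\<^sup>2)" for n i s t by (rule D2_int)
    show "expectation (?D n i s t) \<le> window_const * (t - s)" if i: "i < n" and st: "s \<le> t" for n i s t
    proof -
      have mp: "real (m n i) > 0" using m_ge_2[OF i] by simp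
      have "expectation (?D n i s t) \<le> expectation (?E n i s t)"
        using D_int D_le env_window(1)[OF st]
        by (intro integral_mono_AE integrable_mult_right Bochner_Integration.integrable_sum) auto
      also have "\<dots> = (1 / real (m n i)) * (\<Sum>j<m n i. expectation (\<lambda>\<omega>. env i j \<omega> * indicator {s..t} (T i j \<omega>)))"
        unfolding integral_mult_right_zero
        by (subst Bochner_Integration.integral_sum, rule env_window(1)[OF st], rule refl)
      also have "\<dots> \<le> (1 / real (m n i)) * (\<Sum>j<m n i. (1 + env_const) * (C\<^sub>T * (t - s)))"
        using env_window(2)[OF st] by (intro mult_left_mono sum_mono) auto
      also have "\<dots> = (1 + env_const) * C\<^sub>T * (t - s)" using mp by simp
      also have "\<dots> \<le> window_const * (t - s)"
        unfolding window_const_def using st env_const_nonneg C\<^sub>T_nonneg by (intro mult_right_mono) auto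
      finally show ?thesis .
    qed
    show "expectation (\<lambda>\<omega>. (?D n i s t \<omega>)\<^sup>2) \<le> window_const * ((t - s)\<^sup>2 + (t - s) / real (m n i))"
      if i: "i < n" and st: "s \<le> t" for n i s t
    proof -
      have mp: "real (m n i) > 0" using m_ge_2[OF i] by simp
      let ?mm = "real (m n i)"
      have "expectation (\<lambda>\<omega>. (?D n i s t \<omega>)\<^sup>2) \<le> expectation (\<lambda>\<omega>. (?E n i s t \<omega>)\<^sup>2)"
        using D2_int D2_le E2_int[OF st] by (intro integral_mono_AE) auto
      also have "\<dots> = (1 / ?mm)\<^sup>2 * (\<Sum>j<m n i. \<Sum>k<m n i. expectation (\<lambda>\<omega>.
          (env i j \<omega> * env i k \<omega>) * (indicator {s..t} (T i j \<omega>) * indicator {s..t} (T i k \<omega>))))"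
        unfolding sqE using env_window_product(1)[OF st] by (simp add: Bochner_Integration.integrable_sum)
      also have "\<dots> \<le> (1 / ?mm)\<^sup>2 * (\<Sum>j<m n i. \<Sum>k<m n i.
          env_const * ((if j = k then C\<^sub>T * (t - s) else 0) + (C\<^sub>T * (t - s))\<^sup>2))"
        using env_window_product(2)[OF st] by (intro mult_left_mono sum_mono) auto
      also have "(\<Sum>j<m n i. \<Sum>k<m n i. env_const * ((if j = k then C\<^sub>T * (t - s) else 0) + (C\<^sub>T * (t - s))\<^sup>2))
          = env_const * (?mm * (C\<^sub>T * (t - s)) + ?mm * (?mm * (C\<^sub>T * (t - s))\<^sup>2))"
        unfolding sum_distrib_left[symmetric] sum.distrib by simp
      also have "(1 / ?mm)\<^sup>2 * \<dots> = env_const * (C\<^sub>T * ((t - s) / ?mm) + C\<^sub>T\<^sup>2 * (t - s)\<^sup>2)"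
        using mp by (simp add: field_simps power2_eq_square)
      also have "\<dots> \<le> env_const * ((C\<^sub>T + C\<^sub>T\<^sup>2) * ((t - s)\<^sup>2 + (t - s) / ?mm))"
      proof (rule mult_left_mono[OF _ env_const_nonneg])
        define x where "x = (t - s) / ?mm"
        have "0 \<le> C\<^sub>T * (t - s)\<^sup>2" "0 \<le> C\<^sub>T\<^sup>2 * x" using C\<^sub>T_nonneg st by (auto simp: x_def)
        then show "C\<^sub>T * ((t - s) / ?mm) + C\<^sub>T\<^sup>2 * (t - s)\<^sup>2 \<le> (C\<^sub>T + C\<^sub>T\<^sup>2) * ((t - s)\<^sup>2 + (t - s) / ?mm)"
          unfolding x_def[symmetric] by (simp add: distrib_left distrib_right)
      qed
      also have "\<dots> \<le> window_const * ((t - s)\<^sup>2 + (t - s) / ?mm)"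
        unfolding window_const_def mult.assoc[symmetric] using st env_const_nonneg C\<^sub>T_nonneg
        by (intro mult_right_mono) auto
      finally show ?thesis .
    qed
    show "AE \<omega> in M. \<forall>n i s t. i < n \<longrightarrow> ?D n i s t \<omega> powr \<rho> \<le> row_env i \<omega>"
    proof -
      have "AE \<omega> in M. \<forall>i. \<forall>k\<ge>1. ((1 / real k) * (\<Sum>j<k. \<bar>U i j \<omega>\<bar>)) powr \<rho> \<le> error_max i \<omega>"
        using AE_error_mean_le_error_max by (simp add: AE_all_countable)
      with Z_le show ?thesis
      proof eventually_elim
        fix \<omega> assume Z: "\<forall>i j. Z i j \<omega> \<le> env i j \<omega>"
          and B: "\<forall>i. \<forall>k\<ge>1. ((1 / real k) * (\<Sum>j<k. \<bar>U i j \<omega>\<bar>)) powr \<rho> \<le> error_max i \<omega>"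
        show "\<forall>n i s t. i < n \<longrightarrow> ?D n i s t \<omega> powr \<rho> \<le> row_env i \<omega>"
        proof (intro allI impI)
          fix n i s t assume i: "i < (n::nat)"
          have m1: "m n i \<ge> 1" "real (m n i) > 0" using m_ge_2[OF i] by auto
          have "?D n i s t \<omega> \<le> (1 / real (m n i)) * (\<Sum>j<m n i. env i j \<omega>)"
            unfolding window_sum_def
          proof (intro mult_left_mono sum_mono)
            fix j
            show "Z i j \<omega> * indicator {s..t} (T i j \<omega>) \<le> env i j \<omega>"
              using Z env_nonneg[of i j \<omega>] by (auto simp: indicator_def)
          qed simp
          also have "\<dots> = curve_env i \<omega> + (1 / real (m n i)) * (\<Sum>j<m n i. \<bar>U i j \<omega>\<bar>)"
            using m1 by (simp add: env_def sum.distrib field_simps)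
          finally have "?D n i s t \<omega> powr \<rho>
              \<le> (curve_env i \<omega> + (1 / real (m n i)) * (\<Sum>j<m n i. \<bar>U i j \<omega>\<bar>)) powr \<rho>"
            using D0 \<rho> by (intro powr_mono2) auto
          also have "\<dots> \<le> 2 powr \<rho> * (curve_env i \<omega> powr \<rho> + ((1 / real (m n i)) * (\<Sum>j<m n i. \<bar>U i j \<omega>\<bar>)) powr \<rho>)"
            using \<rho> curve_env_ge_1[of i \<omega>] by (intro powr_add_le mult_nonneg_nonneg sum_nonneg) auto
          also have "\<dots> \<le> row_env i \<omega>"
            unfolding row_env_def using B m1(1) by (intro mult_left_mono add_left_mono) auto
          finally show "?D n i s t \<omega> powr \<rho> \<le> row_env i \<omega>" .
        qed
      qed
    qed
    show "integrable M (row_env i)" for i by (rule row_env_integrable)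
    show "expectation (row_env i) \<le> window_const" for i
    proof -
      have "0 \<le> (1 + env_const) * C\<^sub>T + env_const * (C\<^sub>T + C\<^sub>T\<^sup>2)" using env_const_nonneg C\<^sub>T_nonneg by auto
      then show ?thesis unfolding row_env_expectation[of i] window_const_def by linarith
    qed
    show "AE \<omega> in M. \<exists>C. \<forall>n. (\<Sum>i<n. row_env i \<omega>) \<le> C * real n" by (rule row_env_lln)
    show "2 \<le> m n i" if "i < n" for n i by (rule m_ge_2[OF that])
    show "0 < h n" for n by (rule h_pos)
    show "h \<longlonglongrightarrow> 0" by (rule h_lim)
    show "(\<lambda>n. inverse ((h n)\<^sup>2 + h n / gamma_n m n 1) * (ln (real n) / real n) powr (1 - 2 / \<rho>)) \<longlonglongrightarrow> 0"
      by (rule bandwidth)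
  qed
qed

end

text \<open>Turns the loss and the window sums into weighted sums over one finite set of observations, the form in
which summation by parts applies.\<close>

lemma double_average_eq_sum_Sigma:
  "(1 / real n) * (\<Sum>i<n. (1 / real (k i)) * (\<Sum>j<k i. f i j))
    = (\<Sum>(i, j)\<in>Sigma {..<n} (\<lambda>i. {..<k i}). 1 / (real n * real (k i)) * f i j)"
proof -
  have "(1 / real n) * (\<Sum>i<n. (1 / real (k i)) * (\<Sum>j<k i. f i j))
      = (\<Sum>i<n. \<Sum>j<k i. 1 / (real n * real (k i)) * f i j)"
    unfolding sum_distrib_left by simp
  then show ?thesis by (simp add: sum.Sigma)
qed

context functional_data_moments
begin

abbreviation \<mu> :: "real \<Rightarrow> real" where "\<mu> \<equiv> mean_function M X"

definition noise :: "nat \<Rightarrow> nat \<Rightarrow> 'w \<Rightarrow> real" where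
  "noise i j \<omega> = Xs i \<omega> (T i j \<omega>) + U i j \<omega> - \<mu> (T i j \<omega>)"

lemma mean_measurable: "\<mu> \<in> borel_measurable (restrict_space borel {a..b})"
  by (rule borel_measurable_continuous_on_restrict[OF mean_continuous])

lemma curve_at_time_source:
  "(\<lambda>\<omega>. Xs i \<omega> (T i j \<omega>)) \<in> borel_measurable (source_sigma (row i))"
  "(\<lambda>\<omega>. \<mu> (T i j \<omega>)) \<in> borel_measurable (source_sigma (row i))"
proof -
  have [measurable]: "Xs i \<in> measurable (source_sigma (row i)) S" by (rule Xs_source) (simp add: row_def)
  have [measurable]: "T i j \<in> measurable (source_sigma (row i)) (restrict_space borel {a..b})"
    by (rule T_restrict_source) (simp add: row_def)
  have "(\<lambda>\<omega>. (Xs i \<omega>, T i j \<omega>)) \<in> measurable (source_sigma (row i)) (S \<Otimes>\<^sub>M restrict_space borel {a..b})"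
    by measurable
  from measurable_compose[OF this evaluation_measurable]
  show "(\<lambda>\<omega>. Xs i \<omega> (T i j \<omega>)) \<in> borel_measurable (source_sigma (row i))" by simp
  show "(\<lambda>\<omega>. \<mu> (T i j \<omega>)) \<in> borel_measurable (source_sigma (row i))"
    by (rule measurable_compose[OF _ mean_measurable]) measurable
qed

lemma noise_source: "noise i j \<in> borel_measurable (source_sigma (row i))"
proof -
  note [measurable] = curve_at_time_source
  have [measurable]: "U i j \<in> borel_measurable (source_sigma (row i))" by (rule U_source) (simp add: row_def)
  show ?thesis unfolding noise_def[abs_def] by measurable
qed

lemma AE_noise_le_env: "AE \<omega> in M. \<forall>i j. \<bar>Xs i \<omega> (T i j \<omega>) - \<mu> (T i j \<omega>)\<bar> \<le> curve_env i \<omega> \<and> \<bar>noise i j \<omega>\<bar> \<le> env i j \<omega>"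
  using AE_curve_le_curve_sup AE_space
proof eventually_elim
  fix \<omega> assume x: "\<forall>i. \<forall>t\<in>{a..b}. \<bar>Xs i \<omega> t\<bar> \<le> curve_sup i \<omega>" and sp: "\<omega> \<in> space M"
  show "\<forall>i j. \<bar>Xs i \<omega> (T i j \<omega>) - \<mu> (T i j \<omega>)\<bar> \<le> curve_env i \<omega> \<and> \<bar>noise i j \<omega>\<bar> \<le> env i j \<omega>"
  proof (intro allI)
    fix i j
    have "\<bar>Xs i \<omega> (T i j \<omega>)\<bar> \<le> curve_sup i \<omega>" "\<bar>\<mu> (T i j \<omega>)\<bar> \<le> C\<^sub>\<mu>"
      using x mean_bound T_range[OF sp] by blast+
    then show "\<bar>Xs i \<omega> (T i j \<omega>) - \<mu> (T i j \<omega>)\<bar> \<le> curve_env i \<omega> \<and> \<bar>noise i j \<omega>\<bar> \<le> env i j \<omega>"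
      unfolding noise_def env_def curve_env_def by linarith
  qed
qed

lemma curve_mean: "t \<in> {a..b} \<Longrightarrow> integrable M (\<lambda>\<omega>. Xs i \<omega> t)"
  "t \<in> {a..b} \<Longrightarrow> expectation (\<lambda>\<omega>. Xs i \<omega> t) = \<mu> t"
proof -
  assume t: "t \<in> {a..b}"
  have "(\<lambda>x. (x, t)) \<in> measurable S (S \<Otimes>\<^sub>M restrict_space borel {a..b})"
    using t by (intro measurable_Pair measurable_ident_sets refl measurable_const) (auto simp: space_restrict_space)
  from measurable_compose[OF this evaluation_measurable]
  have [measurable]: "(\<lambda>x. x t) \<in> borel_measurable S" by simp
  note [measurable] = Xs_measurable X_measurable
  have "integrable (distr M S X) (\<lambda>x. x t)"
    using X_mean_exists[OF t] by (subst integrable_distr_eq) measurable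
  then show "integrable M (\<lambda>\<omega>. Xs i \<omega> t)"
    unfolding Xs_distr[of i, symmetric] by (subst (asm) integrable_distr_eq) measurable
  have "expectation (\<lambda>\<omega>. Xs i \<omega> t) = integral\<^sup>L (distr M S (Xs i)) (\<lambda>x. x t)"
    by (subst integral_distr) measurable
  also have "\<dots> = \<mu> t" unfolding Xs_distr mean_function_def by (subst integral_distr) measurable
  finally show "expectation (\<lambda>\<omega>. Xs i \<omega> t) = \<mu> t" .
qed

text \<open>The curve and the observation time are independent, so Fubini allows integrating over the curve first at a
fixed time, where the centred curve has mean zero.\<close>

lemma centred_curve_window:
  "integrable M (\<lambda>\<omega>. (Xs i \<omega> (T i j \<omega>) - \<mu> (T i j \<omega>)) * indicator {s..t} (T i j \<omega>))" (is "integrable M ?f")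
  "expectation (\<lambda>\<omega>. (Xs i \<omega> (T i j \<omega>) - \<mu> (T i j \<omega>)) * indicator {s..t} (T i j \<omega>)) = 0"
proof -
  define R where "R = restrict_space borel {a..b}"
  have XJ: "Xs i \<in> measurable (source_sigma {Curve i}) S" by (rule Xs_source) simp
  have TJ: "T i j \<in> measurable (source_sigma {Time i j}) R" unfolding R_def by (rule T_restrict_source) simp
  note [measurable] = source_measurable_imp_measurable[OF XJ] source_measurable_imp_measurable[OF TJ]
  have mu [measurable]: "\<mu> \<in> borel_measurable R" unfolding R_def by (rule mean_measurable)
  have ev [measurable]: "(\<lambda>p. fst p (snd p)) \<in> borel_measurable (S \<Otimes>\<^sub>M R)"
    using evaluation_measurable unfolding R_def by (simp add: case_prod_beta')
  have [measurable]: "(\<lambda>t. t) \<in> borel_measurable R" unfolding R_def by (rule measurable_restrict_space1) simp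
  define g where "g p = (fst p (snd p) - \<mu> (snd p)) * indicator {s..t} (snd p)" for p :: "(real \<Rightarrow> real) \<times> real"
  have [measurable]: "(\<lambda>p. indicator {s..t} (snd p) :: real) \<in> borel_measurable (S \<Otimes>\<^sub>M R)"
    by (rule measurable_compose[OF _ borel_measurable_indicator[of "{s..t}" borel]]) measurable
  have gm [measurable]: "g \<in> borel_measurable (S \<Otimes>\<^sub>M R)" unfolding g_def[abs_def] by measurable
  have "0 \<le> curve_env i \<omega>" for \<omega> using curve_env_ge_1[of i \<omega>] by linarith
  then have ce: "integrable M (curve_env i)"
    by (rule square_integrable_imp_integrable[OF curve_env_measurable
          integrable_square_of_powr[OF curve_env_measurable _ integrable_curve_env_powr]])
  have pm: "(\<lambda>\<omega>. (Xs i \<omega>, T i j \<omega>)) \<in> measurable M (S \<Otimes>\<^sub>M R)" by measurable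
  have fg: "?f = (\<lambda>\<omega>. g (Xs i \<omega>, T i j \<omega>))" by (simp add: g_def)
  show int: "integrable M ?f"
  proof (rule Bochner_Integration.integrable_bound[OF ce])
    show "?f \<in> borel_measurable M" unfolding fg by (rule measurable_compose[OF pm gm])
    show "AE \<omega> in M. norm (?f \<omega>) \<le> norm (curve_env i \<omega>)"
      using AE_noise_le_env
    proof eventually_elim
      case (elim \<omega>)
      then show ?case using curve_env_ge_1[of i \<omega>] by (auto simp: indicator_def)
    qed
  qed
  let ?PX = "distr M S (Xs i)" and ?PT = "distr M R (T i j)"
  interpret PX: prob_space ?PX by (rule prob_space_distr) measurable
  interpret PT: prob_space ?PT by (rule prob_space_distr) measurable
  interpret P: pair_sigma_finite ?PX ?PT ..
  have law: "distr M (S \<Otimes>\<^sub>M R) (\<lambda>\<omega>. (Xs i \<omega>, T i j \<omega>)) = ?PX \<Otimes>\<^sub>M ?PT"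
    by (rule source_pair_law[OF _ XJ TJ]) simp
  have ig: "integrable (?PX \<Otimes>\<^sub>M ?PT) g"
    unfolding law[symmetric] using int by (simp add: integrable_distr_eq fg)
  have "expectation ?f = integral\<^sup>L (?PX \<Otimes>\<^sub>M ?PT) g"
    unfolding law[symmetric] fg by (rule integral_distr[OF pm gm, symmetric])
  also have "\<dots> = (\<integral>y. (\<integral>x. g (x, y) \<partial>?PX) \<partial>?PT)"
    using P.integral_snd[of "\<lambda>x y. g (x, y)"] ig by simp
  also have "\<dots> = (\<integral>y. 0 \<partial>?PT)"
  proof (intro Bochner_Integration.integral_cong refl)
    fix y assume "y \<in> space ?PT"
    then have y: "y \<in> {a..b}" by (simp add: R_def space_restrict_space)
    have [measurable]: "(\<lambda>x. g (x, y)) \<in> borel_measurable S"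
      by (rule measurable_Pair2'[THEN measurable_compose, OF _ gm]) (use y in \<open>simp add: R_def space_restrict_space\<close>)
    have "(\<integral>x. g (x, y) \<partial>?PX) = expectation (\<lambda>\<omega>. g (Xs i \<omega>, y))" by (rule integral_distr) measurable
    also have "\<dots> = 0" using curve_mean[OF y, of i] by (simp add: g_def prob_space)
    finally show "(\<integral>x. g (x, y) \<partial>?PX) = 0" .
  qed
  finally show "expectation ?f = 0" by simp
qed

lemma noise_window_mean_zero:
  "integrable M (\<lambda>\<omega>. noise i j \<omega> * indicator {s..t} (T i j \<omega>))"
  "expectation (\<lambda>\<omega>. noise i j \<omega> * indicator {s..t} (T i j \<omega>)) = 0"
proof -
  have iv: "indep_var borel (U i j) borel (\<lambda>\<omega>. indicator {s..t} (T i j \<omega>) :: real)"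
    by (rule source_indep_var[of "{Error i j}" "{Time i j}"]) (auto intro: U_source indicator_T_source)
  have u: "integrable M (\<lambda>\<omega>. U i j \<omega> * indicator {s..t} (T i j \<omega>))"
    by (rule indep_var_integrable[OF iv U_integrable expectation_indicator_T(2)])
  have "expectation (\<lambda>\<omega>. U i j \<omega> * indicator {s..t} (T i j \<omega>)) = 0"
    unfolding indep_var_lebesgue_integral[OF iv U_integrable expectation_indicator_T(2)] U_mean by simp
  moreover have eq: "noise i j \<omega> * indicator {s..t} (T i j \<omega>) =
      (Xs i \<omega> (T i j \<omega>) - \<mu> (T i j \<omega>)) * indicator {s..t} (T i j \<omega>) + U i j \<omega> * indicator {s..t} (T i j \<omega>)" for \<omega>
    by (simp add: noise_def algebra_simps)
  ultimately show "expectation (\<lambda>\<omega>. noise i j \<omega> * indicator {s..t} (T i j \<omega>)) = 0"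
    unfolding eq using centred_curve_window u by simp
  show "integrable M (\<lambda>\<omega>. noise i j \<omega> * indicator {s..t} (T i j \<omega>))"
    unfolding eq using centred_curve_window u by simp
qed

lemma window_sum_pos_neg:
  "window_sum (\<lambda>i j \<omega>. max 0 (noise i j \<omega>)) n i s t \<omega> - window_sum (\<lambda>i j \<omega>. max 0 (- noise i j \<omega>)) n i s t \<omega>
    = (1 / real (m n i)) * (\<Sum>j<m n i. noise i j \<omega> * indicator {s..t} (T i j \<omega>))"
  unfolding window_sum_def right_diff_distrib[symmetric] sum_subtractf[symmetric] left_diff_distrib[symmetric]
  by (intro arg_cong2[of _ _ _ _ "(*)"] refl sum.cong) (auto simp: max_def)

lemma uniform_window_sum_deviation:
  assumes "\<And>i j. Z i j \<in> borel_measurable (source_sigma (row i))" "\<And>i j \<omega>. 0 \<le> Z i j \<omega>"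
    and "AE \<omega> in M. \<forall>i j. Z i j \<omega> \<le> env i j \<omega>"
  shows "AE \<omega> in M. \<exists>C. \<forall>\<^sub>F n in sequentially. on_short_windows a b (h n) (\<lambda>s t.
      \<bar>mean_deviation Z n s t \<omega>\<bar> \<le> C * window_rate m h n)"
  by (rule interval_array.uniform_interval_deviation[OF interval_array_window_sum[OF assms]])

lemma window_sum_integrable:
  assumes "\<And>i j. Z i j \<in> borel_measurable (source_sigma (row i))" "\<And>i j \<omega>. 0 \<le> Z i j \<omega>"
    and "AE \<omega> in M. \<forall>i j. Z i j \<omega> \<le> env i j \<omega>" and "i < n"
  shows "integrable M (window_sum Z n i s t)"
  by (rule interval_array.D_int[OF interval_array_window_sum[OF assms(1-3)] assms(4)])

text \<open>The interval sums of the positive and of the negative part of the noise have the same mean, so their deviations can be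
subtracted without a centring term.\<close>

lemma uniform_noise_windows:
  "AE \<omega> in M. \<exists>C. \<forall>\<^sub>F n in sequentially. on_short_windows a b (h n) (\<lambda>s t.
      \<bar>(1 / real n) * (\<Sum>i<n. (1 / real (m n i)) * (\<Sum>j<m n i. noise i j \<omega> * indicator {s..t} (T i j \<omega>)))\<bar>
       \<le> C * window_rate m h n)"
proof -
  let ?P = "\<lambda>i j \<omega>. max 0 (noise i j \<omega>)" and ?N = "\<lambda>i j \<omega>. max 0 (- noise i j \<omega>)"
  note [measurable] = noise_source
  have P: "?P i j \<in> borel_measurable (source_sigma (row i))" and N: "?N i j \<in> borel_measurable (source_sigma (row i))" for i j
    by measurable
  have Ple: "AE \<omega> in M. \<forall>i j. ?P i j \<omega> \<le> env i j \<omega>"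
    using AE_noise_le_env by eventually_elim (use env_nonneg in \<open>force simp: abs_le_iff\<close>)
  have Nle: "AE \<omega> in M. \<forall>i j. ?N i j \<omega> \<le> env i j \<omega>"
    using AE_noise_le_env by eventually_elim (use env_nonneg in \<open>force simp: abs_le_iff\<close>)
  have mean: "expectation (window_sum ?P n i s t) = expectation (window_sum ?N n i s t)" if i: "i < n" for n i s t
  proof -
    have "expectation (window_sum ?P n i s t) - expectation (window_sum ?N n i s t)
        = expectation (\<lambda>\<omega>. window_sum ?P n i s t \<omega> - window_sum ?N n i s t \<omega>)"
      using window_sum_integrable[OF P _ Ple i] window_sum_integrable[OF N _ Nle i] by simp
    also have "\<dots> = 0" unfolding window_sum_pos_neg integral_mult_right_zero
      by (subst Bochner_Integration.integral_sum)
        (simp_all only: noise_window_mean_zero sum.neutral_const mult_zero_right)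
    finally show ?thesis by simp
  qed
  have dP: "AE \<omega> in M. \<exists>C. \<forall>\<^sub>F n in sequentially. on_short_windows a b (h n) (\<lambda>s t.
      \<bar>mean_deviation ?P n s t \<omega>\<bar> \<le> C * window_rate m h n)"
    by (rule uniform_window_sum_deviation[OF P _ Ple]) simp
  have dN: "AE \<omega> in M. \<exists>C. \<forall>\<^sub>F n in sequentially. on_short_windows a b (h n) (\<lambda>s t.
      \<bar>mean_deviation ?N n s t \<omega>\<bar> \<le> C * window_rate m h n)"
    by (rule uniform_window_sum_deviation[OF N _ Nle]) simp
  from dP dN show ?thesis
  proof eventually_elim
    case (elim \<omega>)
    then obtain C1 C2 where C:
      "\<forall>\<^sub>F n in sequentially. on_short_windows a b (h n) (\<lambda>s t.
      \<bar>mean_deviation ?P n s t \<omega>\<bar> \<le> C1 * window_rate m h n)"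
      "\<forall>\<^sub>F n in sequentially. on_short_windows a b (h n) (\<lambda>s t.
      \<bar>mean_deviation ?N n s t \<omega>\<bar> \<le> C2 * window_rate m h n)"
      by blast
    show ?case
    proof (rule exI[of _ "C1 + C2"], use C in eventually_elim, intro allI impI)
      fix n s t
      assume b1: "on_short_windows a b (h n) (\<lambda>s t.
      \<bar>mean_deviation ?P n s t \<omega>\<bar> \<le> C1 * window_rate m h n)"
        and b2: "on_short_windows a b (h n) (\<lambda>s t.
      \<bar>mean_deviation ?N n s t \<omega>\<bar> \<le> C2 * window_rate m h n)"
        and st: "a \<le> s" "s \<le> t" "t \<le> b" "t - s \<le> 2 * h n"
      have "(1 / real n) * (\<Sum>i<n. (1 / real (m n i)) * (\<Sum>j<m n i. noise i j \<omega> * indicator {s..t} (T i j \<omega>)))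
        = mean_deviation ?P n s t \<omega>
          - mean_deviation ?N n s t \<omega>"
        unfolding window_sum_pos_neg[symmetric] right_diff_distrib[symmetric] sum_subtractf[symmetric]
        using mean by (intro arg_cong2[of _ _ _ _ "(*)"] refl sum.cong) auto
      then show "\<bar>(1 / real n) * (\<Sum>i<n. (1 / real (m n i)) * (\<Sum>j<m n i. noise i j \<omega> * indicator {s..t} (T i j \<omega>)))\<bar>
         \<le> (C1 + C2) * window_rate m h n"
        using b1[rule_format, OF st] b2[rule_format, OF st] unfolding distrib_right by linarith
    qed
  qed
qed

lemma uniform_design_windows:
  "AE \<omega> in M. \<exists>C. \<forall>\<^sub>F n in sequentially. on_short_windows a b (h n) (\<lambda>s t.
      c\<^sub>T * (t - s) - C * window_rate m h n
       \<le> (1 / real n) * (\<Sum>i<n. (1 / real (m n i)) * (\<Sum>j<m n i. indicator {s..t} (T i j \<omega>))) \<and>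
     (1 / real n) * (\<Sum>i<n. (1 / real (m n i)) * (\<Sum>j<m n i. indicator {s..t} (T i j \<omega>)))
       \<le> C\<^sub>T * (t - s) + C * window_rate m h n)"
proof -
  let ?O = "\<lambda>(i::nat) (j::nat) (\<omega>::'w). 1 :: real"
  have ws: "window_sum ?O n i s t \<omega> = (1 / real (m n i)) * (\<Sum>j<m n i. indicator {s..t} (T i j \<omega>))" for n i s t \<omega>
    by (simp add: window_sum_def)
  have le: "AE \<omega> in M. \<forall>i j. ?O i j \<omega> \<le> env i j \<omega>"
    using curve_env_ge_1 by (intro AE_I2) (auto simp: env_def intro: add_increasing2)
  have E: "c\<^sub>T * (t - s) \<le> expectation (window_sum ?O n i s t)" "expectation (window_sum ?O n i s t) \<le> C\<^sub>T * (t - s)"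
    if i: "i < n" and st: "a \<le> s" "s \<le> t" "t \<le> b" for n i s t
  proof -
    have mp: "real (m n i) > 0" using m_ge_2[OF i] by simp
    have eq: "expectation (window_sum ?O n i s t) = (1 / real (m n i)) * (\<Sum>j<m n i. prob (T i j -` {s..t} \<inter> space M))"
      unfolding ws[abs_def] integral_mult_right_zero
      by (subst Bochner_Integration.integral_sum) (simp_all only: expectation_indicator_T)
    have const: "(1 / real (m n i)) * (\<Sum>j<m n i. x) = x" for x using mp by simp
    have "(1 / real (m n i)) * (\<Sum>j<m n i. c\<^sub>T * (t - s)) \<le> expectation (window_sum ?O n i s t)"
      unfolding eq using density_bounds st by (intro mult_left_mono sum_mono T_probability_ge) auto
    then show "c\<^sub>T * (t - s) \<le> expectation (window_sum ?O n i s t)" unfolding const .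
    have "expectation (window_sum ?O n i s t) \<le> (1 / real (m n i)) * (\<Sum>j<m n i. C\<^sub>T * (t - s))"
      unfolding eq using T_interval_prob[OF st(2)] by (intro mult_left_mono sum_mono) auto
    then show "expectation (window_sum ?O n i s t) \<le> C\<^sub>T * (t - s)" unfolding const .
  qed
  have "AE \<omega> in M. \<exists>C. \<forall>\<^sub>F n in sequentially. on_short_windows a b (h n) (\<lambda>s t.
      \<bar>mean_deviation ?O n s t \<omega>\<bar> \<le> C * window_rate m h n)"
    by (rule uniform_window_sum_deviation[OF _ _ le]) auto
  then show ?thesis
  proof eventually_elim
    case (elim \<omega>)
    then obtain C where C: "\<forall>\<^sub>F n in sequentially. on_short_windows a b (h n) (\<lambda>s t.
      \<bar>mean_deviation ?O n s t \<omega>\<bar> \<le> C * window_rate m h n)"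
      by blast
    show ?case
      unfolding ws[symmetric]
    proof (rule exI[of _ C], use C eventually_gt_at_top[of 0] in eventually_elim, intro allI impI)
      fix n :: nat and s t
      assume b: "on_short_windows a b (h n) (\<lambda>s t.
      \<bar>mean_deviation ?O n s t \<omega>\<bar> \<le> C * window_rate m h n)"
        and n: "0 < n" and st: "a \<le> s" "s \<le> t" "t \<le> b" "t - s \<le> 2 * h n"
      define e where "e = (1 / real n) * (\<Sum>i<n. expectation (window_sum ?O n i s t))"
      have const: "(1 / real n) * (\<Sum>i<n. x) = x" for x using n by simp
      have "(1 / real n) * (\<Sum>i<n. c\<^sub>T * (t - s)) \<le> e" "e \<le> (1 / real n) * (\<Sum>i<n. C\<^sub>T * (t - s))"
        unfolding e_def using E st by (auto intro!: mult_left_mono sum_mono divide_right_mono simp del: sum_constant)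
      then have "c\<^sub>T * (t - s) \<le> e" "e \<le> C\<^sub>T * (t - s)" unfolding const .
      moreover have "\<bar>(1 / real n) * (\<Sum>i<n. window_sum ?O n i s t \<omega>) - e\<bar> \<le> C * window_rate m h n"
        using b[rule_format, OF st] unfolding e_def right_diff_distrib[symmetric] sum_subtractf[symmetric] .
      ultimately show "c\<^sub>T * (t - s) - C * window_rate m h n \<le> (1 / real n) * (\<Sum>i<n. window_sum ?O n i s t \<omega>) \<and>
          (1 / real n) * (\<Sum>i<n. window_sum ?O n i s t \<omega>) \<le> C\<^sub>T * (t - s) + C * window_rate m h n"
        by linarith
    qed
  qed
qed

end

section \<open>The uniform rate of the local linear estimator\<close>

lemma minimizer_weighted_sum:
  assumes "is_arg_min (local_linear_loss K h n k \<tau> y t) (\<lambda>_. True) (a0, a1)"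
  shows "(\<Sum>(i, j)\<in>Sigma {..<n} (\<lambda>i. {..<k i}). 1 / (real n * real (k i)) *
        ((y i j - a0 - a1 * (\<tau> i j - t))\<^sup>2 * scaled_kernel K h (\<tau> i j - t)))
    \<le> (\<Sum>(i, j)\<in>Sigma {..<n} (\<lambda>i. {..<k i}). 1 / (real n * real (k i)) *
        ((y i j - c0 - c1 * (\<tau> i j - t))\<^sup>2 * scaled_kernel K h (\<tau> i j - t)))"
proof -
  have "local_linear_loss K h n k \<tau> y t (a0, a1) \<le> local_linear_loss K h n k \<tau> y t (c0, c1)"
    using assms unfolding is_arg_min_def by (meson linorder_not_less)
  then show ?thesis unfolding local_linear_loss_def prod.case double_average_eq_sum_Sigma .
qed

text \<open>Symmetry moves an interval on which K is bounded below to the nonnegative half line. Near the right end of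
[a, b] the reflected interval is used, so one side of the window around t always lies within [a, b].\<close>

lemma symmetric_kernel_interval:
  assumes C2: "condition_C2 K"
  obtains p l \<kappa> where "0 \<le> p" "0 < l" "l \<le> 1" "p + 3 * l \<le> 1" "\<kappa> > 0"
    "\<And>u. u \<in> {p..p + 3 * l} \<Longrightarrow> \<kappa> \<le> K u"
proof -
  have K0: "\<And>u. 0 \<le> K u" and sym: "\<And>u. K (- u) = K u" and out: "\<And>u. u \<notin> {-1..1} \<Longrightarrow> K u = 0"
    and int: "has_bochner_integral lborel K 1" and bv: "bounded_variation_on K (-1) 1"
    using C2 unfolding condition_C2_def by blast+
  have "\<not> (AE x in lborel. x \<in> {-1..1} \<longrightarrow> K x \<le> 0)"
  proof
    assume "AE x in lborel. x \<in> {-1..1} \<longrightarrow> K x \<le> 0"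
    then have "AE x in lborel. K x = 0"
      by eventually_elim (use K0 out in \<open>meson order_antisym\<close>)
    then have "integral\<^sup>L lborel K = 0" by (rule integral_eq_zero_AE)
    then show False using int by (simp add: has_bochner_integral_integral_eq)
  qed
  then obtain p0 q0 \<kappa> where pq: "-1 \<le> p0" "p0 < q0" "q0 \<le> 1" "\<kappa> > 0" and low: "\<And>u. u \<in> {p0..q0} \<Longrightarrow> \<kappa> \<le> K u"
    using bounded_variation_positive_interval[OF bv] by metis
  obtain p q where pq': "0 \<le> p" "p < q" "q \<le> 1" "\<And>u. u \<in> {p..q} \<Longrightarrow> \<kappa> \<le> K u"
  proof (cases "0 < q0")
    case True
    show ?thesis by (rule that[of "max 0 p0" q0]) (use True pq low in auto)
  next
    case False
    have "\<kappa> \<le> K u" if "u \<in> {- q0..- p0}" for u using low[of "- u"] sym[of u] that by auto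
    then show ?thesis by (intro that[of "- q0" "- p0"]) (use False pq in auto)
  qed
  define l where "l = (q - p) / 3"
  have q: "q = p + 3 * l" by (simp add: l_def diff_divide_distrib)
  show ?thesis using pq' \<open>\<kappa> > 0\<close> unfolding q by (intro that[of p l \<kappa>]) auto
qed

lemma sum_indicator_filter:
  fixes w :: "'k \<Rightarrow> real"
  assumes "finite A"
  shows "(\<Sum>k\<in>A. w k * indicator I (\<tau> k)) = (\<Sum>k\<in>{k\<in>A. \<tau> k \<in> I}. w k)"
  unfolding sum.inter_filter[OF assms] by (intro sum.cong) (auto simp: indicator_def)

context functional_data_moments
begin

theorem local_linear_uniform_rate:
  assumes est: "is_local_linear_estimator M a b Xs T U m K h \<mu>hat"
    and C2: "condition_C2 K" and C3: "condition_C3 a b \<mu>"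
  shows "AE \<omega> in M. \<exists>C. \<forall>\<^sub>F n in sequentially. \<forall>t\<in>{a..b}.
     \<bar>\<mu>hat n \<omega> t - \<mu> t\<bar> \<le> C * ((h n)\<^sup>2 + delta_n1 m n (h n))"
  using uniform_noise_windows uniform_design_windows AE_space
proof eventually_elim
  case (elim \<omega>)
  then obtain C1 C2 where
    noise: "\<forall>\<^sub>F n in sequentially. on_short_windows a b (h n) (\<lambda>s t.
      \<bar>(1 / real n) * (\<Sum>i<n. (1 / real (m n i)) * (\<Sum>j<m n i. noise i j \<omega> * indicator {s..t} (T i j \<omega>)))\<bar>
       \<le> C1 * window_rate m h n)"
    and design: "\<forall>\<^sub>F n in sequentially. on_short_windows a b (h n) (\<lambda>s t.
      c\<^sub>T * (t - s) - C2 * window_rate m h n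
       \<le> (1 / real n) * (\<Sum>i<n. (1 / real (m n i)) * (\<Sum>j<m n i. indicator {s..t} (T i j \<omega>))) \<and>
     (1 / real n) * (\<Sum>i<n. (1 / real (m n i)) * (\<Sum>j<m n i. indicator {s..t} (T i j \<omega>)))
       \<le> C\<^sub>T * (t - s) + C2 * window_rate m h n)"
    and sp: "\<omega> \<in> space M" by blast
  have K0: "\<And>u. 0 \<le> K u" and sym: "\<And>u. K (- u) = K u" and out: "\<And>u. u \<notin> {-1..1} \<Longrightarrow> K u = 0"
    and bv: "bounded_variation_on K (-1) 1"
    using C2 unfolding condition_C2_def by blast+
  obtain p l \<kappa> where pl: "0 \<le> p" "0 < l" "l \<le> 1" "p + 3 * l \<le> 1" "\<kappa> > 0"
    and Klow: "\<And>u. u \<in> {p..p + 3 * l} \<Longrightarrow> \<kappa> \<le> K u"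
    using symmetric_kernel_interval[OF C2] by metis
  obtain V0 where V0: "\<And>(N::nat) x. mono_on {..N} x \<Longrightarrow> x ` {..N} \<subseteq> {-1..1} \<Longrightarrow>
      (\<Sum>l<N. \<bar>K (x (Suc l)) - K (x l)\<bar>) \<le> V0"
    using bv unfolding bounded_variation_on_def by blast
  obtain V1 where V1: "\<And>(N::nat) x. mono_on {..N} x \<Longrightarrow> x ` {..N} \<subseteq> {-1..1} \<Longrightarrow>
      (\<Sum>l<N. \<bar>x (Suc l) * K (x (Suc l)) - x l * K (x l)\<bar>) \<le> V1"
    using bounded_variation_on_times_id[OF bv] unfolding bounded_variation_on_def by blast
  obtain G where G0: "0 \<le> G" and G: "\<And>x. x \<in> {-1..1} \<Longrightarrow> \<bar>K x\<bar> \<le> G"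
    using bounded_variation_on_bounded[OF bv] by blast
  have KG: "K u \<le> G" for u using G[of u] out[of u] G0 by (cases "u \<in> {-1..1}") auto
  obtain L \<mu>' where L: "0 \<le> L" and taylor:
    "\<And>s t. s \<in> {a..b} \<Longrightarrow> t \<in> {a..b} \<Longrightarrow> \<bar>\<mu> s - \<mu> t - \<mu>' t * (s - t)\<bar> \<le> L * (s - t)\<^sup>2"
    by (rule second_order_taylor_bound[OF C3]) (rule that)
  define W where "W = G + \<bar>V0\<bar> + \<bar>V1\<bar>"
  define c where "c = c\<^sub>T * l / 2"
  have c: "c > 0" using density_bounds(3) pl by (simp add: c_def)
  define B where "B = 2 * C\<^sub>T + 1"
  define F where "F = 4 / (\<kappa> * c * (l / 6)\<^sup>2)"
  have F0: "0 \<le> F" using pl c by (simp add: F_def)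
  define C where "C = F * (W * \<bar>C1\<bar> + G * L * B)"
  have delta0: "(\<lambda>n. delta_n1 m n (h n)) \<longlonglongrightarrow> 0"
    by (rule delta_n1_tendsto_0[OF h_pos h_lim \<rho> m_ge_2 bandwidth])
  have C2delta0: "(\<lambda>n. \<bar>C2\<bar> * delta_n1 m n (h n)) \<longlonglongrightarrow> 0" using tendsto_mult_left[OF delta0, of "\<bar>C2\<bar>"] by simp
  have dsmall: "\<forall>\<^sub>F n in sequentially. \<bar>C2\<bar> * delta_n1 m n (h n) < min c 1"
    by (rule order_tendstoD(2)[OF C2delta0]) (use c in simp)
  have hsmall: "\<forall>\<^sub>F n in sequentially. h n < (b - a) / 2"
    using order_tendstoD(2)[OF h_lim, of "(b - a) / 2"] interval by simp
  have rates_hold: "\<forall>\<^sub>F n in sequentially. n \<ge> 3 \<and> window_var m h n > 0 \<and> window_rate m h n > 0 \<and>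
      1 / real n \<le> window_rate m h n \<and> 1 / real n \<le> h n \<and>
      (window_var m h n / window_rate m h n) powr (1 - \<rho>) \<le> window_rate m h n"
    by (rule window_rates_eventually[OF h_pos h_lim \<rho> m_ge_2 bandwidth])
  have "\<forall>\<^sub>F n in sequentially. \<forall>t\<in>{a..b}. \<bar>\<mu>hat n \<omega> t - \<mu> t\<bar> \<le> C * ((h n)\<^sup>2 + delta_n1 m n (h n))"
    using noise design dsmall hsmall rates_hold
  proof eventually_elim
    case (elim n)
    have n: "n \<ge> 1" and r0: "0 < window_rate m h n" using elim(5) by auto
    define H where "H = h n"
    define r where "r = window_rate m h n"
    have H: "0 < H" "H < (b - a) / 2" using h_pos elim(4) by (auto simp: H_def)
    have rH: "r = H * delta_n1 m n H"
      using window_rate_over_bandwidth[where h = h and n = n and m = m, OF h_pos] H by (simp add: r_def H_def field_simps)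
    have r: "0 < r" using r0 by (simp add: r_def)
    have d0: "0 < delta_n1 m n H" using r H unfolding rH by (simp add: zero_less_mult_iff)
    have C2r: "\<bar>C2\<bar> * r \<le> c * H" "\<bar>C2\<bar> * r \<le> H"
    proof -
      have "\<bar>C2\<bar> * delta_n1 m n H \<le> c" "\<bar>C2\<bar> * delta_n1 m n H \<le> 1" using elim(3) by (auto simp: H_def)
      from mult_right_mono[OF this(1), of H] mult_right_mono[OF this(2), of H] H
      show "\<bar>C2\<bar> * r \<le> c * H" "\<bar>C2\<bar> * r \<le> H" by (simp_all add: rH mult_ac)
    qed
    have C2r': "C2 * r \<le> c * H" "C2 * r \<le> H"
      using C2r r abs_ge_self[of C2] by (auto intro: order.trans[OF mult_right_mono])
    define A where "A = Sigma {..<n} (\<lambda>i. {..<m n i})"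
    have fin: "finite A" by (simp add: A_def)
    define v where "v k = 1 / (real n * real (m n (fst k)))" for k :: "nat \<times> nat"
    define \<tau> where "\<tau> k = T (fst k) (snd k) \<omega>" for k
    define \<zeta> where "\<zeta> k = noise (fst k) (snd k) \<omega>" for k
    define y where "y k = observation Xs T U (fst k) (snd k) \<omega>" for k
    have v0: "0 \<le> v k" for k by (simp add: v_def)
    have \<tau>ab: "\<tau> k \<in> {a..b}" for k unfolding \<tau>_def by (rule T_range[OF sp])
    have y: "y k = \<mu> (\<tau> k) + \<zeta> k" for k by (simp add: y_def \<tau>_def \<zeta>_def observation_def noise_def)
    have as_sum: "(1 / real n) * (\<Sum>i<n. (1 / real (m n i)) * (\<Sum>j<m n i. g i j * indicator I (T i j \<omega>)))
        = (\<Sum>k\<in>{k\<in>A. \<tau> k \<in> I}. v k * g (fst k) (snd k))" for g :: "nat \<Rightarrow> nat \<Rightarrow> real" and I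
    proof -
      have "(1 / real n) * (\<Sum>i<n. (1 / real (m n i)) * (\<Sum>j<m n i. g i j * indicator I (T i j \<omega>)))
          = (\<Sum>k\<in>A. (v k * g (fst k) (snd k)) * indicator I (\<tau> k))"
        unfolding double_average_eq_sum_Sigma A_def v_def \<tau>_def by (simp add: case_prod_beta' mult_ac)
      then show ?thesis unfolding sum_indicator_filter[OF fin] .
    qed
    have count_sum: "(1 / real n) * (\<Sum>i<n. (1 / real (m n i)) * (\<Sum>j<m n i. indicator I (T i j \<omega>)))
        = (\<Sum>k\<in>{k\<in>A. \<tau> k \<in> I}. v k)" for I
      using as_sum[of "\<lambda>i j. 1" I] by (simp only: mult_1_left mult_1_right)
    have "\<tau> k \<in> {s..t} \<longleftrightarrow> \<tau> k \<in> {max s a..min t b}" for k s t using \<tau>ab[of k] by auto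
    \<comment> \<open>Observation times lie in [a, b], so windows reaching beyond it may be cut off.\<close>
    then have clip: "{k\<in>A. \<tau> k \<in> {s..t}} = {k\<in>A. \<tau> k \<in> {max s a..min t b}}" for s t by simp
    have len_clip: "min t b - max s a \<le> t - s" for s t by auto
    have noise_inner: "\<bar>\<Sum>k\<in>{k\<in>A. \<tau> k \<in> {s..t}}. v k * \<zeta> k\<bar> \<le> C1 * r"
      if "a \<le> s" "s \<le> t" "t \<le> b" "t - s \<le> 2 * H" for s t
    proof -
      have "\<bar>(1 / real n) * (\<Sum>i<n. (1 / real (m n i)) * (\<Sum>j<m n i. noise i j \<omega> * indicator {s..t} (T i j \<omega>)))\<bar>
          \<le> C1 * window_rate m h n"
        using elim(1) that unfolding H_def by blast
      then show ?thesis by (simp only: as_sum \<zeta>_def r_def)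
    qed
    have noise_window: "\<bar>\<Sum>k\<in>{k\<in>A. \<tau> k \<in> {s..t}}. v k * \<zeta> k\<bar> \<le> \<bar>C1\<bar> * r" if st: "t - s \<le> 2 * H" for s t
    proof (cases "max s a \<le> min t b")
      case True
      have "\<bar>\<Sum>k\<in>{k\<in>A. \<tau> k \<in> {max s a..min t b}}. v k * \<zeta> k\<bar> \<le> C1 * r"
        using order.trans[OF len_clip st] by (intro noise_inner True) simp_all
      also have "\<dots> \<le> \<bar>C1\<bar> * r" using r by (intro mult_right_mono) auto
      finally show ?thesis unfolding clip[of s t] .
    next
      case False
      then have e: "{k\<in>A. \<tau> k \<in> {s..t}} = {}" unfolding clip[of s t] by auto
      show ?thesis unfolding e using r by simp
    qed
    have design_inner: "c\<^sub>T * (t - s) - C2 * r \<le> (\<Sum>k\<in>{k\<in>A. \<tau> k \<in> {s..t}}. v k)"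
      "(\<Sum>k\<in>{k\<in>A. \<tau> k \<in> {s..t}}. v k) \<le> C\<^sub>T * (t - s) + C2 * r"
      if "a \<le> s" "s \<le> t" "t \<le> b" "t - s \<le> 2 * H" for s t
    proof -
      have "c\<^sub>T * (t - s) - C2 * window_rate m h n
           \<le> (1 / real n) * (\<Sum>i<n. (1 / real (m n i)) * (\<Sum>j<m n i. indicator {s..t} (T i j \<omega>))) \<and>
         (1 / real n) * (\<Sum>i<n. (1 / real (m n i)) * (\<Sum>j<m n i. indicator {s..t} (T i j \<omega>)))
           \<le> C\<^sub>T * (t - s) + C2 * window_rate m h n"
        using elim(2) that unfolding H_def by blast
      then show "c\<^sub>T * (t - s) - C2 * r \<le> (\<Sum>k\<in>{k\<in>A. \<tau> k \<in> {s..t}}. v k)"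
        "(\<Sum>k\<in>{k\<in>A. \<tau> k \<in> {s..t}}. v k) \<le> C\<^sub>T * (t - s) + C2 * r"
        by (simp_all only: count_sum r_def)
    qed
    have design_le: "(\<Sum>k\<in>{k\<in>A. \<tau> k \<in> {s..t}}. v k) \<le> C\<^sub>T * (t - s) + H" if st: "s \<le> t" "t - s \<le> 2 * H" for s t
    proof (cases "max s a \<le> min t b")
      case True
      have "(\<Sum>k\<in>{k\<in>A. \<tau> k \<in> {max s a..min t b}}. v k) \<le> C\<^sub>T * (min t b - max s a) + C2 * r"
        using order.trans[OF len_clip st(2)] by (intro design_inner True) simp_all
      also have "\<dots> \<le> C\<^sub>T * (t - s) + H"
        using C2r'(2) C\<^sub>T_nonneg len_clip by (intro add_mono mult_left_mono)
      finally show ?thesis unfolding clip[of s t] .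
    next
      case False
      then have e: "{k\<in>A. \<tau> k \<in> {s..t}} = {}" unfolding clip[of s t] by auto
      show ?thesis unfolding e using H C\<^sub>T_nonneg st by simp
    qed
    have design_ge: "c * H \<le> (\<Sum>k\<in>{k\<in>A. \<tau> k \<in> {s..t}}. v k)" if st: "a \<le> s" "t \<le> b" "t - s = l * H" for s t
    proof -
      have lH: "0 \<le> l * H" "l * H \<le> 1 * H" using pl H by (auto intro: mult_right_mono)
      have "c\<^sub>T * (t - s) - C2 * r \<le> (\<Sum>k\<in>{k\<in>A. \<tau> k \<in> {s..t}}. v k)"
        using st lH H by (intro design_inner) linarith+
      moreover have "c\<^sub>T * (t - s) = 2 * (c * H)" unfolding st(3) c_def by simp
      ultimately show ?thesis using C2r'(1) by linarith
    qed
    show ?case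
    proof
      fix t assume t: "t \<in> {a..b}"
      obtain a1 where argmin: "is_arg_min (local_linear_loss K H n (m n) (\<lambda>i j. T i j \<omega>)
          (\<lambda>i j. observation Xs T U i j \<omega>) t) (\<lambda>_. True) (\<mu>hat n \<omega> t, a1)"
        using est n sp t unfolding is_local_linear_estimator_def H_def by blast
      define u where "u k = (\<tau> k - t) / H" for k
      define A1 where "A1 = {k\<in>A. u k \<in> {-1..1}}"
      have u_le: "u k \<le> s \<longleftrightarrow> \<tau> k \<le> t + s * H" "s \<le> u k \<longleftrightarrow> t + s * H \<le> \<tau> k" for k s
        using H by (auto simp: u_def pos_divide_le_eq pos_le_divide_eq algebra_simps)
      \<comment> \<open>Intervals u k \<le> s with u k \<ge> - 1 are windows starting at t - H, of length at most 2 H.\<close>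
      have kernel_noise: "\<bar>\<Sum>k\<in>A. v k * g (u k) * \<zeta> k\<bar> \<le> H * (W * \<bar>C1\<bar> * delta_n1 m n H)"
        if var: "\<And>(N::nat) x. mono_on {..N} x \<Longrightarrow> x ` {..N} \<subseteq> {-1..1} \<Longrightarrow> (\<Sum>l<N. \<bar>g (x (Suc l)) - g (x l)\<bar>) \<le> V"
          and gG: "\<And>x. x \<in> {-1..1} \<Longrightarrow> \<bar>g x\<bar> \<le> G" and g0: "\<And>x. x \<notin> {-1..1} \<Longrightarrow> g x = 0"
          and VW: "G + V \<le> W" for g V
      proof -
        have "(\<Sum>k\<in>A. v k * g (u k) * \<zeta> k) = (\<Sum>k\<in>A1. (v k * \<zeta> k) * g (u k))"
          unfolding A1_def using fin g0 by (intro sum.mono_neutral_cong_right) (auto simp: mult_ac)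
        also have "\<bar>\<dots>\<bar> \<le> (G + V) * (\<bar>C1\<bar> * r)"
        proof (rule weighted_sum_le_variation[where A = A1 and u = u and w = "\<lambda>k. v k * \<zeta> k" and g = g
              and c = "-1" and d = 1 and V = V and G = G and B = "\<bar>C1\<bar> * r"])
          fix s :: real assume s: "s \<in> {-1..1}"
          have sH: "s * H \<le> 1 * H" using s H by (intro mult_right_mono) auto
          then have "{k\<in>A1. u k \<le> s} = {k\<in>A. \<tau> k \<in> {t + (-1) * H..t + s * H}}"
            unfolding A1_def by (auto simp: u_le)
          with sH show "\<bar>\<Sum>k\<in>{k\<in>A1. u k \<le> s}. v k * \<zeta> k\<bar> \<le> \<bar>C1\<bar> * r"
            using noise_window[of "t + s * H" "t + (-1) * H"] by simp
        qed (use fin var gG in \<open>auto simp: A1_def\<close>)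
        also have "\<dots> \<le> W * (\<bar>C1\<bar> * r)" using VW r by (intro mult_right_mono) auto
        finally show ?thesis by (simp add: rH mult_ac)
      qed
      have noise0: "\<bar>\<Sum>k\<in>A. v k * K ((\<tau> k - t) / H) * \<zeta> k\<bar> \<le> H * (W * \<bar>C1\<bar> * delta_n1 m n H)"
        unfolding u_def[symmetric] by (rule kernel_noise[of K V0]) (use V0 G out in \<open>auto simp: W_def\<close>)
      have noise1: "\<bar>\<Sum>k\<in>A. v k * ((\<tau> k - t) / H * K ((\<tau> k - t) / H)) * \<zeta> k\<bar> \<le> H * (W * \<bar>C1\<bar> * delta_n1 m n H)"
        unfolding u_def[symmetric]
      proof (rule kernel_noise[of "\<lambda>x. x * K x" V1])
        show "\<bar>x * K x\<bar> \<le> G" if "x \<in> {-1..1}" for x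
        proof -
          have "\<bar>x\<bar> * \<bar>K x\<bar> \<le> 1 * G" using that G by (intro mult_mono) auto
          then show ?thesis by (simp add: abs_mult)
        qed
      qed (use V1 out in \<open>auto simp: W_def\<close>)
      have up: "(\<Sum>k\<in>{k\<in>A. \<bar>\<tau> k - t\<bar> \<le> H}. v k) \<le> B * H"
      proof -
        have "{k\<in>A. \<bar>\<tau> k - t\<bar> \<le> H} = {k\<in>A. \<tau> k \<in> {t - H..t + H}}" by auto
        then have "(\<Sum>k\<in>{k\<in>A. \<bar>\<tau> k - t\<bar> \<le> H}. v k) \<le> C\<^sub>T * (2 * H) + H"
          using design_le[of "t - H" "t + H"] H by simp
        then show ?thesis by (simp add: B_def algebra_simps)
      qed
      \<comment> \<open>The half of the window around t that stays within [a, b]; one of them does since 2 H < b - a.\<close>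
      define sg where "sg = (if t + H \<le> b then 1 else -1 :: real)"
      have sg: "sg = 1 \<or> sg = -1" by (simp add: sg_def)
      have low: "c * H \<le> (\<Sum>k\<in>{k\<in>A. sg * ((\<tau> k - t) / H) \<in> {q..q + l}}. v k)" if q: "0 \<le> q" "q + l \<le> 1" for q
      proof (cases "t + H \<le> b")
        case True
        have e: "{k\<in>A. sg * ((\<tau> k - t) / H) \<in> {q..q + l}} = {k\<in>A. \<tau> k \<in> {t + q * H..t + (q + l) * H}}"
          using True u_le by (auto simp: sg_def u_def[symmetric])
        have "0 \<le> q * H" "(q + l) * H \<le> 1 * H" using q H by (auto intro: mult_right_mono)
        then show ?thesis unfolding e using True t by (intro design_ge) (auto simp: algebra_simps)
      next
        case False
        have flip: "- u k \<in> {q..q + l} \<longleftrightarrow> \<tau> k \<in> {t + (- (q + l)) * H..t + (- q) * H}" for k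
          proof -
          have "- u k \<in> {q..q + l} \<longleftrightarrow> - (q + l) \<le> u k \<and> u k \<le> - q" by auto
          then show ?thesis unfolding u_le by simp
        qed
        have e: "{k\<in>A. sg * ((\<tau> k - t) / H) \<in> {q..q + l}} = {k\<in>A. \<tau> k \<in> {t + (- (q + l)) * H..t + (- q) * H}}"
          using False flip by (auto simp: sg_def u_def[symmetric])
        have "0 \<le> q * H" "(q + l) * H \<le> 1 * H" using q H by (auto intro: mult_right_mono)
        then show ?thesis unfolding e using False t H by (intro design_ge) (auto simp: algebra_simps)
      qed
      have low1: "c * H \<le> (\<Sum>k\<in>{k\<in>A. sg * ((\<tau> k - t) / H) \<in> {p..p + l}}. v k)"
        using low[of p] pl by simp
      have "p + 2 * l + l = p + 3 * l" by simp
      with low[of "p + 2 * l"] pl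
      have low2: "c * H \<le> (\<Sum>k\<in>{k\<in>A. sg * ((\<tau> k - t) / H) \<in> {p + 2 * l..p + 3 * l}}. v k)"
        by (simp only:)
      have minimal: "(\<Sum>k\<in>A. v k * ((y k - \<mu>hat n \<omega> t - a1 * (\<tau> k - t))\<^sup>2 * scaled_kernel K H (\<tau> k - t)))
          \<le> (\<Sum>k\<in>A. v k * ((y k - \<mu> t - \<mu>' t * (\<tau> k - t))\<^sup>2 * scaled_kernel K H (\<tau> k - t)))"
        using minimizer_weighted_sum[OF argmin, of "\<mu> t" "\<mu>' t"]
        by (simp add: A_def v_def y_def \<tau>_def case_prod_beta')
      have Ksg: "\<kappa> \<le> K (sg * u)" if "u \<in> {p..p + 3 * l}" for u
        using Klow[OF that] sg sym by auto
      have "\<bar>\<mu>hat n \<omega> t - \<mu> t\<bar>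
          \<le> 4 * (W * \<bar>C1\<bar> * delta_n1 m n H + G * L * B * H\<^sup>2) / (\<kappa> * c * (l / 6)\<^sup>2)"
        by (rule local_linear_error_bound[where A = A and v = v and \<tau> = \<tau> and y = y and \<zeta> = \<zeta>
              and K = K and \<mu> = \<mu> and h = H and G = G and l = l and p = p and \<kappa> = \<kappa> and ?c1.0 = c
              and sg = sg and L = L and t = t and d = "\<mu>' t" and N = "W * \<bar>C1\<bar> * delta_n1 m n H"
              and ?C1.0 = B and ?a0.0 = "\<mu>hat n \<omega> t" and ?a1.0 = a1,
            OF fin v0 H(1) K0 KG out pl(2,3,1,4,5) c sg Ksg L y taylor[OF \<tau>ab t] noise0 noise1 up low1 low2 minimal])
      also have "\<dots> = F * (W * \<bar>C1\<bar> * delta_n1 m n H + G * L * B * H\<^sup>2)" by (simp add: F_def)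
      also have "\<dots> \<le> F * ((W * \<bar>C1\<bar> + G * L * B) * delta_n1 m n H + (W * \<bar>C1\<bar> + G * L * B) * H\<^sup>2)"
      proof (intro mult_left_mono add_mono mult_right_mono)
        show "W * \<bar>C1\<bar> \<le> W * \<bar>C1\<bar> + G * L * B" using G0 L C\<^sub>T_nonneg by (simp add: B_def)
        show "G * L * B \<le> W * \<bar>C1\<bar> + G * L * B" using G0 by (simp add: W_def)
      qed (use d0 F0 in auto)
      also have "\<dots> = C * (H\<^sup>2 + delta_n1 m n H)" by (simp add: C_def algebra_simps)
      finally show "\<bar>\<mu>hat n \<omega> t - \<mu> t\<bar> \<le> C * ((h n)\<^sup>2 + delta_n1 m n (h n))" by (simp add: H_def)
    qed
  qed
  then show ?case by blast
qed

end

theorem theorem3p1: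
  fixes M :: "'w measure"
    and a b \<sigma> :: real
    and S :: "(real \<Rightarrow> real) measure"
    and X :: "'w \<Rightarrow> real \<Rightarrow> real"
    and Xs :: "nat \<Rightarrow> 'w \<Rightarrow> real \<Rightarrow> real"
    and T U :: "nat \<Rightarrow> nat \<Rightarrow> 'w \<Rightarrow> real"
    and f\<^sub>T K :: "real \<Rightarrow> real"
    and m :: "nat \<Rightarrow> nat \<Rightarrow> nat"
    and h :: "nat \<Rightarrow> real"
    and \<mu>hat :: "nat \<Rightarrow> 'w \<Rightarrow> real \<Rightarrow> real"
  assumes "functional_data M a b S X Xs T U f\<^sub>T \<sigma> m"
    and "\<And>n. h n > 0"
    and "is_local_linear_estimator M a b Xs T U m K h \<mu>hat"
    and "condition_C1 a b f\<^sub>T"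
    and "condition_C2 K"
    and "condition_C3 a b (mean_function M X)"
    and "condition_C5 M a b X U m h"
  shows "AE \<omega> in M.
      (\<forall>\<^sub>F n in sequentially. bdd_above ((\<lambda>t. \<bar>\<mu>hat n \<omega> t - mean_function M X t\<bar>) ` {a..b})) \<and>
      (\<lambda>n. SUP t\<in>{a..b}. \<bar>\<mu>hat n \<omega> t - mean_function M X t\<bar>)
        \<in> O(\<lambda>n. (h n)\<^sup>2 + delta_n1 m n (h n))"
proof -
  interpret functional_data M a b S X Xs T U f\<^sub>T \<sigma> m by (rule assms(1))
  obtain c\<^sub>T C\<^sub>T where T: "0 < c\<^sub>T" "\<And>t. t \<in> {a..b} \<Longrightarrow> c\<^sub>T \<le> f\<^sub>T t" "\<And>t. t \<in> {a..b} \<Longrightarrow> f\<^sub>T t \<le> C\<^sub>T"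
    using assms(4) unfolding condition_C1_def by blast
  obtain \<rho> where \<rho>: "2 < \<rho>" "\<And>i j. integrable M (\<lambda>\<omega>. \<bar>U i j \<omega>\<bar> powr \<rho>)"
    "(\<integral>\<^sup>+\<omega>. (SUP t\<in>{a..b}. ennreal (\<bar>X \<omega> t\<bar> powr \<rho>)) \<partial>M) < \<infinity>" "h \<longlonglongrightarrow> 0"
    "(\<lambda>n. inverse ((h n)\<^sup>2 + h n / gamma_n m n 1) * (ln (real n) / real n) powr (1 - 2 / \<rho>)) \<longlonglongrightarrow> 0"
    using assms(7) unfolding condition_C5_def by blast
  have cont: "continuous_on {a..b} (mean_function M X)"
    using assms(6) unfolding condition_C3_def
    by (auto simp: continuous_on_eq_continuous_within intro: DERIV_continuous)
  have "compact (mean_function M X ` {a..b})" by (rule compact_continuous_image[OF cont]) simp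
  then obtain C\<^sub>\<mu> where mu: "\<forall>t\<in>{a..b}. \<bar>mean_function M X t\<bar> \<le> C\<^sub>\<mu>"
    using compact_imp_bounded[of "mean_function M X ` {a..b}"] unfolding bounded_iff by auto
  interpret functional_data_moments M a b S X Xs T U f\<^sub>T \<sigma> m h \<rho> c\<^sub>T C\<^sub>T C\<^sub>\<mu>
    by unfold_locales (use assms(2) \<rho> T cont mu in auto)
  show ?thesis
    using local_linear_uniform_rate[OF assms(3,5,6)]
  proof eventually_elim
    case (elim \<omega>)
    then obtain C where C: "\<forall>\<^sub>F n in sequentially. \<forall>t\<in>{a..b}.
        \<bar>\<mu>hat n \<omega> t - mean_function M X t\<bar> \<le> C * ((h n)\<^sup>2 + delta_n1 m n (h n))" by blast
    have ne: "{a..b} \<noteq> {}" using interval by simp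
    have bdd: "\<forall>\<^sub>F n in sequentially. bdd_above ((\<lambda>t. \<bar>\<mu>hat n \<omega> t - mean_function M X t\<bar>) ` {a..b})"
      using C by eventually_elim (auto intro!: bdd_aboveI2)
    have "\<forall>\<^sub>F n in sequentially. norm (SUP t\<in>{a..b}. \<bar>\<mu>hat n \<omega> t - mean_function M X t\<bar>)
        \<le> \<bar>C\<bar> * norm ((h n)\<^sup>2 + delta_n1 m n (h n))"
      using C bdd
    proof eventually_elim
      case (elim n)
      have "0 \<le> \<bar>\<mu>hat n \<omega> a - mean_function M X a\<bar>" by simp
      also have "\<dots> \<le> (SUP t\<in>{a..b}. \<bar>\<mu>hat n \<omega> t - mean_function M X t\<bar>)"
        using interval by (intro cSUP_upper elim(2)) auto
      finally have "norm (SUP t\<in>{a..b}. \<bar>\<mu>hat n \<omega> t - mean_function M X t\<bar>)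
          = (SUP t\<in>{a..b}. \<bar>\<mu>hat n \<omega> t - mean_function M X t\<bar>)" by simp
      also have "\<dots> \<le> C * ((h n)\<^sup>2 + delta_n1 m n (h n))" using elim(1) by (intro cSUP_least ne) auto
      also have "\<dots> \<le> \<bar>C\<bar> * norm ((h n)\<^sup>2 + delta_n1 m n (h n))"
        by (metis abs_ge_self abs_mult real_norm_def)
      finally show ?case .
    qed
    then have "(\<lambda>n. SUP t\<in>{a..b}. \<bar>\<mu>hat n \<omega> t - mean_function M X t\<bar>)
        \<in> O(\<lambda>n. (h n)\<^sup>2 + delta_n1 m n (h n))" by (rule bigoI)
    with bdd show ?case by simp
  qed
qed

end
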